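(* Let $m\ge1$ and $n\ge0$ be integers such that $M=m-2n\in-2\mathbb N_0=\{0,-2,-4,\ldots\}$, and let $k\in I_M=[2-M/2,\,2-M]\cap\mathbb N_0$. Then, under the action of $\mathfrak{osp}(m-1|2n)$, the space $\tilde{\mathcal H}_k=\tilde{\mathcal H}_k(\mathbb R^{m|2n})$ has the irreducible decomposition $$\tilde{\mathcal H}_k\simeq\bigoplus_{\ell=0}^{2-M-k}2\,\underline{\mathcal H}_\ell\ \oplus\ \bigoplus_{\ell=3-M-k}^{k}\underline{\mathcal H}_\ell ,$$ where $\underline{\mathcal H}_\ell=\mathcal H_\ell(\mathbb R^{m-1|2n})$ and $2\,\underline{\mathcal H}_\ell$ denotes the direct sum of two copies of $\underline{\mathcal H}_\ell$.
   Context: For integers $m,n\ge0$, let $\mathcal P=\mathcal P(\mathbb R^{m|2n})=\mathbb R[x_1,\ldots,x_m]\otimes\Lambda(\theta_1,\ldots,\theta_{2n})$ be the superalgebra of polynomials on $\mathbb R^{m|2n}$: $x_1,\dots,x_m$ are commuting (even) variables and $\theta_1,\dots,\theta_{2n}$ are anticommuting (odd) variables generating the Grassmann algebra $\Lambda$. Write $X=(X_1,\ldots,X_{m+2n})=(x_1,\ldots,x_m,\theta_1,\ldots,\theta_{2n})$. The partial derivatives $\partial_{X_i}$ are the superderivations of $\mathcal P$ satisfying the supercommutation relations $[\partial_{X_i},X_j]=\delta_{ij}$. $\mathcal P_k$ denotes the subspace of polynomials homogeneous of total degree $k$ in all the variables $x_i,\theta_j$, and $\mathcal P_k=0$ for $k<0$.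 Put $$\Delta=\sum_{j=1}^m\partial_{x_j}^2-4\sum_{j=1}^n\partial_{\theta_{2j-1}}\partial_{\theta_{2j}},\qquad R^2=\sum_{j=1}^m x_j^2-\sum_{j=1}^n\theta_{2j-1}\theta_{2j}.$$ The spherical harmonics and generalized spherical harmonics of degree $k$ are $$\mathcal H_k(\mathbb R^{m|2n})=\{P\in\mathcal P_k\mid\Delta P=0\},\qquad \tilde{\mathcal H}_k(\mathbb R^{m|2n})=\{P\in\mathcal P_k\mid \Delta R^2\Delta P=0\}$$ ($R^2$ acting by multiplication). $M=m-2n$ is the superdimension of $\mathbb R^{m|2n}$. The orthosymplectic Lie superalgebra $\mathfrak{osp}(m|2n)$, with its natural action on $\mathcal P(\mathbb R^{m|2n})$, is realized as the Lie superalgebra of superderivations of $\mathcal P(\mathbb R^{m|2n})$ that map the linear span of the coordinates $X_1,\ldots,X_{m+2n}$ to itself and annihilate $R^2$; the operators $\Delta$ and $R^2$ are invariant under it. Identifying $\mathbb R^{m-1|2n}$ with the hyperplane $x_m=0$ (coordinates $x_1,\dots,x_{m-1},\theta_1,\dots,\theta_{2n}$), $\mathfrak{osp}(m-1|2n)$ acts on $\mathcal P(\mathbb R^{m|2n})=\mathcal P(\mathbb R^{m-1|2n})\otimes\mathbb R[x_m]$ by the extensions of its superderivations that annihilate $x_m$; this is the restriction of the action of $\mathfrak{osp}(m|2n)$ to a subalgebra. The symbol $\simeq$ means isomorphism of $\mathfrak{osp}(m-1|2n)$-modules. "Irreducible decomposition" means that each of the modules $\underline{\mathcal H}_\ell$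 occurring is an irreducible $\mathfrak{osp}(m-1|2n)$-module. *)

theory Defs
  imports "HOL-Analysis.Analysis" "HOL-Library.Poly_Mapping" "HOL-Library.FuncSet"
begin

text \<open>
  The Grassmann algebra on generators \<open>\<theta>\<^sub>j\<close>, \<open>j \<in> \<nat>\<close>. An element is given by its coefficients
  with respect to the basis of monomials \<open>\<theta>\<^sub>A = \<theta>\<^sub>a \<theta>\<^sub>b \<theta>\<^sub>c \<dots>\<close>, where
  \<open>A = {a < b < c < \<dots>}\<close> is a finite set.
\<close>

typedef grassmann =
  "{f :: nat set \<Rightarrow> real. finite {A. f A \<noteq> 0} \<and> (\<forall>A. f A \<noteq> 0 \<longrightarrow> finite A)}"
  morphisms gcoeff Abs_grassmann
  by (rule exI[of _ "\<lambda>_. 0"]) simp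

setup_lifting type_definition_grassmann

text \<open>
  \<open>\<theta>\<^sub>A \<theta>\<^sub>B = inv_sign A B \<cdot> \<theta>\<^sub>C\<close> for disjoint \<open>A\<close>, \<open>B\<close> and \<open>C = A \<union> B\<close>.
\<close>

definition inv_sign :: "nat set \<Rightarrow> nat set \<Rightarrow> real" where
  "inv_sign A B = (-1) ^ card {(a, b). a \<in> A \<and> b \<in> B \<and> b < a}"

lemma gcoeff_finite_support: "finite {A. gcoeff f A \<noteq> 0}"
  using gcoeff[of f] by simp

lemma gcoeff_infinite: "infinite A \<Longrightarrow> gcoeff f A = 0"
  using gcoeff[of f] by auto

lemma grassmann_eqI: "(\<And>A. finite A \<Longrightarrow> gcoeff f A = gcoeff g A) \<Longrightarrow> f = g"
  by (metis gcoeff_infinite gcoeff_inject ext)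

lemma inv_sign_empty [simp]: "inv_sign {} B = 1" "inv_sign A {} = 1"
  by (simp_all add: inv_sign_def)

lemma inv_sign_Un_left:
  assumes "finite A" "finite B" "finite C" "A \<inter> B = {}"
  shows "inv_sign (A \<union> B) C = inv_sign A C * inv_sign B C"
proof -
  have "{(a, c). a \<in> A \<union> B \<and> c \<in> C \<and> c < a} =
      {(a, c). a \<in> A \<and> c \<in> C \<and> c < a} \<union> {(a, c). a \<in> B \<and> c \<in> C \<and> c < a}"
    by auto
  moreover have "finite {(a, c). a \<in> A \<and> c \<in> C \<and> c < a}" "finite {(a, c). a \<in> B \<and> c \<in> C \<and> c < a}"
    using assms by (auto intro: finite_subset[of _ "A \<times> C"] finite_subset[of _ "B \<times> C"])
  moreover have "{(a, c). a \<in> A \<and> c \<in> C \<and> c < a} \<inter> {(a, c). a \<in> B \<and> c \<in> C \<and> c < a} = {}"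
    using assms by auto
  ultimately show ?thesis
    by (simp add: inv_sign_def card_Un_disjoint power_add)
qed

lemma inv_sign_Un_right:
  assumes "finite A" "finite B" "finite C" "B \<inter> C = {}"
  shows "inv_sign A (B \<union> C) = inv_sign A B * inv_sign A C"
proof -
  have "{(a, c). a \<in> A \<and> c \<in> B \<union> C \<and> c < a} =
      {(a, c). a \<in> A \<and> c \<in> B \<and> c < a} \<union> {(a, c). a \<in> A \<and> c \<in> C \<and> c < a}"
    by auto
  moreover have "finite {(a, c). a \<in> A \<and> c \<in> B \<and> c < a}" "finite {(a, c). a \<in> A \<and> c \<in> C \<and> c < a}"
    using assms by (auto intro: finite_subset[of _ "A \<times> B"] finite_subset[of _ "A \<times> C"])
  moreover have "{(a, c). a \<in> A \<and> c \<in> B \<and> c < a} \<inter> {(a, c). a \<in> A \<and> c \<in> C \<and> c < a} = {}"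
    using assms by auto
  ultimately show ?thesis
    by (simp add: inv_sign_def card_Un_disjoint power_add)
qed

instantiation grassmann :: real_algebra_1
begin

lift_definition zero_grassmann :: grassmann is "\<lambda>_. 0" by simp

lift_definition one_grassmann :: grassmann is "\<lambda>A. if A = {} then 1 else 0"
  by simp

lift_definition plus_grassmann :: "grassmann \<Rightarrow> grassmann \<Rightarrow> grassmann" is "\<lambda>f g A. f A + g A"
proof -
  fix f g :: "nat set \<Rightarrow> real"
  assume f: "finite {A. f A \<noteq> 0} \<and> (\<forall>A. f A \<noteq> 0 \<longrightarrow> finite A)"
    and g: "finite {A. g A \<noteq> 0} \<and> (\<forall>A. g A \<noteq> 0 \<longrightarrow> finite A)"
  have "finite {A. f A + g A \<noteq> 0}"
    by (rule finite_subset[of _ "{A. f A \<noteq> 0} \<union> {A. g A \<noteq> 0}"]) (use f g in auto)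
  moreover have "finite A" if "f A + g A \<noteq> 0" for A
    using that f g by (cases "f A = 0") auto
  ultimately show "finite {A. f A + g A \<noteq> 0} \<and> (\<forall>A. f A + g A \<noteq> 0 \<longrightarrow> finite A)"
    by simp
qed

lift_definition uminus_grassmann :: "grassmann \<Rightarrow> grassmann" is "\<lambda>f A. - f A" by simp

definition minus_grassmann :: "grassmann \<Rightarrow> grassmann \<Rightarrow> grassmann" where
  "minus_grassmann f g = f + (- g)"

lift_definition scaleR_grassmann :: "real \<Rightarrow> grassmann \<Rightarrow> grassmann" is "\<lambda>c f A. c * f A"
  by (simp add: finite_mult_not_eq_zero_leftI)

lift_definition times_grassmann :: "grassmann \<Rightarrow> grassmann \<Rightarrow> grassmann"
  is "\<lambda>f g C. \<Sum>A\<in>Pow C. inv_sign A (C - A) * f A * g (C - A)"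
proof -
  fix f g :: "nat set \<Rightarrow> real"
  assume f: "finite {A. f A \<noteq> 0} \<and> (\<forall>A. f A \<noteq> 0 \<longrightarrow> finite A)"
    and g: "finite {A. g A \<noteq> 0} \<and> (\<forall>A. g A \<noteq> 0 \<longrightarrow> finite A)"
  let ?h = "\<lambda>C. \<Sum>A\<in>Pow C. inv_sign A (C - A) * f A * g (C - A)"
  have "\<exists>A B. f A \<noteq> 0 \<and> g B \<noteq> 0 \<and> C = A \<union> B" if h: "?h C \<noteq> 0" for C
  proof -
    obtain A where "A \<in> Pow C" "inv_sign A (C - A) * f A * g (C - A) \<noteq> 0"
      using sum.not_neutral_contains_not_neutral[OF h] by blast
    then show ?thesis
      by (intro exI[of _ A] exI[of _ "C - A"]) auto
  qed
  then have "{C. ?h C \<noteq> 0} \<subseteq> (\<lambda>(A, B). A \<union> B) ` ({A. f A \<noteq> 0} \<times> {B. g B \<noteq> 0})"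
    by fast
  moreover have "finite ((\<lambda>(A, B). A \<union> B) ` ({A. f A \<noteq> 0} \<times> {B. g B \<noteq> 0}))"
    by (intro finite_imageI finite_cartesian_product) (use f g in auto)
  moreover have "finite C" if "?h C \<noteq> 0" for C
  proof (rule ccontr)
    assume "infinite C"
    then have "?h C = 0" by (intro sum.infinite) simp
    then show False using that by simp
  qed
  ultimately show "finite {C. ?h C \<noteq> 0} \<and> (\<forall>C. ?h C \<noteq> 0 \<longrightarrow> finite C)"
    by (intro conjI allI impI) (rule finite_subset, assumption+)
qed

lemma gcoeff_mult_assoc:
  assumes "finite D"
  shows "gcoeff (f * g * h) D = gcoeff (f * (g * h)) D"
proof -
  let ?t = "\<lambda>A B. inv_sign A (D - A) * inv_sign B (D - A - B) *
    gcoeff f A * gcoeff g B * gcoeff h (D - A - B)"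
  have "gcoeff (f * g * h) D =
      (\<Sum>C\<in>Pow D. \<Sum>A\<in>Pow C. inv_sign C (D - C) * inv_sign A (C - A) *
        gcoeff f A * gcoeff g (C - A) * gcoeff h (D - C))"
    by (simp add: times_grassmann.rep_eq sum_distrib_left sum_distrib_right mult_ac)
  also have "\<dots> = (\<Sum>(C, A)\<in>Sigma (Pow D) Pow. inv_sign C (D - C) * inv_sign A (C - A) *
        gcoeff f A * gcoeff g (C - A) * gcoeff h (D - C))"
    using assms by (intro sum.Sigma) (auto intro: finite_subset)
  also have "\<dots> = (\<Sum>(A, B)\<in>Sigma (Pow D) (\<lambda>A. Pow (D - A)). ?t A B)"
  proof (rule sum.reindex_bij_witness[where i = "\<lambda>(A, B). (A \<union> B, A)" and j = "\<lambda>(C, A). (A, C - A)"])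
    fix p assume p: "p \<in> Sigma (Pow D) Pow"
    obtain C A where [simp]: "p = (C, A)" by fastforce
    have CA: "C \<subseteq> D" "A \<subseteq> C" using p by auto
    define B where "B = C - A"
    define E where "E = D - C"
    have fin: "finite A" "finite B" "finite E"
      using CA assms by (auto simp: B_def E_def intro: finite_subset)
    have disj: "A \<inter> B = {}" "B \<inter> E = {}" "C = A \<union> B" "D - A = B \<union> E"
      using CA by (auto simp: B_def E_def)
    have diffs: "C - A = B" "D - C = E" "B \<union> E - B = E"
      unfolding B_def E_def using CA by auto
    show "(\<lambda>(A, B). (A \<union> B, A)) ((\<lambda>(C, A). (A, C - A)) p) = p"
      using CA by auto
    show "(\<lambda>(C, A). (A, C - A)) p \<in> Sigma (Pow D) (\<lambda>A. Pow (D - A))"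
      using CA by auto
    have "inv_sign C E * inv_sign A B = inv_sign A (B \<union> E) * inv_sign B E"
      using fin disj(1,2) by (simp add: disj(3) inv_sign_Un_left[of A B] inv_sign_Un_right[of A B] Int_Un_distrib2)
    then show "(case (\<lambda>(C, A). (A, C - A)) p of (A, B) \<Rightarrow> ?t A B) =
        (case p of (C, A) \<Rightarrow> inv_sign C (D - C) * inv_sign A (C - A) *
          gcoeff f A * gcoeff g (C - A) * gcoeff h (D - C))"
      by (simp add: disj(4) diffs)
  qed auto
  also have "\<dots> = (\<Sum>A\<in>Pow D. \<Sum>B\<in>Pow (D - A). ?t A B)"
    using assms by (intro sum.Sigma[symmetric]) auto
  also have "\<dots> = gcoeff (f * (g * h)) D"
    by (simp add: times_grassmann.rep_eq sum_distrib_left sum_distrib_right mult_ac)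
  finally show ?thesis .
qed

instance
proof
  fix a b c :: grassmann and r s :: real
  show "a + b + c = a + (b + c)" "a + b = b + a" "0 + a = a" "- a + a = 0"
    by (transfer; simp add: fun_eq_iff)+
  show "a - b = a + - b"
    by (simp add: minus_grassmann_def)
  show "r *\<^sub>R (a + b) = r *\<^sub>R a + r *\<^sub>R b" "(r + s) *\<^sub>R a = r *\<^sub>R a + s *\<^sub>R a"
    "r *\<^sub>R s *\<^sub>R a = (r * s) *\<^sub>R a" "1 *\<^sub>R a = a"
    by (transfer; simp add: fun_eq_iff algebra_simps)+
  show "a * b * c = a * (b * c)"
    by (rule grassmann_eqI) (rule gcoeff_mult_assoc)
  show "(a + b) * c = a * c + b * c" "a * (b + c) = a * b + a * c"
    "r *\<^sub>R a * b = r *\<^sub>R (a * b)" "a * r *\<^sub>R b = r *\<^sub>R (a * b)"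
    by (transfer; simp add: fun_eq_iff algebra_simps sum.distrib sum_distrib_left)+
  show "(0 :: grassmann) \<noteq> 1"
    by transfer (metis zero_neq_one)
  show "1 * a = a"
  proof (rule grassmann_eqI)
    fix C :: "nat set" assume C: "finite C"
    have "gcoeff (1 * a) C = (\<Sum>A\<in>Pow C. if A = {} then gcoeff a C else 0)"
      unfolding times_grassmann.rep_eq one_grassmann.rep_eq
      by (rule sum.cong) auto
    then show "gcoeff (1 * a) C = gcoeff a C" using C by simp
  qed
  show "a * 1 = a"
  proof (rule grassmann_eqI)
    fix C :: "nat set" assume C: "finite C"
    have "gcoeff (a * 1) C = (\<Sum>A\<in>Pow C. if A = C then gcoeff a C else 0)"
      unfolding times_grassmann.rep_eq one_grassmann.rep_eq
      by (rule sum.cong) auto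
    then show "gcoeff (a * 1) C = gcoeff a C" using C by simp
  qed
qed

end

lemma gcoeff_simps [simp]:
  "gcoeff 0 A = 0" "gcoeff (f + g) A = gcoeff f A + gcoeff g A" "gcoeff (- f) A = - gcoeff f A"
  "gcoeff (f - g) A = gcoeff f A - gcoeff g A" "gcoeff (c *\<^sub>R f) A = c * gcoeff f A"
  unfolding minus_grassmann_def zero_grassmann.rep_eq plus_grassmann.rep_eq uminus_grassmann.rep_eq
    scaleR_grassmann.rep_eq by simp_all

lift_definition ggen :: "nat \<Rightarrow> grassmann" is "\<lambda>j A. if A = {j} then 1 else 0"
  by simp

text \<open>\<open>ggen_deriv j\<close> is the left derivative \<open>\<partial>/\<partial>\<theta>\<^sub>j\<close>; see \<open>ggen_deriv_ggen_mult\<close>.\<close>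

lift_definition ggen_deriv :: "nat \<Rightarrow> grassmann \<Rightarrow> grassmann"
  is "\<lambda>j f A. if j \<in> A then 0 else (-1) ^ card {a \<in> A. a < j} * f (insert j A)"
proof -
  fix j and f :: "nat set \<Rightarrow> real"
  assume f: "finite {A. f A \<noteq> 0} \<and> (\<forall>A. f A \<noteq> 0 \<longrightarrow> finite A)"
  let ?h = "\<lambda>A. if j \<in> A then 0 else (-1) ^ card {a \<in> A. a < j} * f (insert j A)"
  have h: "j \<notin> A" "f (insert j A) \<noteq> 0" if "?h A \<noteq> 0" for A
    using that by (simp_all split: if_splits)
  have "A \<in> (\<lambda>A. A - {j}) ` {A. f A \<noteq> 0}" if "?h A \<noteq> 0" for A
    using h[OF that] by (intro image_eqI[of _ _ "insert j A"]) simp_all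
  then have "{A. ?h A \<noteq> 0} \<subseteq> (\<lambda>A. A - {j}) ` {A. f A \<noteq> 0}"
    by (intro subsetI) (simp only: mem_Collect_eq)
  then have "finite {A. ?h A \<noteq> 0}"
    using conjunct1[OF f] by (rule finite_surj[rotated])
  moreover have "finite A" if "?h A \<noteq> 0" for A
    using conjunct2[OF f, rule_format, OF h(2)[OF that]] by simp
  ultimately show "finite {A. ?h A \<noteq> 0} \<and> (\<forall>A. ?h A \<noteq> 0 \<longrightarrow> finite A)"
    by (intro conjI allI impI)
qed

lemma gcoeff_ggen_mult:
  assumes "finite A"
  shows "gcoeff (ggen j * f) A =
    (if j \<in> A then (-1) ^ card {a \<in> A. a < j} * gcoeff f (A - {j}) else 0)"
proof -
  have "gcoeff (ggen j * f) A = (\<Sum>B\<in>Pow A. if B = {j} then inv_sign B (A - B) * gcoeff f (A - B) else 0)"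
    unfolding times_grassmann.rep_eq ggen.rep_eq by (rule sum.cong) auto
  also have "\<dots> = (if j \<in> A then inv_sign {j} (A - {j}) * gcoeff f (A - {j}) else 0)"
    using assms by simp
  also have "inv_sign {j} (A - {j}) = (-1) ^ card {a \<in> A. a < j}"
  proof -
    have "{(a, b). a \<in> {j} \<and> b \<in> A - {j} \<and> b < a} = Pair j ` {a \<in> A. a < j}"
      by auto
    then show ?thesis
      by (simp add: inv_sign_def card_image inj_on_def)
  qed
  finally show ?thesis .
qed

lemma ggen_deriv_ggen_mult:
  "ggen_deriv i (ggen j * f) = (if i = j then f else 0) - ggen j * ggen_deriv i f"
proof (rule grassmann_eqI)
  fix A :: "nat set" assume A: "finite A"
  consider "i \<in> A" "i = j" | "i \<in> A" "i \<noteq> j" | "i \<notin> A" "i = j"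
    | "i \<notin> A" "i \<noteq> j" "j \<notin> A" | "i \<notin> A" "i \<noteq> j" "j \<in> A"
    by blast
  then show "gcoeff (ggen_deriv i (ggen j * f)) A = gcoeff ((if i = j then f else 0) - ggen j * ggen_deriv i f) A"
  proof cases
    case 1
    then have eq: "{a \<in> A. a \<noteq> j \<and> a < j} = {a \<in> A. a < j}" "insert j A = A" by auto
    from 1 A show ?thesis
      by (simp add: gcoeff_ggen_mult ggen_deriv.rep_eq eq)
  next
    case 2
    with A show ?thesis
      by (simp add: gcoeff_ggen_mult ggen_deriv.rep_eq)
  next
    case 3
    then have eq: "{a. (a = j \<or> a \<in> A) \<and> a < j} = {a \<in> A. a < j}" by auto
    from 3 A show ?thesis
      by (simp add: gcoeff_ggen_mult ggen_deriv.rep_eq eq)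
  next
    case 4
    with A show ?thesis
      by (simp add: gcoeff_ggen_mult ggen_deriv.rep_eq)
  next
    case 5
    have eq: "insert i A - {j} = insert i (A - {j})" using 5 by auto
    have "(-1) ^ card {a \<in> A. a < i} * (-1) ^ card {a \<in> insert i A. a < j} =
        - ((-1) ^ card {a \<in> A. a < j} * (-1) ^ card {a \<in> A - {j}. a < i} :: real)"
    proof (cases "i < j")
      case True
      then have "{a \<in> insert i A. a < j} = insert i {a \<in> A. a < j}"
        "{a \<in> A - {j}. a < i} = {a \<in> A. a < i}" by auto
      then show ?thesis using 5 A by simp
    next
      case False
      with 5 have "{a \<in> insert i A. a < j} = {a \<in> A. a < j}"
        "{a \<in> A. a < i} = insert j {a \<in> A - {j}. a < i}" by auto
      then show ?thesis using A by simp
    qed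
    then have "(-1) ^ card {a \<in> A. a < i} * ((-1) ^ card {a \<in> insert i A. a < j} * c) =
        - ((-1) ^ card {a \<in> A. a < j} * ((-1) ^ card {a \<in> A - {j}. a < i} * c))" for c :: real
      by (metis (no_types, lifting) minus_mult_left mult.assoc)
    with 5 A show ?thesis
      by (simp add: gcoeff_ggen_mult ggen_deriv.rep_eq eq)
  qed
qed

instantiation poly_mapping :: (type, real_vector) real_vector
begin

lift_definition scaleR_poly_mapping :: "real \<Rightarrow> ('a \<Rightarrow>\<^sub>0 'b) \<Rightarrow> 'a \<Rightarrow>\<^sub>0 'b" is "\<lambda>c f k. c *\<^sub>R f k"
  by (rule rev_finite_subset) auto

lemma lookup_scaleR [simp]: "Poly_Mapping.lookup (c *\<^sub>R f) k = c *\<^sub>R Poly_Mapping.lookup f k"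
  by (simp add: scaleR_poly_mapping.rep_eq)

instance
  by standard (rule poly_mapping_eqI; simp add: lookup_add algebra_simps)+

end

text \<open>
  Polynomials in commuting variables \<open>x\<^sub>i\<close> over the Grassmann algebra, i.e. the algebra
  \<open>\<real>[x\<^sub>1, x\<^sub>2, \<dots>] \<otimes> \<Lambda>(\<theta>\<^sub>1, \<theta>\<^sub>2, \<dots>)\<close>. Exponents of the \<open>x\<^sub>i\<close> are finitely supported functions
  \<open>nat \<Rightarrow>\<^sub>0 nat\<close>. Working with infinitely many variables makes \<open>\<P>(\<real>\<^sup>m\<^sup>|\<^sup>2\<^sup>n)\<close> a subset of one type for
  all \<open>m\<close> and \<open>n\<close>, and \<open>\<P>(\<real>\<^sup>m\<^sup>-\<^sup>1\<^sup>|\<^sup>2\<^sup>n)\<close> a subalgebra of \<open>\<P>(\<real>\<^sup>m\<^sup>|\<^sup>2\<^sup>n)\<close>.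
\<close>

type_synonym superpoly = "(nat \<Rightarrow>\<^sub>0 nat) \<Rightarrow>\<^sub>0 grassmann"

definition xvar :: "nat \<Rightarrow> superpoly" where
  "xvar i = Poly_Mapping.single (Poly_Mapping.single i 1) 1"

definition thetavar :: "nat \<Rightarrow> superpoly" where
  "thetavar j = Poly_Mapping.single 0 (ggen j)"

definition scoeff :: "superpoly \<Rightarrow> (nat \<Rightarrow>\<^sub>0 nat) \<Rightarrow> nat set \<Rightarrow> real" where
  "scoeff f \<alpha> A = gcoeff (Poly_Mapping.lookup f \<alpha>) A"

definition superpolys :: "nat \<Rightarrow> nat \<Rightarrow> superpoly set" where
  "superpolys m n =
    {f. \<forall>\<alpha> A. scoeff f \<alpha> A \<noteq> 0 \<longrightarrow> Poly_Mapping.keys \<alpha> \<subseteq> {1..m} \<and> A \<subseteq> {1..2 * n}}"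

definition homogeneous_superpolys :: "nat \<Rightarrow> nat \<Rightarrow> nat \<Rightarrow> superpoly set" where
  "homogeneous_superpolys m n k = {f \<in> superpolys m n. \<forall>\<alpha> A. scoeff f \<alpha> A \<noteq> 0 \<longrightarrow>
    (\<Sum>i\<in>Poly_Mapping.keys \<alpha>. Poly_Mapping.lookup \<alpha> i) + card A = k}"

text \<open>The \<open>\<int>/2\<close>-grading: \<open>parity_part 0\<close> is the even part, \<open>parity_part 1\<close> the odd part.\<close>

definition parity_part :: "nat \<Rightarrow> superpoly set" where
  "parity_part p = {f. \<forall>\<alpha> A. scoeff f \<alpha> A \<noteq> 0 \<longrightarrow> card A mod 2 = p mod 2}"

lift_definition dx ::
    "nat \<Rightarrow> ((nat \<Rightarrow>\<^sub>0 nat) \<Rightarrow>\<^sub>0 'b) \<Rightarrow> ((nat \<Rightarrow>\<^sub>0 nat) \<Rightarrow>\<^sub>0 'b::real_vector)"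
  is "\<lambda>i f \<alpha>. real (Suc (Poly_Mapping.lookup \<alpha> i)) *\<^sub>R f (\<alpha> + Poly_Mapping.single i 1)"
proof -
  fix i and f :: "(nat \<Rightarrow>\<^sub>0 nat) \<Rightarrow> 'b"
  assume "finite {\<alpha>. f \<alpha> \<noteq> 0}"
  then have "finite ((\<lambda>\<alpha>. \<alpha> + Poly_Mapping.single i 1) -` {\<alpha>. f \<alpha> \<noteq> 0})"
    by (rule finite_vimageI) (simp add: inj_def)
  then show "finite {\<alpha>. real (Suc (Poly_Mapping.lookup \<alpha> i)) *\<^sub>R f (\<alpha> + Poly_Mapping.single i 1) \<noteq> 0}"
    by (rule rev_finite_subset) auto
qed

definition dtheta :: "nat \<Rightarrow> superpoly \<Rightarrow> superpoly" where
  "dtheta j f = Poly_Mapping.map (ggen_deriv j) f"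

text \<open>
  The supercommutation relations \<open>[\<partial>\<^bsub>X i\<^esub>, X\<^sub>j] = \<delta>\<^sub>i\<^sub>j\<close>, which, together with \<open>\<partial> 1 = 0\<close>,
  characterize the partial derivatives.
\<close>

lemma lookup_dtheta: "Poly_Mapping.lookup (dtheta j f) \<alpha> = ggen_deriv j (Poly_Mapping.lookup f \<alpha>)"
proof -
  have "ggen_deriv j 0 = 0" by transfer auto
  then show ?thesis by (simp add: dtheta_def map.rep_eq when_def)
qed

lemma lookup_single_mult_add:
  "Poly_Mapping.lookup (Poly_Mapping.single \<beta> c * f) (\<beta> + \<alpha>) = c * Poly_Mapping.lookup f \<alpha>"
  for f :: superpoly
proof -
  have "Poly_Mapping.lookup (Poly_Mapping.single \<beta> c * f) (\<beta> + \<alpha>) =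
      Sum_any (\<lambda>l. c * Poly_Mapping.lookup f \<alpha> when l = \<beta>)"
    unfolding lookup_mult by (rule Sum_any.cong) (auto simp: lookup_single when_def)
  then show ?thesis by simp
qed

lemma lookup_xvar_mult:
  "Poly_Mapping.lookup (xvar i * f) \<alpha> =
    (if Poly_Mapping.lookup \<alpha> i = 0 then 0 else Poly_Mapping.lookup f (\<alpha> - Poly_Mapping.single i 1))"
proof (cases "Poly_Mapping.lookup \<alpha> i = 0")
  case True
  have "\<alpha> \<noteq> Poly_Mapping.single i 1 + q" for q
    using True by (auto simp: lookup_add)
  then have "Poly_Mapping.lookup (xvar i) l * Sum_any (\<lambda>q. Poly_Mapping.lookup f q when \<alpha> = l + q) = 0" for l
    by (cases "l = Poly_Mapping.single i 1") (simp_all add: xvar_def lookup_single)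
  with True show ?thesis
    by (simp add: lookup_mult)
next
  case False
  then have "\<alpha> = Poly_Mapping.single i 1 + (\<alpha> - Poly_Mapping.single i 1)"
    by (intro poly_mapping_eqI) (auto simp: lookup_add lookup_minus lookup_single when_def)
  with False show ?thesis
    by (metis xvar_def lookup_single_mult_add mult_1)
qed

lemma lookup_thetavar_mult: "Poly_Mapping.lookup (thetavar j * f) \<alpha> = ggen j * Poly_Mapping.lookup f \<alpha>"
  using lookup_single_mult_add[of 0 "ggen j" f \<alpha>] by (simp add: thetavar_def)

lemma dx_xvar_mult: "dx i (xvar j * f) = (if i = j then f else 0) + xvar j * dx i f"
proof (rule poly_mapping_eqI)
  fix \<alpha> :: "nat \<Rightarrow>\<^sub>0 nat"
  let ?e = "\<lambda>i. Poly_Mapping.single i (1 :: nat)"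
  have eq: "\<alpha> - ?e j + ?e i = \<alpha> + ?e i - ?e j" if "Poly_Mapping.lookup \<alpha> j \<noteq> 0"
    using that by (intro poly_mapping_eqI) (auto simp: lookup_add lookup_minus lookup_single when_def)
  show "Poly_Mapping.lookup (dx i (xvar j * f)) \<alpha> =
      Poly_Mapping.lookup ((if i = j then f else 0) + xvar j * dx i f) \<alpha>"
    using eq
    by (auto simp: dx.rep_eq lookup_xvar_mult lookup_add lookup_minus lookup_single when_def scaleR_add_left
        scaleR_diff_left)
qed

lemma dx_thetavar_mult: "dx i (thetavar j * f) = thetavar j * dx i f"
  by (rule poly_mapping_eqI) (simp add: dx.rep_eq lookup_thetavar_mult)

lemma dtheta_xvar_mult: "dtheta i (xvar j * f) = xvar j * dtheta i f"
proof (rule poly_mapping_eqI)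
  have "ggen_deriv i 0 = 0" by transfer auto
  then show "Poly_Mapping.lookup (dtheta i (xvar j * f)) \<alpha> = Poly_Mapping.lookup (xvar j * dtheta i f) \<alpha>" for \<alpha>
    by (simp add: lookup_dtheta lookup_xvar_mult)
qed

lemma dtheta_thetavar_mult: "dtheta i (thetavar j * f) = (if i = j then f else 0) - thetavar j * dtheta i f"
  by (rule poly_mapping_eqI) (simp add: lookup_dtheta lookup_thetavar_mult lookup_minus ggen_deriv_ggen_mult)

lemma dx_one: "dx i (1 :: superpoly) = 0"
proof (rule poly_mapping_eqI)
  fix \<alpha> :: "nat \<Rightarrow>\<^sub>0 nat"
  have "\<alpha> + Poly_Mapping.single i 1 \<noteq> 0"
    by (metis lookup_add lookup_single_eq lookup_zero add_is_0 zero_neq_one)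
  then show "Poly_Mapping.lookup (dx i (1 :: superpoly)) \<alpha> = Poly_Mapping.lookup 0 \<alpha>"
    by (simp add: dx.rep_eq lookup_one)
qed

lemma dtheta_one: "dtheta j 1 = 0"
proof (rule poly_mapping_eqI)
  have "ggen_deriv j 0 = 0" "ggen_deriv j 1 = 0" by (transfer; auto)+
  then show "Poly_Mapping.lookup (dtheta j 1) \<alpha> = Poly_Mapping.lookup 0 \<alpha>" for \<alpha>
    by (simp add: lookup_dtheta lookup_one when_def)
qed

definition laplacian :: "nat \<Rightarrow> nat \<Rightarrow> superpoly \<Rightarrow> superpoly" where
  "laplacian m n f =
    (\<Sum>j=1..m. dx j (dx j f)) - 4 *\<^sub>R (\<Sum>j=1..n. dtheta (2 * j - 1) (dtheta (2 * j) f))"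

definition R2 :: "nat \<Rightarrow> nat \<Rightarrow> superpoly" where
  "R2 m n = (\<Sum>j=1..m. xvar j ^ 2) - (\<Sum>j=1..n. thetavar (2 * j - 1) * thetavar (2 * j))"

definition harmonics :: "nat \<Rightarrow> nat \<Rightarrow> nat \<Rightarrow> superpoly set" where
  "harmonics m n k = {f \<in> homogeneous_superpolys m n k. laplacian m n f = 0}"

definition gen_harmonics :: "nat \<Rightarrow> nat \<Rightarrow> nat \<Rightarrow> superpoly set" where
  "gen_harmonics m n k = {f \<in> homogeneous_superpolys m n k.
    laplacian m n (R2 m n * laplacian m n f) = 0}"

definition linear_on :: "'v set \<Rightarrow> ('v::real_vector \<Rightarrow> 'w::real_vector) \<Rightarrow> bool" where
  "linear_on S f \<longleftrightarrow> (\<forall>v\<in>S. \<forall>w\<in>S. f (v + w) = f v + f w) \<and> (\<forall>c. \<forall>v\<in>S. f (c *\<^sub>R v) = c *\<^sub>R f v)"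

text \<open>
  Homogeneous superderivations of \<open>\<P>(\<real>\<^sup>m\<^sup>|\<^sup>2\<^sup>n)\<close> of parity \<open>p \<in> {0, 1}\<close>, normalized to be
  \<open>undefined\<close> outside \<open>\<P>(\<real>\<^sup>m\<^sup>|\<^sup>2\<^sup>n)\<close>.
\<close>

definition superderivations :: "nat \<Rightarrow> nat \<Rightarrow> nat \<Rightarrow> (superpoly \<Rightarrow> superpoly) set" where
  "superderivations m n p = {D \<in> superpolys m n \<rightarrow>\<^sub>E superpolys m n.
    linear_on (superpolys m n) D \<and>
    (\<forall>q\<in>{0, 1}. \<forall>f \<in> superpolys m n \<inter> parity_part q. D f \<in> parity_part (p + q)) \<and>
    (\<forall>q\<in>{0, 1}. \<forall>f \<in> superpolys m n \<inter> parity_part q. \<forall>g \<in> superpolys m n.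
      D (f * g) = D f * g + (-1) ^ (p * q) *\<^sub>R (f * D g))}"

text \<open>
  \<open>osp m n p\<close> is the component of parity \<open>p \<in> {0, 1}\<close> of \<open>osp(m|2n)\<close>, which is the direct sum
  of its two components.
\<close>

definition osp :: "nat \<Rightarrow> nat \<Rightarrow> nat \<Rightarrow> (superpoly \<Rightarrow> superpoly) set" where
  "osp m n p = {D \<in> superderivations m n p.
    D ` span (xvar ` {1..m} \<union> thetavar ` {1..2 * n}) \<subseteq> span (xvar ` {1..m} \<union> thetavar ` {1..2 * n}) \<and>
    D (R2 m n) = 0}"

definition lincomb :: "nat \<Rightarrow> nat \<Rightarrow> real \<Rightarrow> (superpoly \<Rightarrow> superpoly) \<Rightarrow> real \<Rightarrow> (superpoly \<Rightarrow> superpoly) \<Rightarrow>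
    superpoly \<Rightarrow> superpoly" where
  "lincomb m n a D b E = (\<lambda>f\<in>superpolys m n. a *\<^sub>R D f + b *\<^sub>R E f)"

definition superbracket :: "nat \<Rightarrow> nat \<Rightarrow> nat \<Rightarrow> nat \<Rightarrow> (superpoly \<Rightarrow> superpoly) \<Rightarrow> (superpoly \<Rightarrow> superpoly) \<Rightarrow>
    superpoly \<Rightarrow> superpoly" where
  "superbracket m n p q D E = (\<lambda>f\<in>superpolys m n. D (E f) - (-1) ^ (p * q) *\<^sub>R E (D f))"

text \<open>
  A \<open>\<int>/2\<close>-graded vector space with an action of the operators on superpolynomials. Only
  \<open>mpart V 0\<close> (even part) and \<open>mpart V 1\<close> (odd part) are relevant. As usual for Lie superalgebras,
  submodules are graded subspaces, and isomorphisms preserve parity.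
\<close>

record 'v smodule =
  mspace :: "'v set"
  mpart :: "nat \<Rightarrow> 'v set"
  mact :: "(superpoly \<Rightarrow> superpoly) \<Rightarrow> 'v \<Rightarrow> 'v"

definition graded_subspace :: "'v::real_vector smodule \<Rightarrow> 'v set \<Rightarrow> bool" where
  "graded_subspace V U \<longleftrightarrow> subspace U \<and> U \<subseteq> mspace V \<and>
    (\<forall>u\<in>U. \<exists>u0 \<in> U \<inter> mpart V 0. \<exists>u1 \<in> U \<inter> mpart V 1. u = u0 + u1)"

definition osp_module :: "nat \<Rightarrow> nat \<Rightarrow> 'v::real_vector smodule \<Rightarrow> bool" where
  "osp_module m n V \<longleftrightarrow>
    (\<forall>p\<in>{0, 1}. subspace (mpart V p) \<and> mpart V p \<subseteq> mspace V) \<and>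
    mpart V 0 \<inter> mpart V 1 = {0} \<and> graded_subspace V (mspace V) \<and>
    (\<forall>p\<in>{0, 1}. \<forall>D \<in> osp m n p. linear_on (mspace V) (mact V D) \<and>
      (\<forall>q\<in>{0, 1}. mact V D ` mpart V q \<subseteq> mpart V ((p + q) mod 2))) \<and>
    (\<forall>p\<in>{0, 1}. \<forall>D \<in> osp m n p. \<forall>E \<in> osp m n p. \<forall>a b. \<forall>v \<in> mspace V.
      mact V (lincomb m n a D b E) v = a *\<^sub>R mact V D v + b *\<^sub>R mact V E v) \<and>
    (\<forall>p\<in>{0, 1}. \<forall>q\<in>{0, 1}. \<forall>D \<in> osp m n p. \<forall>E \<in> osp m n q. \<forall>v \<in> mspace V.
      mact V (superbracket m n p q D E) v =
        mact V D (mact V E v) - (-1) ^ (p * q) *\<^sub>R mact V E (mact V D v))"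

definition osp_irreducible :: "nat \<Rightarrow> nat \<Rightarrow> 'v::real_vector smodule \<Rightarrow> bool" where
  "osp_irreducible m n V \<longleftrightarrow> osp_module m n V \<and> mspace V \<noteq> {0} \<and>
    (\<forall>U. graded_subspace V U \<and> (\<forall>p\<in>{0, 1}. \<forall>D \<in> osp m n p. mact V D ` U \<subseteq> U) \<longrightarrow>
      U = {0} \<or> U = mspace V)"

definition osp_isomorphic ::
    "nat \<Rightarrow> nat \<Rightarrow> 'v::real_vector smodule \<Rightarrow> 'w::real_vector smodule \<Rightarrow> bool" where
  "osp_isomorphic m n V W \<longleftrightarrow> osp_module m n V \<and> osp_module m n W \<and>
    (\<exists>\<phi>. bij_betw \<phi> (mspace V) (mspace W) \<and> linear_on (mspace V) \<phi> \<and>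
      (\<forall>p\<in>{0, 1}. \<phi> ` mpart V p \<subseteq> mpart W p) \<and>
      (\<forall>p\<in>{0, 1}. \<forall>D \<in> osp m n p. \<forall>v \<in> mspace V. \<phi> (mact V D v) = mact W D (\<phi> v)))"

definition dsum :: "'v::real_vector smodule \<Rightarrow> 'w::real_vector smodule \<Rightarrow> ('v \<times> 'w) smodule"
    (infixr \<open>\<oplus>\<^sub>s\<close> 65) where
  "V \<oplus>\<^sub>s W = \<lparr>mspace = mspace V \<times> mspace W, mpart = (\<lambda>p. mpart V p \<times> mpart W p),
    mact = (\<lambda>D (v, w). (mact V D v, mact W D w))\<rparr>"

definition dsum_family :: "'i set \<Rightarrow> ('i \<Rightarrow> 'v::real_vector smodule) \<Rightarrow> ('i \<Rightarrow>\<^sub>0 'v) smodule" where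
  "dsum_family I V =
    \<lparr>mspace = {v. Poly_Mapping.keys v \<subseteq> I \<and> (\<forall>i\<in>I. Poly_Mapping.lookup v i \<in> mspace (V i))},
     mpart = (\<lambda>p. {v. Poly_Mapping.keys v \<subseteq> I \<and> (\<forall>i\<in>I. Poly_Mapping.lookup v i \<in> mpart (V i) p)}),
     mact = (\<lambda>D. Poly_Mapping.mapp (\<lambda>i. mact (V i) D))\<rparr>"

text \<open>
  For a derivation \<open>D\<close> of \<open>\<P>(\<real>\<^sup>m\<^sup>-\<^sup>1\<^sup>|\<^sup>2\<^sup>n)\<close>, the unique extension to \<open>\<P>(\<real>\<^sup>m\<^sup>|\<^sup>2\<^sup>n)\<close> that annihilates
  \<open>x\<^sub>m\<close> (\<open>m \<ge> 1\<close>).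
\<close>

definition extend_der :: "nat \<Rightarrow> nat \<Rightarrow> (superpoly \<Rightarrow> superpoly) \<Rightarrow> superpoly \<Rightarrow> superpoly" where
  "extend_der m n D = (THE E. (\<exists>p\<in>{0, 1}. E \<in> superderivations m n p) \<and>
    (\<forall>f \<in> superpolys (m - 1) n. E f = D f) \<and> E (xvar m) = 0)"

definition harmonics_module :: "nat \<Rightarrow> nat \<Rightarrow> nat \<Rightarrow> superpoly smodule" where
  "harmonics_module m n l =
    \<lparr>mspace = harmonics m n l, mpart = (\<lambda>p. harmonics m n l \<inter> parity_part p), mact = (\<lambda>D. D)\<rparr>"

text \<open>The space \<open>gen_harmonics m n k\<close> as a module over \<open>osp(m-1|2n)\<close>.\<close>

definition gen_harmonics_restricted :: "nat \<Rightarrow> nat \<Rightarrow> nat \<Rightarrow> superpoly smodule" where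
  "gen_harmonics_restricted m n k =
    \<lparr>mspace = gen_harmonics m n k, mpart = (\<lambda>p. gen_harmonics m n k \<inter> parity_part p),
     mact = extend_der m n\<rparr>"

definition I_M :: "int \<Rightarrow> nat set" where
  "I_M M = {k. real k \<in> {2 - real_of_int M / 2 .. 2 - real_of_int M}}"

end

(*
Write t for the last even coordinate and r for the square radius of the remaining ones;
osp(m-1|2n) acts coefficientwise in t.

The equation Laplacian f = g is a recursion for the t-coefficients of f, so f is determined by g and
its two lowest coefficients. For f in the space of generalized spherical harmonics, g = Laplacian f
satisfies Laplacian (R^2 g) = 0. From [Laplacian, R^2] = 4 Euler + 2M one sees that this happens
exactly for g = R^(2j-2) h with h harmonic of degree i = 2 - M - k, i.e. 2j = k - i, and h is a
multiple of Laplacian^j f. Hence f is given by the two lowest coefficients of f and of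
Laplacian^j f, which are arbitrary polynomials on R^(m-1|2n) of degrees k, k - 1 and i, i - 1. As the
superdimension M - 1 is odd, the Fischer decomposition holds on R^(m-1|2n) and splits these pairs
into one copy of the spherical harmonics for each degree up to k and up to i.

For the irreducibility of the harmonics of degree l on R^(m|2n) with odd m, let now t be the last
coordinate of R^m. The rotations of t into the other coordinates show that some f in a nonzero
submodule U has a nonzero coefficient of t^l. The sum of their squares is, up to a scalar, minus the
Casimir operator of osp(m-1|2n); since l is small, a polynomial in it maps f to a nonzero polynomial
in t and r, and this is a multiple of t^l modulo R^2. Finally t^l generates all polynomials of
degree l by rotations, so U + R^2 P = P, whence U is everything by the Fischer decomposition.
*)
theory Submission
  imports Defs
begin

section \<open>Coefficients and monomials\<close>

text \<open>The obstacle is that \<open>M\<close> is even and not positive. For h harmonic of degree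
  i, Delta maps R^(2s) h to 2s(2i + M + 2s - 2) R^(2s-2) h. This scalar can vanish; then R^(2s) h is
  harmonic again and the Fischer decomposition fails on the large space. The zero lies at s = 1 -
  M/2 - i, and R^(2s) h has degree k for i = 2 - M - k, s = j. The bounds of \<open>I_M\<close> say
  just that i >= 0 and j >= 1. With one even coordinate less the superdimension is odd, and the
  scalar is never 0.

  Modules of orthosymplectic superalgebras need not be completely reducible, so equal composition
  factors would not yield an isomorphism. Instead, two injective equivariant maps with the same
  image, a space of pairs of polynomials, are compared.

  In the irreducibility proof the Casimir eigenvalues s(s + mu - 2) in degree s, with mu the
  superdimension without t, may coincide, so the operator is not diagonalized. A product of its
  shifts makes every t-coefficient radial by descent in the degree. The bound on l keeps the
  eigenvalues nonzero for 1 <= s <= l, so that the coefficient of t^l survives.\<close>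

lemma scoeff_simps [simp]:
  "scoeff 0 \<alpha> A = 0" "scoeff (f + g) \<alpha> A = scoeff f \<alpha> A + scoeff g \<alpha> A"
  "scoeff (- f) \<alpha> A = - scoeff f \<alpha> A" "scoeff (f - g) \<alpha> A = scoeff f \<alpha> A - scoeff g \<alpha> A"
  "scoeff (c *\<^sub>R f) \<alpha> A = c * scoeff f \<alpha> A"
  by (simp_all add: scoeff_def lookup_add lookup_minus)

lemma scoeff_sum [simp]: "scoeff (sum f S) \<alpha> A = (\<Sum>s\<in>S. scoeff (f s) \<alpha> A)"
  by (induction S rule: infinite_finite_induct) simp_all

lemma superpoly_eqI: "(\<And>\<alpha> A. finite A \<Longrightarrow> scoeff f \<alpha> A = scoeff g \<alpha> A) \<Longrightarrow> f = g"
  unfolding scoeff_def by (intro poly_mapping_eqI grassmann_eqI) simp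

lemma scoeff_one: "scoeff 1 \<alpha> A = (if \<alpha> = 0 \<and> A = {} then 1 else 0)"
  by (simp add: scoeff_def lookup_one when_def one_grassmann.rep_eq)

lemma scoeff_xvar_mult:
  "scoeff (xvar i * f) \<alpha> A =
    (if Poly_Mapping.lookup \<alpha> i = 0 then 0 else scoeff f (\<alpha> - Poly_Mapping.single i 1) A)"
  by (simp add: scoeff_def lookup_xvar_mult)

lemma scoeff_thetavar_mult:
  "finite A \<Longrightarrow> scoeff (thetavar j * f) \<alpha> A =
    (if j \<in> A then (-1) ^ card {a \<in> A. a < j} * scoeff f \<alpha> (A - {j}) else 0)"
  by (simp add: scoeff_def lookup_thetavar_mult gcoeff_ggen_mult)

lemma scoeff_dx:
  "scoeff (dx i f) \<alpha> A =
    real (Suc (Poly_Mapping.lookup \<alpha> i)) * scoeff f (\<alpha> + Poly_Mapping.single i 1) A"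
  by (simp add: scoeff_def dx.rep_eq)

lemma scoeff_dtheta:
  "scoeff (dtheta j f) \<alpha> A =
    (if j \<in> A then 0 else (-1) ^ card {a \<in> A. a < j} * scoeff f \<alpha> (insert j A))"
  by (simp add: scoeff_def lookup_dtheta ggen_deriv.rep_eq)

lemma scoeff_finite_set: "scoeff f \<alpha> A \<noteq> 0 \<Longrightarrow> finite A"
  unfolding scoeff_def using gcoeff_infinite by blast

lemma finite_scoeff_support: "finite {(\<alpha>, A). scoeff f \<alpha> A \<noteq> 0}"
proof (rule finite_subset)
  show "{(\<alpha>, A). scoeff f \<alpha> A \<noteq> 0} \<subseteq>
      Sigma (Poly_Mapping.keys f) (\<lambda>\<alpha>. {A. gcoeff (Poly_Mapping.lookup f \<alpha>) A \<noteq> 0})"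
    by (auto simp: scoeff_def in_keys_iff)
  show "finite (Sigma (Poly_Mapping.keys f) (\<lambda>\<alpha>. {A. gcoeff (Poly_Mapping.lookup f \<alpha>) A \<noteq> 0}))"
    by (intro finite_SigmaI) (simp_all add: gcoeff_finite_support)
qed

text \<open>Degree, parity and the variables that occur depend on supports alone. For products it is
  then enough to know which pair of terms a nonzero coefficient comes from, in place of a signed
  formula.\<close>

lemma scoeff_mult_nonzero:
  assumes "scoeff (f * g) \<gamma> C \<noteq> 0"
  obtains \<alpha> \<beta> A B where "\<gamma> = \<alpha> + \<beta>" "C = A \<union> B" "A \<inter> B = {}" "scoeff f \<alpha> A \<noteq> 0" "scoeff g \<beta> B \<noteq> 0"
proof -
  have gsum: "gcoeff (sum h S) C = (\<Sum>s\<in>S. gcoeff (h s) C)" for h :: "(nat \<Rightarrow>\<^sub>0 nat) \<Rightarrow> grassmann" and S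
    by (induction S rule: infinite_finite_induct) simp_all
  have "gcoeff (Sum_any (\<lambda>l. Poly_Mapping.lookup f l *
      Sum_any (\<lambda>q. Poly_Mapping.lookup g q when \<gamma> = l + q))) C \<noteq> 0"
    using assms by (simp add: scoeff_def lookup_mult)
  then obtain \<alpha> where \<alpha>: "gcoeff (Poly_Mapping.lookup f \<alpha> *
      Sum_any (\<lambda>q. Poly_Mapping.lookup g q when \<gamma> = \<alpha> + q)) C \<noteq> 0"
    unfolding Sum_any.expand_set gsum using sum.not_neutral_contains_not_neutral by blast
  then obtain A where A: "A \<subseteq> C" "gcoeff (Poly_Mapping.lookup f \<alpha>) A \<noteq> 0"
      "gcoeff (Sum_any (\<lambda>q. Poly_Mapping.lookup g q when \<gamma> = \<alpha> + q)) (C - A) \<noteq> 0"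
    unfolding times_grassmann.rep_eq
    by (metis (no_types, lifting) Pow_iff mult_eq_0_iff sum.neutral)
  have gsum': "gcoeff (sum h S) (C - A) = (\<Sum>s\<in>S. gcoeff (h s) (C - A))"
    for h :: "(nat \<Rightarrow>\<^sub>0 nat) \<Rightarrow> grassmann" and S
    by (induction S rule: infinite_finite_induct) simp_all
  obtain \<beta> where "gcoeff (Poly_Mapping.lookup g \<beta> when \<gamma> = \<alpha> + \<beta>) (C - A) \<noteq> 0"
    using A(3) unfolding Sum_any.expand_set gsum'
    using sum.not_neutral_contains_not_neutral by blast
  then have "\<gamma> = \<alpha> + \<beta>" "scoeff g \<beta> (C - A) \<noteq> 0"
    by (auto simp: when_def scoeff_def split: if_splits)
  with A that[of \<alpha> \<beta> A "C - A"] show ?thesis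
    by (auto simp: scoeff_def)
qed

text \<open>For infinite \<open>A\<close> the value is 0, because coefficients are supported on
  finite sets.\<close>

lift_definition gmonom :: "nat set \<Rightarrow> grassmann" is "\<lambda>A B. if finite A \<and> B = A then 1 else 0"
  by (auto split: if_splits)

definition smonom :: "(nat \<Rightarrow>\<^sub>0 nat) \<Rightarrow> nat set \<Rightarrow> superpoly" where
  "smonom \<alpha> A = Poly_Mapping.single \<alpha> (gmonom A)"

lemma scoeff_smonom: "scoeff (smonom \<alpha> A) \<beta> B = (if finite A \<and> \<beta> = \<alpha> \<and> B = A then 1 else 0)"
  by (auto simp: scoeff_def smonom_def lookup_single when_def gmonom.rep_eq)

lemma smonom_zero: "smonom 0 {} = 1"
  by (rule superpoly_eqI) (simp add: scoeff_smonom scoeff_one)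

lemma smonom_add_single:
  assumes "finite A"
  shows "smonom (\<alpha> + Poly_Mapping.single i 1) A = xvar i * smonom \<alpha> A"
proof (rule superpoly_eqI)
  fix \<beta> :: "nat \<Rightarrow>\<^sub>0 nat" and B
  have "Poly_Mapping.lookup \<beta> i \<noteq> 0 \<Longrightarrow> \<beta> = (\<beta> - Poly_Mapping.single i 1) + Poly_Mapping.single i 1"
    by (intro poly_mapping_eqI) (auto simp: lookup_add lookup_minus lookup_single when_def)
  then have "\<beta> = \<alpha> + Poly_Mapping.single i 1 \<longleftrightarrow>
      Poly_Mapping.lookup \<beta> i \<noteq> 0 \<and> \<beta> - Poly_Mapping.single i 1 = \<alpha>"
    by (auto simp: lookup_add)
  then show "scoeff (smonom (\<alpha> + Poly_Mapping.single i 1) A) \<beta> B = scoeff (xvar i * smonom \<alpha> A) \<beta> B"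
    by (auto simp: scoeff_smonom scoeff_xvar_mult)
qed

text \<open>A generator smaller than all of \<open>A\<close> enters from the left without passing
  another one, so no sign arises.\<close>

lemma smonom_insert:
  assumes "finite A" "\<forall>a\<in>A. j < a"
  shows "smonom \<alpha> (insert j A) = thetavar j * smonom \<alpha> A"
proof (rule superpoly_eqI)
  fix \<beta> and B :: "nat set" assume "finite B"
  moreover have "{a \<in> insert j A. a < j} = {}"
    using assms(2) by auto
  then have "(-1) ^ card {a \<in> insert j A. a < j} = (1 :: real)"
    by (metis card.empty power_0)
  moreover have "B - {j} = A \<and> j \<in> B \<longleftrightarrow> B = insert j A"
    using assms(2) by auto
  ultimately show "scoeff (smonom \<alpha> (insert j A)) \<beta> B = scoeff (thetavar j * smonom \<alpha> A) \<beta> B"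
    using assms(1) by (cases "B = insert j A") (simp_all del: insert_iff add: scoeff_smonom scoeff_thetavar_mult)
qed

lemma superpoly_expand:
  "f = (\<Sum>(\<alpha>, A) | scoeff f \<alpha> A \<noteq> 0. scoeff f \<alpha> A *\<^sub>R smonom \<alpha> A)"
proof (rule superpoly_eqI)
  fix \<beta> and B :: "nat set" assume "finite B"
  then have "(\<Sum>p | scoeff f (fst p) (snd p) \<noteq> 0. scoeff f (fst p) (snd p) *
      scoeff (smonom (fst p) (snd p)) \<beta> B) =
    (\<Sum>p | scoeff f (fst p) (snd p) \<noteq> 0. if p = (\<beta>, B) then scoeff f \<beta> B else 0)"
    by (intro sum.cong) (auto simp: scoeff_smonom prod_eq_iff)
  also have "\<dots> = scoeff f \<beta> B"
    using finite_scoeff_support[of f] by (subst sum.delta) (simp_all add: case_prod_unfold)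
  finally show "scoeff f \<beta> B =
      scoeff (\<Sum>(\<alpha>, A) | scoeff f \<alpha> A \<noteq> 0. scoeff f \<alpha> A *\<^sub>R smonom \<alpha> A) \<beta> B"
    by (simp add: case_prod_unfold)
qed

definition pdeg :: "(nat \<Rightarrow>\<^sub>0 nat) \<Rightarrow> nat" where
  "pdeg \<alpha> = (\<Sum>i\<in>Poly_Mapping.keys \<alpha>. Poly_Mapping.lookup \<alpha> i)"

lemma pdeg_eq_sum:
  assumes "finite S" "Poly_Mapping.keys \<alpha> \<subseteq> S"
  shows "pdeg \<alpha> = (\<Sum>i\<in>S. Poly_Mapping.lookup \<alpha> i)"
  unfolding pdeg_def by (rule sum.mono_neutral_left) (use assms in \<open>auto simp: in_keys_iff\<close>)

lemma pdeg_zero [simp]: "pdeg 0 = 0"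
  by (simp add: pdeg_def)

lemma pdeg_add: "pdeg (\<alpha> + \<beta>) = pdeg \<alpha> + pdeg \<beta>"
proof -
  let ?S = "Poly_Mapping.keys \<alpha> \<union> Poly_Mapping.keys \<beta>"
  have "pdeg (\<alpha> + \<beta>) = (\<Sum>i\<in>?S. Poly_Mapping.lookup (\<alpha> + \<beta>) i)"
    by (intro pdeg_eq_sum) (auto simp: Poly_Mapping.keys_add)
  also have "\<dots> = pdeg \<alpha> + pdeg \<beta>"
    by (simp add: pdeg_eq_sum[of ?S \<alpha>] pdeg_eq_sum[of ?S \<beta>] lookup_add sum.distrib)
  finally show ?thesis .
qed

lemma pdeg_single [simp]: "pdeg (Poly_Mapping.single i c) = c"
  by (simp add: pdeg_def)

lemma keys_add_nat: "Poly_Mapping.keys (\<alpha> + \<beta>) = Poly_Mapping.keys \<alpha> \<union> Poly_Mapping.keys (\<beta> :: 'a \<Rightarrow>\<^sub>0 nat)"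
  by (auto simp: in_keys_iff lookup_add)

text \<open>The even exponents are built over the empty set, and the odd generators are then
  multiplied on from the left in decreasing order. Every step is a product with one coordinate and
  carries no sign.\<close>

lemma smonom_induct [consumes 3, case_names one xvar thetavar]:
  fixes A J K :: "nat set" and \<alpha> :: "nat \<Rightarrow>\<^sub>0 nat"
  assumes "finite A" "Poly_Mapping.keys \<alpha> \<subseteq> K" "A \<subseteq> J"
    and one: "Q 0 {}"
    and xvar: "\<And>i \<beta>. i \<in> K \<Longrightarrow> Poly_Mapping.keys \<beta> \<subseteq> K \<Longrightarrow> Q \<beta> {} \<Longrightarrow> Q (\<beta> + Poly_Mapping.single i 1) {}"
    and thetavar: "\<And>j B. j \<in> J \<Longrightarrow> finite B \<Longrightarrow> B \<subseteq> J \<Longrightarrow> \<forall>b\<in>B. j < b \<Longrightarrow> Q \<alpha> B \<Longrightarrow> Q \<alpha> (insert j B)"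
  shows "Q \<alpha> A"
  using assms(1,3)
proof (induction A rule: finite_linorder_min_induct)
  case empty
  have "Q \<alpha> {}" if "pdeg \<alpha> = d" "Poly_Mapping.keys \<alpha> \<subseteq> K" for d \<alpha>
    using that
  proof (induction d arbitrary: \<alpha>)
    case 0
    then have "\<alpha> = 0"
      by (intro poly_mapping_eqI) (auto simp: pdeg_def in_keys_iff)
    with one show ?case by simp
  next
    case (Suc d)
    then obtain i where i: "i \<in> Poly_Mapping.keys \<alpha>"
      by (metis pdeg_def sum.empty ex_in_conv nat.distinct(1))
    define \<beta> where "\<beta> = \<alpha> - Poly_Mapping.single i 1"
    have eq: "\<alpha> = \<beta> + Poly_Mapping.single i 1"
      unfolding \<beta>_def using i
      by (intro poly_mapping_eqI) (auto simp: lookup_add lookup_minus lookup_single when_def in_keys_iff)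
    then have "Poly_Mapping.keys \<beta> \<subseteq> K" "pdeg \<beta> = d"
      using Suc.prems by (auto simp: keys_add_nat pdeg_add)
    with Suc.IH xvar[of i \<beta>] i Suc.prems eq show ?case by auto
  qed
  with assms(2) show ?case by blast
next
  case (insert j B)
  then show ?case by (intro thetavar) auto
qed

text \<open>The monomial case retains \<open>scoeff f \<alpha> A \<noteq> 0\<close>, so conditions
  on the support of \<open>f\<close> (variables, parity) pass to its monomials.\<close>

lemma superpoly_linear_induct [case_names zero add scaleR smonom]:
  assumes "Q 0" "\<And>f g. Q f \<Longrightarrow> Q g \<Longrightarrow> Q (f + g)" "\<And>c f. Q f \<Longrightarrow> Q (c *\<^sub>R f)"
    and "\<And>\<alpha> A. finite A \<Longrightarrow> scoeff f \<alpha> A \<noteq> 0 \<Longrightarrow> Q (smonom \<alpha> A)"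
  shows "Q f"
proof -
  have "Q (\<Sum>p\<in>S. scoeff f (fst p) (snd p) *\<^sub>R smonom (fst p) (snd p))"
    if "finite S" "S \<subseteq> {(\<alpha>, A). scoeff f \<alpha> A \<noteq> 0}" for S
    using that
  proof (induction S rule: finite_induct)
    case (insert p S)
    then have "Q (smonom (fst p) (snd p))"
      by (intro assms(4)) (auto intro: scoeff_finite_set)
    with insert show ?case by (simp add: assms(2,3))
  qed (simp add: assms(1))
  from this[OF finite_scoeff_support order_refl] show ?thesis
    by (subst superpoly_expand) (simp add: case_prod_beta)
qed

section \<open>Polynomials in finitely many coordinates\<close>

lemma superpolysD: "f \<in> superpolys m n \<Longrightarrow> scoeff f \<alpha> A \<noteq> 0 \<Longrightarrow>
    Poly_Mapping.keys \<alpha> \<subseteq> {1..m} \<and> A \<subseteq> {1..2 * n}"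
  by (auto simp: superpolys_def)

lemma subspace_superpolys: "subspace (superpolys m n)"
proof (rule subspaceI)
  fix f g assume "f \<in> superpolys m n" "g \<in> superpolys m n"
  then show "f + g \<in> superpolys m n"
    unfolding superpolys_def by simp (metis add.right_neutral)
qed (auto simp: superpolys_def)

lemma superpolys_one: "1 \<in> superpolys m n"
  by (auto simp: superpolys_def scoeff_one)

lemma superpolys_mult:
  assumes "f \<in> superpolys m n" "g \<in> superpolys m n"
  shows "f * g \<in> superpolys m n"
  unfolding superpolys_def
proof (intro CollectI allI impI)
  fix \<gamma> C assume "scoeff (f * g) \<gamma> C \<noteq> 0"
  then obtain \<alpha> \<beta> A B where "\<gamma> = \<alpha> + \<beta>" "C = A \<union> B" "scoeff f \<alpha> A \<noteq> 0" "scoeff g \<beta> B \<noteq> 0"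
    using scoeff_mult_nonzero by metis
  then show "Poly_Mapping.keys \<gamma> \<subseteq> {1..m} \<and> C \<subseteq> {1..2 * n}"
    using superpolysD[OF assms(1)] superpolysD[OF assms(2)] by (auto simp: keys_add_nat)
qed

lemma xvar_eq_smonom: "xvar i = smonom (Poly_Mapping.single i 1) {}"
  using smonom_add_single[of "{}" 0 i] by (simp add: smonom_zero)

lemma thetavar_eq_smonom: "thetavar j = smonom 0 {j}"
  using smonom_insert[of "{}" j 0] by (simp add: smonom_zero)

lemma smonom_in_superpolys:
  "Poly_Mapping.keys \<alpha> \<subseteq> {1..m} \<Longrightarrow> A \<subseteq> {1..2 * n} \<Longrightarrow> smonom \<alpha> A \<in> superpolys m n"
  by (auto simp: superpolys_def scoeff_smonom split: if_splits)

lemma xvar_in_superpolys: "i \<in> {1..m} \<Longrightarrow> xvar i \<in> superpolys m n"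
  unfolding xvar_eq_smonom by (rule smonom_in_superpolys) auto

lemma thetavar_in_superpolys: "j \<in> {1..2 * n} \<Longrightarrow> thetavar j \<in> superpolys m n"
  unfolding thetavar_eq_smonom by (rule smonom_in_superpolys) auto

lemma superpolys_induct [consumes 1, case_names zero add scaleR one xvar thetavar]:
  assumes "f \<in> superpolys m n"
    and "Q 0" "\<And>f g. Q f \<Longrightarrow> Q g \<Longrightarrow> Q (f + g)" "\<And>c f. Q f \<Longrightarrow> Q (c *\<^sub>R f)"
    and "Q 1" "\<And>i f. i \<in> {1..m} \<Longrightarrow> f \<in> superpolys m n \<Longrightarrow> Q f \<Longrightarrow> Q (xvar i * f)"
    and "\<And>j f. j \<in> {1..2 * n} \<Longrightarrow> f \<in> superpolys m n \<Longrightarrow> Q f \<Longrightarrow> Q (thetavar j * f)"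
  shows "Q f"
proof (induction rule: superpoly_linear_induct[of Q f])
  case (smonom \<alpha> A)
  have "Poly_Mapping.keys \<alpha> \<subseteq> {1..m}" "A \<subseteq> {1..2 * n}"
    using superpolysD[OF assms(1) smonom(2)] by auto
  with smonom(1) show ?case
  proof (induction \<alpha> A rule: smonom_induct)
    case one
    then show ?case using assms(5) by (simp add: smonom_zero)
  next
    case (xvar i \<beta>)
    then show ?case
      unfolding smonom_add_single[OF finite.emptyI] by (intro assms(6) smonom_in_superpolys) auto
  next
    case (thetavar j B)
    then show ?case
      using \<open>Poly_Mapping.keys \<alpha> \<subseteq> {1..m}\<close>
      unfolding smonom_insert[OF thetavar(2,4)] by (intro assms(7) smonom_in_superpolys) auto
  qed
qed (use assms in auto)

lemma dx_add [simp]: "dx i (f + g :: superpoly) = dx i f + dx i g"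
  and dx_scaleR [simp]: "dx i (c *\<^sub>R f :: superpoly) = c *\<^sub>R dx i f"
  by (rule superpoly_eqI; simp add: scoeff_dx algebra_simps)+

lemma dtheta_add [simp]: "dtheta i (f + g) = dtheta i f + dtheta i g"
  and dtheta_scaleR [simp]: "dtheta i (c *\<^sub>R f) = c *\<^sub>R dtheta i f"
  by (rule superpoly_eqI; simp add: scoeff_dtheta algebra_simps)+

lemma linear_dx: "linear (dx i :: superpoly \<Rightarrow> superpoly)"
  and linear_dtheta: "linear (dtheta i)"
  by (simp_all add: linearI)

lemma dx_simps [simp]:
  "dx i (0 :: superpoly) = 0" "dx i (f - g :: superpoly) = dx i f - dx i g"
  "dx i (- f :: superpoly) = - dx i f" "dx i (sum h S :: superpoly) = (\<Sum>s\<in>S. dx i (h s))"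
  using linear_dx[of i] by (simp_all add: linear_0 linear_diff linear_neg linear_sum)

lemma dtheta_simps [simp]:
  "dtheta i 0 = 0" "dtheta i (f - g) = dtheta i f - dtheta i g"
  "dtheta i (- f) = - dtheta i f" "dtheta i (sum h S) = (\<Sum>s\<in>S. dtheta i (h s))"
  using linear_dtheta[of i] by (simp_all add: linear_0 linear_diff linear_neg linear_sum)

lemma Sum_any_scaleR:
  fixes h :: "'a \<Rightarrow> 'b::real_vector"
  shows "Sum_any (\<lambda>a. c *\<^sub>R h a) = c *\<^sub>R Sum_any h"
  by (cases "c = 0") (simp_all add: Sum_any.expand_set scaleR_sum_right)

instance poly_mapping :: (monoid_add, real_algebra_1) real_algebra_1
proof
  fix c :: real and f g :: "'a \<Rightarrow>\<^sub>0 'b"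
  have "(c *\<^sub>R h when P) = c *\<^sub>R (h when P)" for h :: 'b and P
    by (simp add: when_def)
  then show "c *\<^sub>R f * g = c *\<^sub>R (f * g)" "f * c *\<^sub>R g = c *\<^sub>R (f * g)"
    by (intro poly_mapping_eqI; simp add: lookup_mult Sum_any_scaleR)+
qed

section \<open>Degree, parity and derivatives\<close>

text \<open>Homogeneous polynomials with an integer degree: \<open>hspace m n k = {0}\<close> for \<open>k < 0\<close>.\<close>

definition hspace :: "nat \<Rightarrow> nat \<Rightarrow> int \<Rightarrow> superpoly set" where
  "hspace m n k = {f \<in> superpolys m n. \<forall>\<alpha> A. scoeff f \<alpha> A \<noteq> 0 \<longrightarrow> int (pdeg \<alpha> + card A) = k}"

lemma homogeneous_superpolys_eq: "homogeneous_superpolys m n k = hspace m n (int k)"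
  by (simp only: homogeneous_superpolys_def hspace_def pdeg_def of_nat_eq_iff)

lemma hspaceD: "f \<in> hspace m n k \<Longrightarrow> scoeff f \<alpha> A \<noteq> 0 \<Longrightarrow> int (pdeg \<alpha> + card A) = k"
  by (simp add: hspace_def)

lemma hspace_superpolys: "f \<in> hspace m n k \<Longrightarrow> f \<in> superpolys m n"
  by (simp add: hspace_def)

lemma subspace_hspace: "subspace (hspace m n k)"
proof (rule subspaceI)
  fix f g assume fg: "f \<in> hspace m n k" "g \<in> hspace m n k"
  show "f + g \<in> hspace m n k"
    unfolding hspace_def
  proof (intro CollectI conjI allI impI)
    show "f + g \<in> superpolys m n"
      using fg by (intro subspace_add[OF subspace_superpolys]) (auto simp: hspace_def)
    fix \<alpha> A assume "scoeff (f + g) \<alpha> A \<noteq> 0"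
    then have "scoeff f \<alpha> A \<noteq> 0 \<or> scoeff g \<alpha> A \<noteq> 0" by auto
    then show "int (pdeg \<alpha> + card A) = k"
      using fg hspaceD by blast
  qed
next
  fix c f assume "f \<in> hspace m n k"
  then show "c *\<^sub>R f \<in> hspace m n k"
    using subspace_scale[OF subspace_superpolys, of f m n c] by (simp add: hspace_def)
next
  show "0 \<in> hspace m n k"
    using subspace_0[OF subspace_superpolys] by (auto simp: hspace_def)
qed

lemma hspace_neg: "f \<in> hspace m n k \<Longrightarrow> k < 0 \<Longrightarrow> f = 0"
  by (intro superpoly_eqI) (auto dest: hspaceD)

lemma hspace_mult:
  assumes "f \<in> hspace m n a" "g \<in> hspace m n b"
  shows "f * g \<in> hspace m n (a + b)"
  unfolding hspace_def
proof (intro CollectI conjI allI impI)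
  show "f * g \<in> superpolys m n"
    using assms by (intro superpolys_mult hspace_superpolys)
  fix \<gamma> C assume "scoeff (f * g) \<gamma> C \<noteq> 0"
  then obtain \<alpha> \<beta> A B where *: "\<gamma> = \<alpha> + \<beta>" "C = A \<union> B" "A \<inter> B = {}" "scoeff f \<alpha> A \<noteq> 0" "scoeff g \<beta> B \<noteq> 0"
    using scoeff_mult_nonzero by metis
  moreover have "finite A" "finite B"
    using * scoeff_finite_set by blast+
  ultimately show "int (pdeg \<gamma> + card C) = a + b"
    using hspaceD[OF assms(1) *(4)] hspaceD[OF assms(2) *(5)] by (simp add: pdeg_add card_Un_disjoint)
qed

lemma one_in_hspace: "1 \<in> hspace m n 0"
  by (auto simp: hspace_def superpolys_one scoeff_one split: if_splits)

lemma smonom_in_hspace: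
  "Poly_Mapping.keys \<alpha> \<subseteq> {1..m} \<Longrightarrow> A \<subseteq> {1..2 * n} \<Longrightarrow> smonom \<alpha> A \<in> hspace m n (int (pdeg \<alpha> + card A))"
  by (auto simp: hspace_def smonom_in_superpolys scoeff_smonom split: if_splits)

lemma xvar_in_hspace: "i \<in> {1..m} \<Longrightarrow> xvar i \<in> hspace m n 1"
  using smonom_in_hspace[of "Poly_Mapping.single i 1" m "{}" n] by (simp add: xvar_eq_smonom)

lemma thetavar_in_hspace: "j \<in> {1..2 * n} \<Longrightarrow> thetavar j \<in> hspace m n 1"
  using smonom_in_hspace[of 0 m "{j}" n] by (simp add: thetavar_eq_smonom)

lemma xvar_mult_hspace: "i \<in> {1..m} \<Longrightarrow> f \<in> hspace m n (k - 1) \<Longrightarrow> xvar i * f \<in> hspace m n k"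
  using hspace_mult[of "xvar i" m n 1 f "k - 1"] xvar_in_hspace by simp

lemma hspace_zero_const:
  assumes "f \<in> hspace m n 0" obtains c where "f = c *\<^sub>R 1"
proof
  show "f = scoeff f 0 {} *\<^sub>R 1"
  proof (rule superpoly_eqI)
    fix \<alpha> and A :: "nat set" assume "finite A"
    have "\<alpha> = 0 \<and> A = {}" if "scoeff f \<alpha> A \<noteq> 0"
    proof -
      have "pdeg \<alpha> = 0" "card A = 0"
        using hspaceD[OF assms that] by linarith+
      then show ?thesis
        using \<open>finite A\<close> by (auto simp: pdeg_def in_keys_iff intro!: poly_mapping_eqI)
    qed
    then show "scoeff f \<alpha> A = scoeff (scoeff f 0 {} *\<^sub>R 1) \<alpha> A"
      by (auto simp: scoeff_one)
  qed
qed

lemma dx_superpolys: "f \<in> superpolys m n \<Longrightarrow> dx i f \<in> superpolys m n"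
  by (simp add: superpolys_def scoeff_dx) (metis Un_subset_iff keys_add_nat)

lemma dtheta_superpolys: "f \<in> superpolys m n \<Longrightarrow> dtheta i f \<in> superpolys m n"
  by (simp add: superpolys_def scoeff_dtheta) (metis insert_subset)

lemma dx_hspace:
  assumes "f \<in> hspace m n k" shows "dx i f \<in> hspace m n (k - 1)"
  unfolding hspace_def
proof (intro CollectI conjI allI impI)
  show "dx i f \<in> superpolys m n"
    using assms by (intro dx_superpolys hspace_superpolys)
  fix \<alpha> A assume "scoeff (dx i f) \<alpha> A \<noteq> 0"
  then have "scoeff f (\<alpha> + Poly_Mapping.single i 1) A \<noteq> 0"
    by (simp add: scoeff_dx)
  from hspaceD[OF assms this] show "int (pdeg \<alpha> + card A) = k - 1"
    by (simp add: pdeg_add)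
qed

lemma dtheta_hspace:
  assumes "f \<in> hspace m n k" shows "dtheta i f \<in> hspace m n (k - 1)"
  unfolding hspace_def
proof (intro CollectI conjI allI impI)
  show "dtheta i f \<in> superpolys m n"
    using assms by (intro dtheta_superpolys hspace_superpolys)
  fix \<alpha> A assume nz: "scoeff (dtheta i f) \<alpha> A \<noteq> 0"
  then have "scoeff f \<alpha> (insert i A) \<noteq> 0" "i \<notin> A"
    by (auto simp: scoeff_dtheta split: if_splits)
  with hspaceD[OF assms this(1)] scoeff_finite_set[OF nz] show "int (pdeg \<alpha> + card A) = k - 1"
    by simp
qed

section \<open>The parity grading\<close>

lemma parity_part_cong: "p mod 2 = q mod 2 \<Longrightarrow> parity_part p = parity_part q"
  by (simp add: parity_part_def)

lemma parity_partD: "f \<in> parity_part p \<Longrightarrow> scoeff f \<alpha> A \<noteq> 0 \<Longrightarrow> card A mod 2 = p mod 2"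
  by (simp add: parity_part_def)

lemma subspace_parity_part: "subspace (parity_part p)"
proof (rule subspaceI)
  fix f g assume fg: "f \<in> parity_part p" "g \<in> parity_part p"
  show "f + g \<in> parity_part p"
    unfolding parity_part_def
  proof (intro CollectI allI impI)
    fix \<alpha> A assume "scoeff (f + g) \<alpha> A \<noteq> 0"
    then have "scoeff f \<alpha> A \<noteq> 0 \<or> scoeff g \<alpha> A \<noteq> 0" by auto
    then show "card A mod 2 = p mod 2"
      using fg parity_partD by blast
  qed
qed (auto simp: parity_part_def)

lemma parity_part_disjoint:
  assumes "f \<in> parity_part p" "f \<in> parity_part q" "p mod 2 \<noteq> q mod 2" shows "f = 0"
proof (rule superpoly_eqI)
  fix \<alpha> A
  have "scoeff f \<alpha> A = 0"
    using parity_partD[OF assms(1), of \<alpha> A] parity_partD[OF assms(2), of \<alpha> A] assms(3) by argo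
  then show "scoeff f \<alpha> A = scoeff 0 \<alpha> A" by simp
qed

lemma parity_part_mult:
  assumes "f \<in> parity_part p" "g \<in> parity_part q"
  shows "f * g \<in> parity_part (p + q)"
  unfolding parity_part_def
proof (intro CollectI allI impI)
  fix \<gamma> C assume "scoeff (f * g) \<gamma> C \<noteq> 0"
  then obtain \<alpha> \<beta> A B where *: "\<gamma> = \<alpha> + \<beta>" "C = A \<union> B" "A \<inter> B = {}" "scoeff f \<alpha> A \<noteq> 0" "scoeff g \<beta> B \<noteq> 0"
    using scoeff_mult_nonzero by metis
  moreover have "finite A" "finite B"
    using * scoeff_finite_set by blast+
  ultimately have "card C = card A + card B"
    by (simp add: card_Un_disjoint)
  with mod_add_cong[OF parity_partD[OF assms(1) *(4)] parity_partD[OF assms(2) *(5)]]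
  show "card C mod 2 = (p + q) mod 2" by simp
qed

lemma smonom_parity: "smonom \<alpha> A \<in> parity_part (card A)"
  by (auto simp: parity_part_def scoeff_smonom split: if_splits)

lemma one_parity: "1 \<in> parity_part 0"
  by (auto simp: parity_part_def scoeff_one split: if_splits)

lemma xvar_parity: "xvar i \<in> parity_part 0"
  using smonom_parity[of "Poly_Mapping.single i 1" "{}"] by (simp add: xvar_eq_smonom)

lemma thetavar_parity: "thetavar j \<in> parity_part 1"
  using smonom_parity[of 0 "{j}"] by (simp add: thetavar_eq_smonom)

lemma dx_parity: "f \<in> parity_part p \<Longrightarrow> dx i f \<in> parity_part p"
  by (simp add: parity_part_def scoeff_dx)

lemma dtheta_parity:
  assumes "f \<in> parity_part p" shows "dtheta i f \<in> parity_part (p + 1)"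
  unfolding parity_part_def
proof (intro CollectI allI impI)
  fix \<alpha> A assume nz: "scoeff (dtheta i f) \<alpha> A \<noteq> 0"
  then have "scoeff f \<alpha> (insert i A) \<noteq> 0" "i \<notin> A"
    by (auto simp: scoeff_dtheta split: if_splits)
  with parity_partD[OF assms this(1)] scoeff_finite_set[OF nz] have "Suc (card A) mod 2 = p mod 2"
    by simp
  then show "card A mod 2 = (p + 1) mod 2"
    by presburger
qed

text \<open>The projection to the component of parity \<open>q\<close>, meaningful for
  \<open>q\<close> in {0, 1}: the monomial expansion cut down to the sets \<open>A\<close> of that
  parity.\<close>

definition ppart :: "nat \<Rightarrow> superpoly \<Rightarrow> superpoly" where
  "ppart q f = (\<Sum>p | scoeff f (fst p) (snd p) \<noteq> 0 \<and> card (snd p) mod 2 = q.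
      scoeff f (fst p) (snd p) *\<^sub>R smonom (fst p) (snd p))"

lemma scoeff_ppart: "scoeff (ppart q f) \<alpha> A = (if card A mod 2 = q then scoeff f \<alpha> A else 0)"
proof (cases "finite A")
  case True
  let ?S = "{p. scoeff f (fst p) (snd p) \<noteq> 0 \<and> card (snd p) mod 2 = q}"
  have "finite ?S"
    using finite_scoeff_support[of f] by (rule rev_finite_subset) auto
  moreover have "scoeff (ppart q f) \<alpha> A = (\<Sum>p\<in>?S. if p = (\<alpha>, A) then scoeff f \<alpha> A else 0)"
    unfolding ppart_def using True by (simp, intro sum.cong) (auto simp: scoeff_smonom prod_eq_iff)
  ultimately show ?thesis by (simp add: sum.delta)
next
  case False
  then show ?thesis using scoeff_finite_set by metis
qed

lemma ppart_add: "f = ppart 0 f + ppart 1 f"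
  by (rule superpoly_eqI) (auto simp: scoeff_ppart)

lemma ppart_parity: "ppart q f \<in> parity_part q"
  by (auto simp: parity_part_def scoeff_ppart)

lemma ppart_superpolys: "f \<in> superpolys m n \<Longrightarrow> ppart q f \<in> superpolys m n"
  by (auto simp: superpolys_def scoeff_ppart)

lemma ppart_hspace: "f \<in> hspace m n k \<Longrightarrow> ppart q f \<in> hspace m n k"
  by (auto simp: hspace_def scoeff_ppart ppart_superpolys)

section \<open>Supercommutation and Leibniz rules\<close>

lemma xvar_mult_commute: "f * xvar i = xvar i * f"
proof (induction rule: superpoly_linear_induct[of _ f])
  case (smonom \<alpha> A)
  then show ?case by (simp add: smonom_def xvar_def mult_single add.commute)
qed (simp_all add: algebra_simps)

lemma xvar_left_commute: "f * (xvar i * g) = xvar i * (f * g)"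
  using arg_cong[OF xvar_mult_commute[of f i], of "\<lambda>h. h * g"] by (simp only: mult.assoc)

text \<open>For i < j the product theta_i theta_j is a basis monomial, while theta_j theta_i has one
  inversion. Squares vanish because no set \<open>A\<close> contains \<open>i\<close> and satisfies
  \<open>A - {i} = {i}\<close>.\<close>

lemma thetavar_anticommute: "thetavar i * thetavar j = - (thetavar j * thetavar i)"
proof -
  have *: "thetavar i * thetavar j = - (thetavar j * thetavar i)" if "i < j" for i j
  proof (rule superpoly_eqI)
    fix \<alpha> and B :: "nat set" assume B: "finite B"
    have 1: "thetavar i * thetavar j = smonom 0 {i, j}"
      using that smonom_insert[of "{j}" i 0] by (simp add: thetavar_eq_smonom[of j])
    have "(-1) ^ card {a \<in> {i, j}. a < j} = (-1 :: real)"
    proof -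
      have "{a \<in> {i, j}. a < j} = {i}" using that by blast
      from arg_cong[OF this, of "\<lambda>S. (-1 :: real) ^ card S"] show ?thesis by simp
    qed
    moreover have "B - {j} = {i} \<and> j \<in> B \<longleftrightarrow> B = {i, j}"
      using that by blast
    ultimately have "scoeff (thetavar j * thetavar i) \<alpha> B = (if \<alpha> = 0 \<and> B = {i, j} then -1 else 0)"
      using B by (cases "B = {i, j}")
        (simp_all only: scoeff_thetavar_mult thetavar_eq_smonom[of i] scoeff_smonom, auto)
    with 1 show "scoeff (thetavar i * thetavar j) \<alpha> B = scoeff (- (thetavar j * thetavar i)) \<alpha> B"
      by (simp add: scoeff_smonom)
  qed
  have "thetavar i * thetavar i = 0"
    by (rule superpoly_eqI) (auto simp: scoeff_thetavar_mult thetavar_eq_smonom[of i] scoeff_smonom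
      scoeff_thetavar_mult[unfolded thetavar_eq_smonom])
  with *[of i j] *[of j i] show ?thesis
    by (cases i j rule: linorder_cases) auto
qed

lemma thetavar_left_anticommute: "thetavar i * (thetavar j * f) = - (thetavar j * (thetavar i * f))"
  using arg_cong[OF thetavar_anticommute[of i j], of "\<lambda>h. h * f"]
  by (simp only: mult.assoc mult_minus_left)

lemma thetavar_smonom_commute:
  assumes "finite A"
  shows "thetavar j * smonom \<alpha> A = (-1) ^ card A *\<^sub>R (smonom \<alpha> A * thetavar j)"
  using assms subset_UNIV[of "Poly_Mapping.keys \<alpha>"] subset_UNIV[of A]
proof (induction \<alpha> A rule: smonom_induct)
  case one
  then show ?case by (simp add: smonom_zero)
next
  case (xvar i \<beta>)
  have "thetavar j * (xvar i * smonom \<beta> {}) = xvar i * (thetavar j * smonom \<beta> {})"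
    by (rule xvar_left_commute)
  also have "\<dots> = (xvar i * smonom \<beta> {}) * thetavar j"
    using xvar by (simp add: mult.assoc)
  finally show ?case
    by (simp only: smonom_add_single[OF finite.emptyI] card.empty power_0 scaleR_one)
next
  case (thetavar k B)
  have "thetavar j * (thetavar k * smonom \<alpha> B) = - (thetavar k * (thetavar j * smonom \<alpha> B))"
    by (rule thetavar_left_anticommute)
  also have "\<dots> = - ((-1) ^ card B) *\<^sub>R (thetavar k * smonom \<alpha> B * thetavar j)"
    using thetavar by (simp add: mult.assoc)
  finally have "thetavar j * (thetavar k * smonom \<alpha> B) = - ((-1) ^ card B) *\<^sub>R (thetavar k * smonom \<alpha> B * thetavar j)" .
  moreover have "card (insert k B) = Suc (card B)"
    using thetavar(2,4) by auto
  ultimately show ?case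
    using thetavar(2,4) by (simp add: smonom_insert)
qed

text \<open>Parity reaches the monomials as an equality of signs, the form in which it enters the
  commutation and Leibniz rules.\<close>

lemma parity_part_linear_induct [consumes 1, case_names zero add scaleR smonom]:
  assumes "f \<in> parity_part p" "Q 0" "\<And>f g. Q f \<Longrightarrow> Q g \<Longrightarrow> Q (f + g)" "\<And>c f. Q f \<Longrightarrow> Q (c *\<^sub>R f)"
    and "\<And>\<alpha> A. finite A \<Longrightarrow> (-1) ^ p = ((-1) ^ card A :: real) \<Longrightarrow> Q (smonom \<alpha> A)"
  shows "Q f"
proof (induction rule: superpoly_linear_induct[of _ f])
  case (smonom \<alpha> A)
  have "card A mod 2 = p mod 2"
    using parity_partD[OF assms(1) smonom(2)] .
  then have "even p \<longleftrightarrow> even (card A)"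
    by presburger
  then show ?case
    using assms(5)[OF smonom(1)] by (simp add: minus_one_power_iff)
qed (use assms in auto)

lemma thetavar_mult_commute:
  assumes "f \<in> parity_part p"
  shows "thetavar j * f = (-1) ^ p *\<^sub>R (f * thetavar j)"
  using assms
  by (induction rule: parity_part_linear_induct) (simp_all add: algebra_simps thetavar_smonom_commute)

lemma dx_mult: "dx i (f * g) = dx i f * g + f * dx i (g :: superpoly)"
proof (induction rule: superpoly_linear_induct[of _ f])
  case (smonom \<alpha> A)
  show ?case
    using smonom(1) subset_UNIV[of "Poly_Mapping.keys \<alpha>"] subset_UNIV[of A]
  proof (induction \<alpha> A rule: smonom_induct)
    case one
    then show ?case by (simp add: smonom_zero dx_one)
  next
    case (xvar i \<beta>)
    then show ?case
      by (simp only: smonom_add_single[OF finite.emptyI]) (simp add: mult.assoc dx_xvar_mult algebra_simps)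
  next
    case (thetavar j B)
    then show ?case
      by (simp add: smonom_insert mult.assoc dx_thetavar_mult algebra_simps)
  qed
qed (simp_all add: algebra_simps)

lemma dtheta_mult:
  assumes "f \<in> parity_part p"
  shows "dtheta j (f * g) = dtheta j f * g + (-1) ^ p *\<^sub>R (f * dtheta j g)"
  using assms
proof (induction rule: parity_part_linear_induct)
  case (smonom \<alpha> A)
  have "dtheta j (smonom \<alpha> A * g) = dtheta j (smonom \<alpha> A) * g + (-1) ^ card A *\<^sub>R (smonom \<alpha> A * dtheta j g)"
    using smonom(1) subset_UNIV[of "Poly_Mapping.keys \<alpha>"] subset_UNIV[of A]
  proof (induction \<alpha> A rule: smonom_induct)
    case one
    then show ?case by (simp add: smonom_zero dtheta_one)
  next
    case (xvar i \<beta>)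
    then show ?case
      by (simp only: smonom_add_single[OF finite.emptyI]) (simp add: mult.assoc dtheta_xvar_mult algebra_simps)
  next
    case (thetavar j B)
    moreover have "card (insert j B) = Suc (card B)"
      using thetavar by auto
    ultimately show ?case
      by (simp add: smonom_insert mult.assoc dtheta_thetavar_mult algebra_simps)
  qed
  with smonom show ?case by simp
qed (simp_all add: algebra_simps)

section \<open>The Euler operator\<close>

definition euler :: "nat \<Rightarrow> nat \<Rightarrow> superpoly \<Rightarrow> superpoly" where
  "euler m n f = (\<Sum>i=1..m. xvar i * dx i f) + (\<Sum>j=1..2 * n. thetavar j * dtheta j f)"

text \<open>On coefficients, x_i d/dx_i multiplies by the exponent of x_i, and theta_j d/dtheta_j by
  1 or 0 according to whether j lies in \<open>A\<close>; these numbers add up to the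
  degree.\<close>

lemma euler_hspace:
  assumes "f \<in> hspace m n k" shows "euler m n f = real_of_int k *\<^sub>R f"
proof (rule superpoly_eqI)
  fix \<alpha> :: "nat \<Rightarrow>\<^sub>0 nat" and A :: "nat set" assume A: "finite A"
  have "scoeff (xvar i * dx i f) \<alpha> A = real (Poly_Mapping.lookup \<alpha> i) * scoeff f \<alpha> A" for i
  proof (cases "Poly_Mapping.lookup \<alpha> i = 0")
    case False
    then have "\<alpha> - Poly_Mapping.single i 1 + Poly_Mapping.single i 1 = \<alpha>"
      by (intro poly_mapping_eqI) (auto simp: lookup_add lookup_minus lookup_single when_def)
    with False show ?thesis
      by (simp add: scoeff_xvar_mult scoeff_dx lookup_minus)
  qed (simp add: scoeff_xvar_mult)
  moreover have "scoeff (thetavar j * dtheta j f) \<alpha> A = (if j \<in> A then scoeff f \<alpha> A else 0)" for j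
  proof -
    have "{a \<in> A. a \<noteq> j \<and> a < j} = {a \<in> A. a < j}" "j \<in> A \<Longrightarrow> insert j A = A" by auto
    then show ?thesis
      using A by (simp add: scoeff_thetavar_mult scoeff_dtheta)
  qed
  ultimately have "scoeff (euler m n f) \<alpha> A =
      (\<Sum>i=1..m. real (Poly_Mapping.lookup \<alpha> i) * scoeff f \<alpha> A) + (\<Sum>j=1..2 * n. if j \<in> A then scoeff f \<alpha> A else 0)"
    by (simp add: euler_def)
  also have "\<dots> = real_of_int k * scoeff f \<alpha> A"
  proof (cases "scoeff f \<alpha> A = 0")
    case False
    then have *: "Poly_Mapping.keys \<alpha> \<subseteq> {1..m}" "A \<subseteq> {1..2 * n}" "int (pdeg \<alpha> + card A) = k"
      using assms superpolysD hspaceD hspace_superpolys by blast+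
    then have "{1..2 * n} \<inter> A = A" by auto
    then show ?thesis
      using pdeg_eq_sum[OF _ *(1)]
      by (simp add: sum.If_cases flip: sum_distrib_right of_nat_sum *(3)) (simp add: algebra_simps)
  qed (auto intro!: sum.neutral)
  finally show "scoeff (euler m n f) \<alpha> A = scoeff (real_of_int k *\<^sub>R f) \<alpha> A"
    by simp
qed

text \<open>Euler's identity writes a polynomial of degree k + 1 as 1/(k + 1) times a sum of
  coordinates multiplied by derivatives of degree k, which allows induction over homogeneous
  polynomials without leaving their degree.\<close>

lemma hspace_induct [consumes 1, case_names zero add scaleR one xvar thetavar]:
  assumes "f \<in> hspace m n (int k)"
    and zero: "\<And>k. Q k 0" and add: "\<And>k f g. Q k f \<Longrightarrow> Q k g \<Longrightarrow> Q k (f + g)"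
    and scale: "\<And>k c f. Q k f \<Longrightarrow> Q k (c *\<^sub>R f)"
    and one: "Q 0 1"
    and xvar: "\<And>i k f. i \<in> {1..m} \<Longrightarrow> f \<in> hspace m n (int k) \<Longrightarrow> Q k f \<Longrightarrow> Q (Suc k) (xvar i * f)"
    and thetavar: "\<And>j k f. j \<in> {1..2 * n} \<Longrightarrow> f \<in> hspace m n (int k) \<Longrightarrow> Q k f \<Longrightarrow> Q (Suc k) (thetavar j * f)"
  shows "Q k f"
  using assms(1)
proof (induction k arbitrary: f)
  case 0
  then obtain c where "f = c *\<^sub>R 1"
    using hspace_zero_const[of f m n] by auto
  with one scale show ?case by simp
next
  case (Suc k)
  have sum: "Q (Suc k) (sum h S)" if "finite S" "\<And>s. s \<in> S \<Longrightarrow> Q (Suc k) (h s)" for h and S :: "nat set"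
    using that by (induction S rule: finite_induct) (auto intro: zero add)
  have "dx i f \<in> hspace m n (int k)" "dtheta i f \<in> hspace m n (int k)" for i
    using dx_hspace[OF Suc.prems] dtheta_hspace[OF Suc.prems] by simp_all
  then have "Q (Suc k) (euler m n f)"
    unfolding euler_def by (intro add sum) (auto intro!: xvar thetavar Suc.IH)
  then have "Q (Suc k) ((1 / real (Suc k)) *\<^sub>R euler m n f)"
    by (rule scale)
  then show ?case
    using euler_hspace[OF Suc.prems] by simp
qed

section \<open>The Laplacian and the square radius\<close>

lemma linear_laplacian: "linear (laplacian m n)"
  by (rule linearI)
    (simp_all add: laplacian_def sum.distrib scaleR_add_right scaleR_diff_right scaleR_scaleR flip: scaleR_sum_right)

lemma laplacian_simps [simp]:
  "laplacian m n 0 = 0" "laplacian m n (f + g) = laplacian m n f + laplacian m n g"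
  "laplacian m n (f - g) = laplacian m n f - laplacian m n g" "laplacian m n (- f) = - laplacian m n f"
  "laplacian m n (c *\<^sub>R f) = c *\<^sub>R laplacian m n f"
  "laplacian m n (sum h S) = (\<Sum>s\<in>S. laplacian m n (h s))"
  using linear_laplacian[of m n]
  by (simp_all add: linear_0 linear_add linear_diff linear_neg linear_scale linear_sum)

lemma laplacian_one: "laplacian m n 1 = 0"
  by (simp add: laplacian_def dx_one dtheta_one)

lemma laplacian_superpolys: "f \<in> superpolys m' n' \<Longrightarrow> laplacian m n f \<in> superpolys m' n'"
  unfolding laplacian_def
  by (intro subspace_diff subspace_sum subspace_scale subspace_superpolys dx_superpolys dtheta_superpolys)

lemma laplacian_hspace:
  assumes "f \<in> hspace m' n' k" shows "laplacian m n f \<in> hspace m' n' (k - 2)"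
proof -
  have "dx j (dx j f) \<in> hspace m' n' (k - 2)" "dtheta i (dtheta j f) \<in> hspace m' n' (k - 2)" for i j
    using dx_hspace[OF dx_hspace[OF assms]] dtheta_hspace[OF dtheta_hspace[OF assms]] by simp_all
  then show ?thesis
    unfolding laplacian_def by (intro subspace_diff subspace_sum subspace_scale subspace_hspace)
qed

lemma laplacian_parity:
  assumes "f \<in> parity_part p" shows "laplacian m n f \<in> parity_part p"
proof -
  have "dtheta i (dtheta j f) \<in> parity_part p" for i j
    using dtheta_parity[OF dtheta_parity[OF assms]] parity_part_cong[of "p + 1 + 1" p] by simp
  with assms show ?thesis
    unfolding laplacian_def by (intro subspace_diff subspace_sum subspace_scale subspace_parity_part dx_parity)
qed

lemma laplacian_Suc: "laplacian (Suc m) n f = dx (Suc m) (dx (Suc m) f) + laplacian m n f"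
  by (simp add: laplacian_def)

lemma laplacian_xvar_mult:
  "laplacian m n (xvar i * f) = xvar i * laplacian m n f + (if i \<in> {1..m} then 2 *\<^sub>R dx i f else 0)"
proof -
  have "dx j (dx j (xvar i * f)) = xvar i * dx j (dx j f) + (if j = i then 2 *\<^sub>R dx i f else 0)" for j
    by (simp add: dx_xvar_mult scaleR_2)
  then show ?thesis
    by (simp add: laplacian_def dtheta_xvar_mult sum.distrib sum_distrib_left algebra_simps)
qed

text \<open>
  The symplectic partner of \<open>\<theta>\<^sub>q\<close> in \<open>R\<^sup>2\<close>, and the sign with which it occurs.
\<close>

definition tconj :: "nat \<Rightarrow> nat" where
  "tconj q = (if odd q then q + 1 else q - 1)"

definition tsgn :: "nat \<Rightarrow> real" where
  "tsgn q = (if odd q then 1 else -1)"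

lemma tconj_mem: "q \<in> {1..2 * n} \<Longrightarrow> tconj q \<in> {1..2 * n}"
  unfolding tconj_def atLeastAtMost_iff by presburger

lemma tconj_tconj: "q \<in> {1..2 * n} \<Longrightarrow> tconj (tconj q) = q"
  by (auto simp: tconj_def elim!: oddE evenE)

text \<open>Only the summand of Delta that contains theta_q fails to commute with it. The sign tells
  whether theta_q meets the inner derivative (q even) or the outer one (q odd), and the factor 4 is
  that of the odd part of Delta.\<close>

lemma laplacian_thetavar_mult:
  assumes q: "q \<in> {1..2 * n}"
  shows "laplacian m n (thetavar q * f) = thetavar q * laplacian m n f + (4 * tsgn q) *\<^sub>R dtheta (tconj q) f"
proof -
  have *: "dtheta (2 * j - 1) (dtheta (2 * j) (thetavar q * f)) =
      thetavar q * dtheta (2 * j - 1) (dtheta (2 * j) f) +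
      (if j = (q + 1) div 2 then - tsgn q *\<^sub>R dtheta (tconj q) f else 0)" if j: "j \<in> {1..n}" for j
  proof -
    consider "q = 2 * j" | "q = 2 * j - 1" | "q \<noteq> 2 * j" "q \<noteq> 2 * j - 1" by blast
    then show ?thesis
    proof cases
      case 1
      moreover have "2 * j - 1 \<noteq> 2 * j" using j by auto
      ultimately show ?thesis by (simp add: dtheta_thetavar_mult tconj_def tsgn_def)
    next
      case 2
      then have "odd q" "Suc q = 2 * j" using j by auto
      with 2 show ?thesis using j by (simp add: dtheta_thetavar_mult tconj_def tsgn_def)
    next
      case 3
      then have "j \<noteq> (q + 1) div 2" using j by presburger
      with 3 show ?thesis by (simp add: dtheta_thetavar_mult)
    qed
  qed
  have mem: "(q + 1) div 2 \<in> {1..n}" using q by auto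
  have "(\<Sum>j=1..n. dtheta (2 * j - 1) (dtheta (2 * j) (thetavar q * f))) =
      (\<Sum>j=1..n. thetavar q * dtheta (2 * j - 1) (dtheta (2 * j) f) +
      (if j = (q + 1) div 2 then - tsgn q *\<^sub>R dtheta (tconj q) f else 0))"
    by (rule sum.cong[OF refl *])
  also have "\<dots> = thetavar q * (\<Sum>j=1..n. dtheta (2 * j - 1) (dtheta (2 * j) f)) -
      tsgn q *\<^sub>R dtheta (tconj q) f"
    using mem by (simp add: sum.distrib sum_distrib_left)
  finally have eq: "(\<Sum>j=1..n. dtheta (2 * j - 1) (dtheta (2 * j) (thetavar q * f))) =
      thetavar q * (\<Sum>j=1..n. dtheta (2 * j - 1) (dtheta (2 * j) f)) - tsgn q *\<^sub>R dtheta (tconj q) f" .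
  show ?thesis
    unfolding laplacian_def eq by (simp add: dx_thetavar_mult sum_distrib_left algebra_simps)
qed

lemma sum_pairs: "(\<Sum>q=1..2 * n. g q) = (\<Sum>j=1..n. g (2 * j - 1) + g (2 * j))"
  for g :: "nat \<Rightarrow> 'a::comm_monoid_add"
  by (induction n) (simp_all add: add.assoc)

lemma R2_superpolys: "R2 m n \<in> superpolys m n"
  unfolding R2_def power2_eq_square
  by (intro subspace_diff subspace_sum subspace_superpolys superpolys_mult xvar_in_superpolys thetavar_in_superpolys) auto

lemma R2_hspace: "R2 m n \<in> hspace m n 2"
proof -
  have "xvar i * xvar i \<in> hspace m n 2" if "i \<in> {1..m}" for i
    using hspace_mult[OF xvar_in_hspace xvar_in_hspace, OF that that] by simp
  moreover have "thetavar (2 * j - 1) * thetavar (2 * j) \<in> hspace m n 2" if "j \<in> {1..n}" for j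
  proof -
    have "2 * j - 1 \<in> {1..2 * n}" "2 * j \<in> {1..2 * n}" using that by auto
    from hspace_mult[OF this[THEN thetavar_in_hspace]] show ?thesis by simp
  qed
  ultimately show ?thesis
    unfolding R2_def power2_eq_square by (intro subspace_diff subspace_sum subspace_hspace)
qed

lemma R2_parity: "R2 m n \<in> parity_part 0"
proof -
  have "thetavar i * thetavar j \<in> parity_part 0" for i j
    using parity_part_mult[OF thetavar_parity thetavar_parity] parity_part_cong[of "1 + 1" 0] by simp
  moreover have "xvar i * xvar i \<in> parity_part 0" for i
    using parity_part_mult[OF xvar_parity xvar_parity] by simp
  ultimately show ?thesis
    unfolding R2_def power2_eq_square by (intro subspace_diff subspace_sum subspace_parity_part)
qed

lemma R2_mult_superpolys: "f \<in> superpolys m n \<Longrightarrow> R2 m n * f \<in> superpolys m n"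
  by (rule superpolys_mult[OF R2_superpolys])

lemma R2_mult_hspace: "f \<in> hspace m n (k - 2) \<Longrightarrow> R2 m n * f \<in> hspace m n k"
  using hspace_mult[OF R2_hspace, of f m n "k - 2"] by simp

lemma R2_mult_parity: "f \<in> parity_part p \<Longrightarrow> R2 m n * f \<in> parity_part p"
  using parity_part_mult[OF R2_parity] by simp

lemma R2_Suc: "R2 (Suc m) n = xvar (Suc m) ^ 2 + R2 m n"
  by (simp add: R2_def)

text \<open>The sl(2) relation between Delta, R^2 and the Euler operator. Every even variable
  contributes 2 to the constant and every pair of odd variables -4, which gives 2M.\<close>

lemma laplacian_R2_mult:
  "laplacian m n (R2 m n * f) =
    R2 m n * laplacian m n f + 4 *\<^sub>R euler m n f + (2 * (real m - 2 * real n)) *\<^sub>R f"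
proof -
  have x: "laplacian m n (xvar i * (xvar i * f)) =
      xvar i * (xvar i * laplacian m n f) + (4 *\<^sub>R (xvar i * dx i f) + 2 *\<^sub>R f)" if "i \<in> {1..m}" for i
    using that by (simp add: laplacian_xvar_mult dx_xvar_mult algebra_simps flip: scaleR_add_left)
  have th: "laplacian m n (thetavar (2 * j - 1) * (thetavar (2 * j) * f)) =
      thetavar (2 * j - 1) * (thetavar (2 * j) * laplacian m n f) -
      (4 *\<^sub>R (thetavar (2 * j - 1) * dtheta (2 * j - 1) f + thetavar (2 * j) * dtheta (2 * j) f) - 4 *\<^sub>R f)"
    if "j \<in> {1..n}" for j
  proof -
    have "2 * j - 1 \<in> {1..2 * n}" "2 * j \<in> {1..2 * n}" "odd (2 * j - 1)" "Suc (2 * j - 1) = 2 * j" "j \<noteq> 0"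
      using that by auto
    then show ?thesis
      by (simp add: laplacian_thetavar_mult tconj_def tsgn_def dtheta_thetavar_mult algebra_simps)
  qed
  have "laplacian m n (R2 m n * f) =
      (\<Sum>i=1..m. laplacian m n (xvar i * (xvar i * f))) -
      (\<Sum>j=1..n. laplacian m n (thetavar (2 * j - 1) * (thetavar (2 * j) * f)))"
    by (simp add: R2_def left_diff_distrib sum_distrib_right power2_eq_square mult.assoc)
  also have "\<dots> = (\<Sum>i=1..m. xvar i * (xvar i * laplacian m n f) + (4 *\<^sub>R (xvar i * dx i f) + 2 *\<^sub>R f)) -
      (\<Sum>j=1..n. thetavar (2 * j - 1) * (thetavar (2 * j) * laplacian m n f) -
      (4 *\<^sub>R (thetavar (2 * j - 1) * dtheta (2 * j - 1) f + thetavar (2 * j) * dtheta (2 * j) f) - 4 *\<^sub>R f))"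
    by (intro arg_cong2[of _ _ _ _ "(-)"] sum.cong refl x th)
  also have "\<dots> = R2 m n * laplacian m n f + 4 *\<^sub>R euler m n f + (2 * (real m - 2 * real n)) *\<^sub>R f"
    unfolding euler_def sum_pairs
    by (simp del: sum_constant add: R2_def left_diff_distrib sum_distrib_right power2_eq_square mult.assoc
        sum.distrib sum_subtractf sum_constant_scaleR scaleR_add_right scaleR_diff_right scaleR_sum_right algebra_simps)
  finally show ?thesis .
qed

lemma laplacian_R2_hspace:
  assumes "f \<in> hspace m n k"
  shows "laplacian m n (R2 m n * f) =
    R2 m n * laplacian m n f + (2 * (2 * real_of_int k + real m - 2 * real n)) *\<^sub>R f"
  by (simp add: laplacian_R2_mult euler_hspace[OF assms] algebra_simps)

lemma R2_power_hspace: "f \<in> hspace m n k \<Longrightarrow> R2 m n ^ s * f \<in> hspace m n (k + 2 * int s)"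
proof (induction s)
  case (Suc s)
  then have "R2 m n * (R2 m n ^ s * f) \<in> hspace m n (k + 2 * int (Suc s))"
    by (intro R2_mult_hspace) (simp add: algebra_simps)
  then show ?case by (simp add: mult.assoc)
qed simp

text \<open>The constants of the sl(2) relation, summed over the powers of R^2. The zeros of the
  resulting product are the source of the exceptional degrees.\<close>

lemma laplacian_R2_power:
  assumes "f \<in> hspace m n k" "laplacian m n f = 0"
  shows "laplacian m n (R2 m n ^ Suc s * f) =
    (2 * real (Suc s) * (2 * real_of_int k + real m - 2 * real n + 2 * real s)) *\<^sub>R (R2 m n ^ s * f)"
proof (induction s)
  case 0
  then show ?case using laplacian_R2_hspace[OF assms(1)] assms(2) by simp
next
  case (Suc s)
  have "laplacian m n (R2 m n ^ Suc (Suc s) * f) = laplacian m n (R2 m n * (R2 m n ^ Suc s * f))"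
    by (simp add: mult.assoc)
  also have "\<dots> = R2 m n * laplacian m n (R2 m n ^ Suc s * f) +
      (2 * (2 * real_of_int (k + 2 * int (Suc s)) + real m - 2 * real n)) *\<^sub>R (R2 m n ^ Suc s * f)"
    by (rule laplacian_R2_hspace[OF R2_power_hspace[OF assms(1)]])
  also have "\<dots> = (2 * real (Suc (Suc s)) * (2 * real_of_int k + real m - 2 * real n + 2 * real (Suc s))) *\<^sub>R
      (R2 m n ^ Suc s * f)"
    unfolding Suc by (simp add: mult.assoc algebra_simps flip: scaleR_add_left)
  finally show ?case .
qed

section \<open>Superderivations\<close>

text \<open>Superderivations of \<open>\<P>(\<real>\<^sup>m\<^sup>|\<^sup>2\<^sup>n)\<close> with arbitrary values elsewhere.\<close>

definition sder :: "nat \<Rightarrow> nat \<Rightarrow> nat \<Rightarrow> (superpoly \<Rightarrow> superpoly) \<Rightarrow> bool" where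
  "sder m n p D \<longleftrightarrow> D \<in> superpolys m n \<rightarrow> superpolys m n \<and> linear_on (superpolys m n) D \<and>
    (\<forall>q. \<forall>f \<in> superpolys m n \<inter> parity_part q. D f \<in> parity_part (p + q)) \<and>
    (\<forall>q. \<forall>f \<in> superpolys m n \<inter> parity_part q. \<forall>g \<in> superpolys m n.
      D (f * g) = D f * g + (-1) ^ (p * q) *\<^sub>R (f * D g))"

lemma minus_one_power_cong: "p mod 2 = q mod 2 \<Longrightarrow> (-1) ^ p = ((-1) ^ q :: real)"
  by (metis even_iff_mod_2_eq_zero minus_one_power_iff)

lemma sderI:
  assumes "\<And>f. f \<in> superpolys m n \<Longrightarrow> D f \<in> superpolys m n"
    and "\<And>f g. f \<in> superpolys m n \<Longrightarrow> g \<in> superpolys m n \<Longrightarrow> D (f + g) = D f + D g"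
    and "\<And>c f. f \<in> superpolys m n \<Longrightarrow> D (c *\<^sub>R f) = c *\<^sub>R D f"
    and "\<And>q f. f \<in> superpolys m n \<Longrightarrow> f \<in> parity_part q \<Longrightarrow> D f \<in> parity_part (p + q)"
    and "\<And>q f g. f \<in> superpolys m n \<Longrightarrow> f \<in> parity_part q \<Longrightarrow> g \<in> superpolys m n \<Longrightarrow>
      D (f * g) = D f * g + (-1) ^ (p * q) *\<^sub>R (f * D g)"
  shows "sder m n p D"
  using assms by (auto simp: sder_def linear_on_def)

text \<open>Parity components and Leibniz signs depend on \<open>q\<close> modulo 2 alone, so the
  conditions for \<open>q\<close> in {0, 1} extend to all \<open>q\<close>. Parities can then be
  added without reduction.\<close>

lemma superderivations_iff:
  "D \<in> superderivations m n p \<longleftrightarrow> D \<in> extensional (superpolys m n) \<and> sder m n p D"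
proof
  assume D: "D \<in> superderivations m n p"
  have par: "\<forall>q\<in>{0, 1}. \<forall>f \<in> superpolys m n \<inter> parity_part q. D f \<in> parity_part (p + q)"
    and leib: "\<forall>q\<in>{0, 1}. \<forall>f \<in> superpolys m n \<inter> parity_part q. \<forall>g \<in> superpolys m n.
      D (f * g) = D f * g + (-1) ^ (p * q) *\<^sub>R (f * D g)"
    using D[unfolded superderivations_def mem_Collect_eq, THEN conjunct2, THEN conjunct2]
    by (rule conjunct1, rule conjunct2)
  have "sder m n p D"
  proof (rule sderI)
    fix q f assume f: "f \<in> superpolys m n" "f \<in> parity_part q"
    then have f': "q mod 2 \<in> {0, 1}" "f \<in> superpolys m n \<inter> parity_part (q mod 2)"
      using parity_part_cong[of q "q mod 2"] by auto
    have "D f \<in> parity_part (p + q mod 2)"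
      by (rule bspec[OF bspec[OF par f'(1)] f'(2)])
    then show "D f \<in> parity_part (p + q)"
      using parity_part_cong[of "p + q mod 2" "p + q"] by (simp add: mod_add_right_eq)
    fix g assume g: "g \<in> superpolys m n"
    have "D (f * g) = D f * g + (-1) ^ (p * (q mod 2)) *\<^sub>R (f * D g)"
      by (rule bspec[OF bspec[OF bspec[OF leib f'(1)] f'(2)] g])
    then show "D (f * g) = D f * g + (-1) ^ (p * q) *\<^sub>R (f * D g)"
      using minus_one_power_cong[of "p * (q mod 2)" "p * q"] by (simp add: mod_mult_right_eq)
  qed (use D in \<open>auto simp: superderivations_def linear_on_def\<close>)
  with D show "D \<in> extensional (superpolys m n) \<and> sder m n p D"
    by (auto simp: superderivations_def PiE_def)
next
  assume "D \<in> extensional (superpolys m n) \<and> sder m n p D"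
  then show "D \<in> superderivations m n p"
    unfolding superderivations_def sder_def PiE_def mem_Collect_eq by (intro conjI ballI) blast+
qed

context
  fixes m n p D
  assumes D: "sder m n p D"
begin

lemma sder_superpolys: "f \<in> superpolys m n \<Longrightarrow> D f \<in> superpolys m n"
  using D by (auto simp: sder_def)

lemma sder_linear_on: "linear_on (superpolys m n) D"
  using D by (auto simp: sder_def)

lemma sder_add: "f \<in> superpolys m n \<Longrightarrow> g \<in> superpolys m n \<Longrightarrow> D (f + g) = D f + D g"
  using D by (auto simp: sder_def linear_on_def)

lemma sder_scaleR: "f \<in> superpolys m n \<Longrightarrow> D (c *\<^sub>R f) = c *\<^sub>R D f"
  using D by (auto simp: sder_def linear_on_def)

lemma sder_zero: "D 0 = 0"
  using sder_scaleR[of 0 0] subspace_0[OF subspace_superpolys] by simp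

lemma sder_diff: "f \<in> superpolys m n \<Longrightarrow> g \<in> superpolys m n \<Longrightarrow> D (f - g) = D f - D g"
  using sder_add[of f "- 1 *\<^sub>R g"] sder_scaleR[of g "- 1"] subspace_scale[OF subspace_superpolys, of g m n "- 1"]
  by simp

lemma sder_sum: "(\<And>s. s \<in> S \<Longrightarrow> h s \<in> superpolys m n) \<Longrightarrow> D (sum h S) = (\<Sum>s\<in>S. D (h s))"
proof (induction S rule: infinite_finite_induct)
  case (insert s S)
  then show ?case
    by (simp add: sder_add subspace_sum[OF subspace_superpolys])
qed (simp_all add: sder_zero)

lemma sder_parity: "f \<in> superpolys m n \<Longrightarrow> f \<in> parity_part q \<Longrightarrow> D f \<in> parity_part (p + q)"
  using D by (auto simp: sder_def)

lemma sder_mult: "f \<in> superpolys m n \<Longrightarrow> f \<in> parity_part q \<Longrightarrow> g \<in> superpolys m n \<Longrightarrow>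
    D (f * g) = D f * g + (-1) ^ (p * q) *\<^sub>R (f * D g)"
  using D by (auto simp: sder_def)

lemma sder_one: "D 1 = 0"
  using sder_mult[OF superpolys_one one_parity superpolys_one] by simp

lemma sder_xvar_mult:
  "i \<in> {1..m} \<Longrightarrow> f \<in> superpolys m n \<Longrightarrow> D (xvar i * f) = D (xvar i) * f + xvar i * D f"
  using sder_mult[OF xvar_in_superpolys xvar_parity] by simp

lemma sder_thetavar_mult:
  "j \<in> {1..2 * n} \<Longrightarrow> f \<in> superpolys m n \<Longrightarrow>
    D (thetavar j * f) = D (thetavar j) * f + (-1) ^ p *\<^sub>R (thetavar j * D f)"
  using sder_mult[OF thetavar_in_superpolys thetavar_parity] by simp

lemma sder_eq_zero:
  assumes "\<And>i. i \<in> {1..m} \<Longrightarrow> D (xvar i) = 0" "\<And>j. j \<in> {1..2 * n} \<Longrightarrow> D (thetavar j) = 0"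
    and "f \<in> superpolys m n"
  shows "D f = 0"
proof -
  \<comment> \<open>Membership is part of the induction claim because \<open>D\<close> is linear on
    this subspace and arbitrary elsewhere.\<close>
  have "f \<in> superpolys m n \<and> D f = 0"
    using assms(3)
  proof (induction rule: superpolys_induct)
    case (add f g)
    then show ?case by (simp add: sder_add subspace_add[OF subspace_superpolys])
  next
    case (scaleR c f)
    then show ?case by (simp add: sder_scaleR subspace_scale[OF subspace_superpolys])
  next
    case (xvar i f)
    then show ?case
      using assms(1) by (simp add: sder_xvar_mult superpolys_mult xvar_in_superpolys)
  next
    case (thetavar j f)
    then show ?case
      using assms(2) by (simp add: sder_thetavar_mult superpolys_mult thetavar_in_superpolys)
  qed (simp_all add: sder_zero sder_one superpolys_one subspace_0[OF subspace_superpolys])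
  then show ?thesis ..
qed

lemma sder_cong: "(\<And>f. f \<in> superpolys m n \<Longrightarrow> E f = D f) \<Longrightarrow> sder m n p E"
  by (intro sderI)
    (simp_all add: sder_superpolys sder_add sder_scaleR sder_parity sder_mult superpolys_mult
      subspace_add[OF subspace_superpolys] subspace_scale[OF subspace_superpolys])

lemma sder_parity_cong: "p mod 2 = q mod 2 \<Longrightarrow> sder m n q D"
proof (rule sderI)
  assume pq: "p mod 2 = q mod 2"
  fix r f assume f: "f \<in> superpolys m n" "f \<in> parity_part r"
  show "D f \<in> parity_part (q + r)"
    using sder_parity[OF f] parity_part_cong[OF mod_add_cong[OF pq refl, of r]] by simp
  fix g assume "g \<in> superpolys m n"
  with sder_mult[OF f this] show "D (f * g) = D f * g + (-1) ^ (q * r) *\<^sub>R (f * D g)"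
    using minus_one_power_cong[OF mod_mult_cong[OF pq refl, of r]] by simp
qed (auto simp: sder_superpolys sder_add sder_scaleR)

lemma sder_restrict: "sder m n p (restrict D (superpolys m n))"
  by (rule sder_cong) simp

lemma sder_scale_map: "sder m n p (\<lambda>f. c *\<^sub>R D f)"
  by (intro sderI)
    (simp_all add: sder_superpolys sder_add sder_scaleR sder_parity sder_mult scaleR_add_right
      subspace_scale[OF subspace_superpolys] subspace_scale[OF subspace_parity_part])

lemma sder_xvar_mult_map: "i \<in> {1..m} \<Longrightarrow> sder m n p (\<lambda>f. xvar i * D f)"
proof (rule sderI)
  fix q f assume i: "i \<in> {1..m}" and f: "f \<in> superpolys m n" "f \<in> parity_part q"
  show "xvar i * D f \<in> parity_part (p + q)"
    using parity_part_mult[OF xvar_parity sder_parity[OF f]] by simp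
  fix g assume "g \<in> superpolys m n"
  then show "xvar i * D (f * g) = xvar i * D f * g + (-1) ^ (p * q) *\<^sub>R (f * (xvar i * D g))"
    by (simp add: sder_mult[OF f] distrib_left mult.assoc xvar_left_commute[of f])
qed (simp_all add: superpolys_mult xvar_in_superpolys sder_superpolys sder_add sder_scaleR distrib_left)

text \<open>Moving theta_j past \<open>f\<close> of parity \<open>q\<close> costs (-1)^q, which
  turns the Leibniz sign of parity \<open>p\<close> into that of parity
  \<open>p + 1\<close>.\<close>

lemma sder_thetavar_mult_map: "j \<in> {1..2 * n} \<Longrightarrow> sder m n (p + 1) (\<lambda>f. thetavar j * D f)"
proof (rule sderI)
  fix q f assume j: "j \<in> {1..2 * n}" and f: "f \<in> superpolys m n" "f \<in> parity_part q"
  show "thetavar j * D f \<in> parity_part (p + 1 + q)"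
    using parity_part_mult[OF thetavar_parity sder_parity[OF f]] by simp
  fix g assume "g \<in> superpolys m n"
  moreover have "thetavar j * (f * D g) = (-1) ^ q *\<^sub>R (f * (thetavar j * D g))"
    using thetavar_mult_commute[OF f(2), of j] by (simp flip: mult.assoc)
  ultimately show "thetavar j * D (f * g) = thetavar j * D f * g + (-1) ^ ((p + 1) * q) *\<^sub>R (f * (thetavar j * D g))"
    by (simp add: sder_mult[OF f] distrib_left mult.assoc power_add mult.commute)
qed (simp_all add: superpolys_mult thetavar_in_superpolys sder_superpolys sder_add sder_scaleR distrib_left)

end

lemma sder_add_map:
  assumes "sder m n p D" "sder m n p E"
  shows "sder m n p (\<lambda>f. D f + E f)"
proof (rule sderI)
  fix q f assume f: "f \<in> superpolys m n" "f \<in> parity_part q"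
  show "D f + E f \<in> parity_part (p + q)"
    using assms[THEN sder_parity] f by (intro subspace_add[OF subspace_parity_part])
  fix g assume "g \<in> superpolys m n"
  then show "D (f * g) + E (f * g) = (D f + E f) * g + (-1) ^ (p * q) *\<^sub>R (f * (D g + E g))"
    using assms[THEN sder_mult, OF f] by (simp add: algebra_simps)
qed (simp_all add: assms[THEN sder_superpolys] assms[THEN sder_add] assms[THEN sder_scaleR] scaleR_add_right
    subspace_add[OF subspace_superpolys])

lemma sder_diff_map:
  assumes "sder m n p D" "sder m n p E"
  shows "sder m n p (\<lambda>f. D f - E f)"
  using sder_add_map[OF assms(1) sder_scale_map[OF assms(2), of "-1"]] by simp

text \<open>The mixed terms \<open>E f * D g\<close> and \<open>D f * E g\<close> occur in both
  compositions, and the sign of the bracket makes them cancel. All signs are decided by the parities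
  of \<open>p\<close>, \<open>q\<close> and \<open>r\<close>.\<close>

lemma sder_bracket:
  assumes D: "sder m n p D" and E: "sder m n q E"
  shows "sder m n (p + q) (\<lambda>f. D (E f) - (-1) ^ (p * q) *\<^sub>R E (D f))"
proof (rule sderI)
  fix r f assume f: "f \<in> superpolys m n" "f \<in> parity_part r"
  have "D (E f) \<in> parity_part (p + (q + r))" "E (D f) \<in> parity_part (q + (p + r))"
    using sder_parity[OF D sder_superpolys[OF E f(1)] sder_parity[OF E f]]
      sder_parity[OF E sder_superpolys[OF D f(1)] sder_parity[OF D f]] .
  then show "D (E f) - (-1) ^ (p * q) *\<^sub>R E (D f) \<in> parity_part (p + q + r)"
    by (intro subspace_diff subspace_scale subspace_parity_part) (simp_all add: ac_simps)
  fix g assume g: "g \<in> superpolys m n"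
  have Df: "D f \<in> superpolys m n" "E f \<in> superpolys m n" "D g \<in> superpolys m n" "E g \<in> superpolys m n"
    using D E f g sder_superpolys by blast+
  have D2: "D (E (f * g)) = D (E f) * g + (-1) ^ (p * (q + r)) *\<^sub>R (E f * D g) +
      (-1) ^ (q * r) *\<^sub>R (D f * E g + (-1) ^ (p * r) *\<^sub>R (f * D (E g)))"
    using Df f g subspace_scale[OF subspace_superpolys]
    by (simp add: sder_mult[OF E f g] sder_add[OF D] sder_scaleR[OF D] superpolys_mult
        sder_mult[OF D Df(2) sder_parity[OF E f] g] sder_mult[OF D f Df(4)])
  have E2: "E (D (f * g)) = E (D f) * g + (-1) ^ (q * (p + r)) *\<^sub>R (D f * E g) +
      (-1) ^ (p * r) *\<^sub>R (E f * D g + (-1) ^ (q * r) *\<^sub>R (f * E (D g)))"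
    using Df f g subspace_scale[OF subspace_superpolys]
    by (simp add: sder_mult[OF D f g] sder_add[OF E] sder_scaleR[OF E] superpolys_mult
        sder_mult[OF E Df(1) sder_parity[OF D f] g] sder_mult[OF E f Df(3)])
  have sq: "(-1) ^ (a * b) *\<^sub>R (-1) ^ (a * b) *\<^sub>R h = h" for a b and h :: superpoly
    by simp
  show "D (E (f * g)) - (-1) ^ (p * q) *\<^sub>R E (D (f * g)) =
      (D (E f) - (-1) ^ (p * q) *\<^sub>R E (D f)) * g +
      (-1) ^ ((p + q) * r) *\<^sub>R (f * (D (E g) - (-1) ^ (p * q) *\<^sub>R E (D g)))"
    unfolding D2 E2
    by (cases "even p"; cases "even q"; cases "even r")
      (simp_all add: minus_one_power_iff algebra_simps)
qed (simp_all add: sder_superpolys[OF D] sder_superpolys[OF E] sder_add[OF D] sder_add[OF E]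
    sder_scaleR[OF D] sder_scaleR[OF E] subspace_diff[OF subspace_superpolys]
    subspace_scale[OF subspace_superpolys] scaleR_add_right scaleR_diff_right)

lemma sder_dx: "sder m n 0 (dx i)"
  by (rule sderI) (simp_all add: dx_superpolys dx_parity dx_mult)

lemma sder_dtheta: "sder m n 1 (dtheta j)"
proof (rule sderI)
  fix q f assume "f \<in> parity_part q"
  then show "dtheta j f \<in> parity_part (1 + q)"
    using dtheta_parity[of f q j] by simp
  then show "dtheta j (f * g) = dtheta j f * g + (-1) ^ (1 * q) *\<^sub>R (f * dtheta j g)" for g
    using dtheta_mult[OF \<open>f \<in> parity_part q\<close>] by simp
qed (simp_all add: dtheta_superpolys)

text \<open>The commutator of \<open>\<Delta>\<close> with a linear form \<open>w\<close> is the derivative dual to \<open>w\<close>.\<close>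

definition sharp :: "nat \<Rightarrow> nat \<Rightarrow> superpoly \<Rightarrow> superpoly \<Rightarrow> superpoly" where
  "sharp m n w f = laplacian m n (w * f) - w * laplacian m n f"

lemma sharp_xvar: "i \<in> {1..m} \<Longrightarrow> sharp m n (xvar i) f = 2 *\<^sub>R dx i f"
  by (simp add: sharp_def laplacian_xvar_mult)

lemma sharp_thetavar:
  "q \<in> {1..2 * n} \<Longrightarrow> sharp m n (thetavar q) f = (4 * tsgn q) *\<^sub>R dtheta (tconj q) f"
  by (simp add: sharp_def laplacian_thetavar_mult)

lemma dx_xvar: "dx i (xvar j) = (if i = j then 1 else 0)"
  using dx_xvar_mult[of i j 1] by (simp add: dx_one)

lemma dx_thetavar: "dx i (thetavar j) = 0"
  using dx_thetavar_mult[of i j 1] by (simp add: dx_one)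

lemma dtheta_xvar: "dtheta i (xvar j) = 0"
  using dtheta_xvar_mult[of i j 1] by (simp add: dtheta_one)

lemma dtheta_thetavar: "dtheta i (thetavar j) = (if i = j then 1 else 0)"
  using dtheta_thetavar_mult[of i j 1] by (simp add: dtheta_one)

definition coords :: "nat \<Rightarrow> nat \<Rightarrow> superpoly set" where
  "coords m n = span (xvar ` {1..m} \<union> thetavar ` {1..2 * n})"

lemma xvar_coords: "i \<in> {1..m} \<Longrightarrow> xvar i \<in> coords m n"
  and thetavar_coords: "j \<in> {1..2 * n} \<Longrightarrow> thetavar j \<in> coords m n"
  unfolding coords_def by (auto intro!: span_base)

lemma coords_hspace: "w \<in> coords m n \<Longrightarrow> w \<in> hspace m n 1"
proof -
  have "coords m n \<subseteq> hspace m n 1"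
    unfolding coords_def
    by (intro span_minimal subspace_hspace) (auto intro!: xvar_in_hspace thetavar_in_hspace)
  then show "w \<in> coords m n \<Longrightarrow> w \<in> hspace m n 1" by blast
qed

lemma R2_thetavar_mult_commute: "thetavar j * R2 m n = R2 m n * thetavar j"
  using thetavar_mult_commute[OF R2_parity] by simp

lemma coords_R2_commute: "w \<in> coords m n \<Longrightarrow> w * R2 m n = R2 m n * w"
  unfolding coords_def
proof (induction rule: span_induct)
  case base
  show ?case
    by (rule subspaceI) (simp_all add: algebra_simps)
next
  case (step w)
  then show ?case
    by (auto simp: R2_thetavar_mult_commute xvar_mult_commute[of "R2 m n"])
qed

text \<open>Linear forms are harmonic and commute with R^2. So Delta(R^2 w) gives 2(2 + M) w and w
  Delta(R^2) gives 2M w; the difference is 4w.\<close>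

lemma sharp_R2: "w \<in> coords m n \<Longrightarrow> sharp m n w (R2 m n) = 4 *\<^sub>R w"
proof -
  assume w: "w \<in> coords m n"
  have "laplacian m n w = 0"
    using laplacian_hspace[OF coords_hspace[OF w]] by (rule hspace_neg) simp
  moreover have "w * laplacian m n (R2 m n) = (2 * (real m - 2 * real n)) *\<^sub>R w"
    using laplacian_R2_hspace[OF one_in_hspace, of m n] by (simp add: laplacian_one)
  ultimately show ?thesis
    unfolding sharp_def coords_R2_commute[OF w] laplacian_R2_hspace[OF coords_hspace[OF w]]
    by (simp add: algebra_simps)
qed

lemma sharp_add: "sharp m n (v + w) = (\<lambda>f. sharp m n v f + sharp m n w f)"
  and sharp_scaleR: "sharp m n (c *\<^sub>R w) = (\<lambda>f. c *\<^sub>R sharp m n w f)"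
  and sharp_zero: "sharp m n 0 = (\<lambda>f. 0)"
  by (simp_all add: sharp_def fun_eq_iff algebra_simps)

lemma sder_zero_map: "sder m n p (\<lambda>f. 0)"
  by (rule sderI)
    (simp_all add: subspace_0[OF subspace_superpolys] subspace_0[OF subspace_parity_part])

text \<open>A linear form is u + v with u in the span of the x_i and v in that of the theta_j.
  Homogeneity of \<open>w\<close> kills one of the two, and the dual of the other is a combination
  of partial derivatives of one parity.\<close>

lemma sder_sharp:
  assumes "w \<in> coords m n" "w \<in> parity_part r"
  shows "sder m n r (sharp m n w)"
proof -
  have sub: "subspace {w. w \<in> parity_part q \<and> sder m n q (sharp m n w)}" for q
    by (rule subspaceI)
      (simp_all add: sharp_add sharp_scaleR sharp_zero sder_zero_map sder_add_map sder_scale_map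
        subspace_0[OF subspace_parity_part] subspace_add[OF subspace_parity_part]
        subspace_scale[OF subspace_parity_part])
  have x: "xvar ` {1..m} \<subseteq> {w. w \<in> parity_part 0 \<and> sder m n 0 (sharp m n w)}"
  proof safe
    fix i assume "i \<in> {1..m}"
    then have "sharp m n (xvar i) = (\<lambda>f. 2 *\<^sub>R dx i f)"
      by (intro ext sharp_xvar)
    then show "sder m n 0 (sharp m n (xvar i))"
      using sder_scale_map[OF sder_dx, of m n 2 i] by simp
  qed (rule xvar_parity)
  have th: "thetavar ` {1..2 * n} \<subseteq> {w. w \<in> parity_part 1 \<and> sder m n 1 (sharp m n w)}"
  proof safe
    fix q assume "q \<in> {1..2 * n}"
    then have "sharp m n (thetavar q) = (\<lambda>f. (4 * tsgn q) *\<^sub>R dtheta (tconj q) f)"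
      by (intro ext sharp_thetavar)
    then show "sder m n 1 (sharp m n (thetavar q))"
      using sder_scale_map[OF sder_dtheta, of m n "4 * tsgn q" "tconj q"] by simp
  qed (rule thetavar_parity)
  obtain u v where w: "w = u + v" "u \<in> span (xvar ` {1..m})" "v \<in> span (thetavar ` {1..2 * n})"
    using assms(1) unfolding coords_def span_Un by auto
  have uv: "u \<in> parity_part 0" "sder m n 0 (sharp m n u)" "v \<in> parity_part 1" "sder m n 1 (sharp m n v)"
    using span_minimal[OF x sub] span_minimal[OF th sub] w(2,3) by auto
  show ?thesis
  proof (cases "even r")
    case True
    then have "w \<in> parity_part 0"
      using assms(2) parity_part_cong[of r 0] by (simp add: even_iff_mod_2_eq_zero)
    then have "v \<in> parity_part 0"
      using subspace_diff[OF subspace_parity_part, of w 0 u] uv(1) w(1) by simp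
    then have "v = 0"
      using parity_part_disjoint[OF _ uv(3), of 0] by simp
    with w(1) uv(2) True show ?thesis
      by (auto intro: sder_parity_cong)
  next
    case False
    then have "w \<in> parity_part 1"
      using assms(2) parity_part_cong[of r 1] by (simp add: odd_iff_mod_2_eq_one)
    then have "u \<in> parity_part 1"
      using subspace_diff[OF subspace_parity_part, of w 1 v] uv(3) w(1) by simp
    then have "u = 0"
      using parity_part_disjoint[OF uv(1), of 1] by simp
    with w(1) uv(4) False show ?thesis
      by (auto intro: sder_parity_cong simp: odd_iff_mod_2_eq_one)
  qed
qed

text \<open>
  A superderivation with constant values on the coordinates maps \<open>R\<^sup>2\<close> to a linear form
  that determines these values, because the form \<open>R\<^sup>2\<close> is nondegenerate.
\<close>

lemma constant_sder_eq_zero: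
  assumes C: "sder m n p C" and "C (R2 m n) = 0"
    and const: "\<And>w. w \<in> coords m n \<Longrightarrow> C w \<in> hspace m n 0"
    and f: "f \<in> superpolys m n"
  shows "C f = 0"
proof -
  have "\<exists>c. C (xvar i) = c *\<^sub>R 1" if "i \<in> {1..m}" for i
    using const[OF xvar_coords[OF that]] hspace_zero_const by metis
  then obtain c where c: "\<And>i. i \<in> {1..m} \<Longrightarrow> C (xvar i) = c i *\<^sub>R 1" by metis
  have "\<exists>c. C (thetavar j) = c *\<^sub>R 1" if "j \<in> {1..2 * n}" for j
    using const[OF thetavar_coords[OF that]] hspace_zero_const by metis
  then obtain d where d: "\<And>j. j \<in> {1..2 * n} \<Longrightarrow> C (thetavar j) = d j *\<^sub>R 1" by metis
  have x: "C (xvar i * xvar i) = (2 * c i) *\<^sub>R xvar i" if "i \<in> {1..m}" for i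
    using sder_xvar_mult[OF C that xvar_in_superpolys[OF that]] c[OF that]
    by (simp flip: scaleR_add_left)
  have th: "C (thetavar (2 * j - 1) * thetavar (2 * j)) =
      d (2 * j - 1) *\<^sub>R thetavar (2 * j) + ((-1) ^ p * d (2 * j)) *\<^sub>R thetavar (2 * j - 1)"
    if "j \<in> {1..n}" for j
  proof -
    have "2 * j - 1 \<in> {1..2 * n}" "2 * j \<in> {1..2 * n}" using that by auto
    then show ?thesis
      using sder_thetavar_mult[OF C _ thetavar_in_superpolys] d by simp
  qed
  have "C (R2 m n) = (\<Sum>i=1..m. C (xvar i * xvar i)) - (\<Sum>j=1..n. C (thetavar (2 * j - 1) * thetavar (2 * j)))"
    unfolding R2_def power2_eq_square
    by (subst sder_diff[OF C] sder_sum[OF C];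
        (intro subspace_sum subspace_superpolys superpolys_mult xvar_in_superpolys thetavar_in_superpolys; auto)?)+
      auto
  also have "\<dots> = (\<Sum>i=1..m. (2 * c i) *\<^sub>R xvar i) - (\<Sum>j=1..n.
      d (2 * j - 1) *\<^sub>R thetavar (2 * j) + ((-1) ^ p * d (2 * j)) *\<^sub>R thetavar (2 * j - 1))"
    by (intro arg_cong2[of _ _ _ _ "(-)"] sum.cong refl x th)
  finally have eq: "(\<Sum>i=1..m. (2 * c i) *\<^sub>R xvar i) - (\<Sum>j=1..n.
      d (2 * j - 1) *\<^sub>R thetavar (2 * j) + ((-1) ^ p * d (2 * j)) *\<^sub>R thetavar (2 * j - 1)) = 0"
    using assms(2) by simp
  \<comment> \<open>A partial derivative of the vanishing linear form reads off a single
    coefficient.\<close>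
  have "c i = 0" if "i \<in> {1..m}" for i
    using arg_cong[OF eq, of "dx i"] that
    by (simp add: dx_xvar dx_thetavar if_distrib[of "\<lambda>f. _ *\<^sub>R f"] cong: if_cong)
  moreover have "d (2 * j) = 0 \<and> d (2 * j - 1) = 0" if j: "j \<in> {1..n}" for j
  proof -
    have 1: "2 * i - 1 = 2 * j - 1 \<longleftrightarrow> i = j" "2 * j - 1 \<noteq> 2 * i" "2 * i \<noteq> 2 * j - 1" if "i \<in> {1..n}" for i
      using that j by auto presburger+
    have "dtheta (2 * j) (\<Sum>j=1..n. d (2 * j - 1) *\<^sub>R thetavar (2 * j) + ((-1) ^ p * d (2 * j)) *\<^sub>R thetavar (2 * j - 1)) =
        (\<Sum>i=1..n. if i = j then d (2 * j - 1) *\<^sub>R 1 else 0)"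
      unfolding dtheta_simps by (rule sum.cong) (use 1 in \<open>auto simp: dtheta_thetavar\<close>)
    moreover have "dtheta (2 * j - 1) (\<Sum>j=1..n. d (2 * j - 1) *\<^sub>R thetavar (2 * j) + ((-1) ^ p * d (2 * j)) *\<^sub>R thetavar (2 * j - 1)) =
        (\<Sum>i=1..n. if i = j then ((-1) ^ p * d (2 * j)) *\<^sub>R 1 else 0)"
      unfolding dtheta_simps by (rule sum.cong) (use 1 in \<open>auto simp: dtheta_thetavar\<close>)
    ultimately show ?thesis
      using arg_cong[OF eq, of "dtheta (2 * j)"] arg_cong[OF eq, of "dtheta (2 * j - 1)"] j
      by (simp add: dtheta_xvar)
  qed
  then have "d q = 0" if "q \<in> {1..2 * n}" for q
  proof (cases "even q")
    case True
    with that \<open>\<And>j. j \<in> {1..n} \<Longrightarrow> d (2 * j) = 0 \<and> d (2 * j - 1) = 0\<close> [of "q div 2"] show ?thesis by auto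
  next
    case False
    then have "q = 2 * ((q + 1) div 2) - 1" "(q + 1) div 2 \<in> {1..n}"
      using that unfolding atLeastAtMost_iff by presburger+
    with \<open>\<And>j. j \<in> {1..n} \<Longrightarrow> d (2 * j) = 0 \<and> d (2 * j - 1) = 0\<close> show ?thesis by metis
  qed
  ultimately show ?thesis
    using sder_eq_zero[OF C _ _ f] c d by simp
qed

section \<open>Invariance of degree, R^2 and the Laplacian under osp(m|2n)\<close>

context
  fixes m n p D
  assumes D: "D \<in> osp m n p"
begin

lemma osp_sder: "sder m n p D"
  using D by (auto simp: osp_def superderivations_iff)

lemma osp_coords: "w \<in> coords m n \<Longrightarrow> D w \<in> coords m n"
  using D by (auto simp: osp_def coords_def)

lemma osp_R2: "D (R2 m n) = 0"
  using D by (auto simp: osp_def)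

lemma osp_R2_mult: "f \<in> superpolys m n \<Longrightarrow> D (R2 m n * f) = R2 m n * D f"
  using sder_mult[OF osp_sder R2_superpolys R2_parity] osp_R2 by simp

lemma osp_hspace: "f \<in> hspace m n k \<Longrightarrow> D f \<in> hspace m n k"
proof -
  have *: "f \<in> hspace m n (int k) \<and> D f \<in> hspace m n (int k)" if "f \<in> hspace m n (int k)" for k
    using that
  proof (induction rule: hspace_induct)
    case (zero k)
    then show ?case using sder_zero[OF osp_sder] subspace_0[OF subspace_hspace] by simp
  next
    case (add k f g)
    then show ?case
      using sder_add[OF osp_sder] subspace_add[OF subspace_hspace] by (simp add: hspace_superpolys[of _ m n "int k"])
  next
    case (scaleR k c f)
    then show ?case
      using sder_scaleR[OF osp_sder] subspace_scale[OF subspace_hspace] by (simp add: hspace_superpolys[of _ m n "int k"])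
  next
    case one
    then show ?case using sder_one[OF osp_sder] one_in_hspace subspace_0[OF subspace_hspace] by simp
  next
    case (xvar i k f)
    then have "xvar i * f \<in> hspace m n (1 + int k)" "D (xvar i) * f \<in> hspace m n (1 + int k)"
        "xvar i * D f \<in> hspace m n (1 + int k)"
      by (auto intro!: hspace_mult xvar_in_hspace coords_hspace osp_coords xvar_coords)
    then show ?case
      using sder_xvar_mult[OF osp_sder xvar(1)] xvar(2) subspace_add[OF subspace_hspace]
      by (simp add: hspace_superpolys[of _ m n "int k"])
  next
    case (thetavar j k f)
    then have "thetavar j * f \<in> hspace m n (1 + int k)" "D (thetavar j) * f \<in> hspace m n (1 + int k)"
        "thetavar j * D f \<in> hspace m n (1 + int k)"
      by (auto intro!: hspace_mult thetavar_in_hspace coords_hspace osp_coords thetavar_coords)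
    then show ?case
      using sder_thetavar_mult[OF osp_sder thetavar(1)] thetavar(2)
        subspace_add[OF subspace_hspace] subspace_scale[OF subspace_hspace]
      by (simp add: hspace_superpolys[of _ m n "int k"])
  qed
  assume f: "f \<in> hspace m n k"
  show ?thesis
  proof (cases "k < 0")
    case True
    then show ?thesis
      using hspace_neg[OF f] sder_zero[OF osp_sder] f by simp
  next
    case False
    then show ?thesis using *[of "nat k"] f by simp
  qed
qed

text \<open>The bracket of \<open>D\<close> with the dual of \<open>y\<close> and the dual of
  \<open>D y\<close> both have constant values on coordinates. Both send R^2 to 4 D y, so their
  difference \<open>C\<close> vanishes by nondegeneracy.\<close>

lemma osp_sharp:
  assumes y: "y \<in> coords m n" "y \<in> parity_part q" and f: "f \<in> superpolys m n"
  shows "D (sharp m n y f) = (-1) ^ (p * q) *\<^sub>R sharp m n y (D f) + sharp m n (D y) f"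
proof -
  have Dy: "D y \<in> coords m n" "D y \<in> parity_part (p + q)"
    using osp_coords[OF y(1)] sder_parity[OF osp_sder hspace_superpolys[OF coords_hspace[OF y(1)]] y(2)] by auto
  define C where "C f = D (sharp m n y f) - (-1) ^ (p * q) *\<^sub>R sharp m n y (D f) - sharp m n (D y) f" for f
  have C: "sder m n (p + q) C"
    unfolding C_def by (rule sder_diff_map[OF sder_bracket[OF osp_sder sder_sharp[OF y]] sder_sharp[OF Dy]])
  have sharp0: "sharp m n v w \<in> hspace m n 0" if "v \<in> coords m n" "w \<in> coords m n" for v w
  proof -
    have "laplacian m n (v * w) \<in> hspace m n 0"
      using laplacian_hspace[OF hspace_mult[OF that[THEN coords_hspace]]] by simp
    moreover have "laplacian m n w = 0"
      using laplacian_hspace[OF coords_hspace[OF that(2)]] by (rule hspace_neg) simp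
    ultimately show ?thesis by (simp add: sharp_def)
  qed
  have "C (R2 m n) = 0"
    using y Dy by (simp add: C_def osp_R2 sharp_R2 sder_scaleR[OF osp_sder hspace_superpolys[OF coords_hspace]]
        sder_zero[OF sder_sharp[OF y]])
  moreover have "C w \<in> hspace m n 0" if "w \<in> coords m n" for w
    unfolding C_def using that y Dy
    by (intro subspace_diff subspace_scale subspace_hspace osp_hspace sharp0 osp_coords)
  ultimately have "C f = 0"
    by (rule constant_sder_eq_zero[OF C _ _ f])
  then show ?thesis by (simp add: C_def algebra_simps)
qed

text \<open>The definition of \<open>osp\<close> demands annihilation of R^2, and invariance of
  Delta has to be derived from it. Since Delta(w f) = w Delta f + \<open>sharp m n w f\<close>,
  induction over products with coordinates reduces it to the equivariance of
  \<open>sharp\<close>.\<close>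

lemma osp_laplacian: 
  assumes "f \<in> superpolys m n" shows "D (laplacian m n f) = laplacian m n (D f)"
proof -
  have "f \<in> superpolys m n \<and> D (laplacian m n f) = laplacian m n (D f)"
    using assms
  proof (induction rule: superpolys_induct)
    case zero
    show ?case by (simp add: sder_zero[OF osp_sder] subspace_0[OF subspace_superpolys])
  next
    case (add f g)
    then show ?case
      by (simp add: sder_add[OF osp_sder] laplacian_superpolys subspace_add[OF subspace_superpolys])
  next
    case (scaleR c f)
    then show ?case
      by (simp add: sder_scaleR[OF osp_sder] laplacian_superpolys subspace_scale[OF subspace_superpolys])
  next
    case one
    then show ?case by (simp add: laplacian_one sder_one[OF osp_sder] sder_zero[OF osp_sder] superpolys_one)
  next
    case (xvar i f)
    have lap: "laplacian m n (w * g) = w * laplacian m n g + sharp m n w g" for w g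
      by (simp add: sharp_def)
    have "D (laplacian m n (xvar i * f)) = D (xvar i * laplacian m n f) + D (sharp m n (xvar i) f)"
      unfolding lap using xvar
      by (intro sder_add[OF osp_sder] superpolys_mult xvar_in_superpolys laplacian_superpolys
          sder_superpolys[OF sder_sharp[OF xvar_coords xvar_parity]])
    also have "\<dots> = laplacian m n (D (xvar i * f))"
      using xvar osp_sharp[OF xvar_coords[OF xvar(1)] xvar_parity xvar(2)]
      by (simp add: sder_xvar_mult[OF osp_sder] laplacian_superpolys lap)
    finally show ?case using xvar by (simp add: superpolys_mult xvar_in_superpolys)
  next
    case (thetavar j f)
    have lap: "laplacian m n (w * g) = w * laplacian m n g + sharp m n w g" for w g
      by (simp add: sharp_def)
    have "D (laplacian m n (thetavar j * f)) = D (thetavar j * laplacian m n f) + D (sharp m n (thetavar j) f)"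
      unfolding lap using thetavar
      by (intro sder_add[OF osp_sder] superpolys_mult thetavar_in_superpolys laplacian_superpolys
          sder_superpolys[OF sder_sharp[OF thetavar_coords thetavar_parity]])
    also have "\<dots> = laplacian m n (D (thetavar j * f))"
      using thetavar osp_sharp[OF thetavar_coords[OF thetavar(1)] thetavar_parity thetavar(2)]
      by (simp add: sder_thetavar_mult[OF osp_sder] laplacian_superpolys lap algebra_simps)
    finally show ?case using thetavar by (simp add: superpolys_mult thetavar_in_superpolys)
  qed
  then show ?thesis ..
qed

end

lemma ospI:
  assumes "D \<in> extensional (superpolys m n)" "sder m n p D"
    and "\<And>i. i \<in> {1..m} \<Longrightarrow> D (xvar i) \<in> coords m n"
    and "\<And>j. j \<in> {1..2 * n} \<Longrightarrow> D (thetavar j) \<in> coords m n"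
    and "D (R2 m n) = 0"
  shows "D \<in> osp m n p"
proof -
  have "w \<in> superpolys m n \<and> D w \<in> coords m n" if "w \<in> coords m n" for w
    using that unfolding coords_def[of m n]
  proof (induction rule: span_induct)
    case base
    show ?case
      using subspace_span by (intro subspaceI)
       (auto simp: sder_zero[OF assms(2)] sder_add[OF assms(2)] sder_scaleR[OF assms(2)]
        subspace_0[OF subspace_superpolys] subspace_add[OF subspace_superpolys]
        subspace_scale[OF subspace_superpolys] span_zero intro: span_add span_scale)
  next
    case (step w)
    then show ?case
      using assms(3,4) by (auto simp: coords_def intro!: xvar_in_superpolys thetavar_in_superpolys)
  qed
  with assms show ?thesis
    by (auto simp: osp_def superderivations_iff coords_def)
qed

section \<open>The Fischer decomposition\<close>

definition radial_const :: "nat \<Rightarrow> nat \<Rightarrow> nat \<Rightarrow> int \<Rightarrow> int" where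
  "radial_const m n s k = 2 * int s * (2 * k + int m - 2 * int n + 2 * int s - 2)"

text \<open>
  The operators \<open>R\<^sup>2 \<Delta> + radial_const m n s k\<close> on \<open>\<P>\<^sub>k\<close> arise when \<open>\<Delta>\<close> is applied to
  \<open>R\<^sup>2\<^sup>s f\<close>. Since \<open>\<Delta>\<close> intertwines the operator for \<open>(s, k)\<close> with that for \<open>(s + 1, k - 2)\<close>,
  invertibility follows by induction from the nonvanishing of the constants.
\<close>

lemma radial_step:
  assumes "y \<in> hspace m n k"
  shows "laplacian m n (R2 m n * laplacian m n y + radial_const m n s k *\<^sub>R y) =
    R2 m n * laplacian m n (laplacian m n y) + radial_const m n (Suc s) (k - 2) *\<^sub>R laplacian m n y"
  by (simp only: laplacian_simps laplacian_R2_hspace[OF laplacian_hspace[OF assms, of m n]] add.assoc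
      flip: scaleR_add_left)
    (simp add: radial_const_def algebra_simps)

text \<open>Passing from (s, k) to (s + 1, k - 2) lowers the last factor of the constant by 2. The
  condition on \<open>j\<close> therefore excludes all the zeros that the descent can meet.\<close>

lemma radial_inj:
  assumes "y \<in> hspace m n k" "s \<ge> 1"
    and "R2 m n * laplacian m n y + radial_const m n s k *\<^sub>R y = 0"
    and "\<And>j::nat. 2 * int j \<le> k \<Longrightarrow> 2 * k + int m - 2 * int n + 2 * int s - 2 \<noteq> 2 * int j"
  shows "y = 0"
  using assms
\<comment> \<open>The shift by 2 lets the measure decrease in the step from k = 0 to k = -2 as
  well.\<close>
proof (induction "nat (k + 2)" arbitrary: k s y rule: less_induct)
  case less
  show ?case
  proof (cases "k < 0")
    case True
    with less.prems(1) show ?thesis by (rule hspace_neg)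
  next
    case False
    have "laplacian m n y = 0"
    proof (rule less.hyps[of "k - 2" _ "Suc s"])
      show "R2 m n * laplacian m n (laplacian m n y) +
          radial_const m n (Suc s) (k - 2) *\<^sub>R laplacian m n y = 0"
        using radial_step[OF less.prems(1), of s] less.prems(3) by simp
      fix j :: nat assume "2 * int j \<le> k - 2"
      then show "2 * (k - 2) + int m - 2 * int n + 2 * int (Suc s) - 2 \<noteq> 2 * int j"
        using less.prems(4)[of "Suc j"] by simp
    qed (use False laplacian_hspace[OF less.prems(1)] in auto)
    with less.prems(3) have "radial_const m n s k *\<^sub>R y = 0" by simp
    moreover have "radial_const m n s k \<noteq> 0"
      using less.prems(4)[of 0] less.prems(2) False by (simp add: radial_const_def)
    ultimately show ?thesis by simp
  qed
qed

text \<open>Applying Delta gives an equation of the same type for z = Delta y, with (s + 1, k - 2)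
  and right-hand side Delta g. A solution z leaves only the choice y = (g - R^2 z)/c, and the
  equation for z ensures that Delta y is indeed z.\<close>

lemma radial_surj:
  assumes "g \<in> hspace m n k" "s \<ge> 1"
    and "\<And>j::nat. 2 * int j \<le> k \<Longrightarrow> 2 * k + int m - 2 * int n + 2 * int s - 2 \<noteq> 2 * int j"
  shows "\<exists>y \<in> hspace m n k. R2 m n * laplacian m n y + radial_const m n s k *\<^sub>R y = g"
  using assms
proof (induction "nat (k + 2)" arbitrary: k s g rule: less_induct)
  case less
  show ?case
  proof (cases "k < 0")
    case True
    then have "g = 0" using hspace_neg[OF less.prems(1)] by simp
    then show ?thesis
      using subspace_0[OF subspace_hspace] by (intro bexI[of _ 0]) simp_all
  next
    case False
    have "\<exists>z \<in> hspace m n (k - 2). R2 m n * laplacian m n z + radial_const m n (Suc s) (k - 2) *\<^sub>R z = laplacian m n g"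
    proof (rule less.hyps)
      fix j :: nat assume "2 * int j \<le> k - 2"
      then show "2 * (k - 2) + int m - 2 * int n + 2 * int (Suc s) - 2 \<noteq> 2 * int j"
        using less.prems(3)[of "Suc j"] by simp
    qed (use False laplacian_hspace[OF less.prems(1)] in auto)
    then obtain z where z: "z \<in> hspace m n (k - 2)"
        "R2 m n * laplacian m n z + radial_const m n (Suc s) (k - 2) *\<^sub>R z = laplacian m n g"
      by blast
    define c where "c = real_of_int (radial_const m n s k)"
    have "c \<noteq> 0"
      using less.prems(3)[of 0] less.prems(2) False by (simp add: c_def radial_const_def)
    define y where "y = (1 / c) *\<^sub>R (g - R2 m n * z)"
    have "laplacian m n (R2 m n * z) = laplacian m n g - c *\<^sub>R z"
      unfolding laplacian_R2_hspace[OF z(1)] z(2)[symmetric]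
      by (simp add: c_def radial_const_def algebra_simps flip: scaleR_add_left)
    then have "laplacian m n y = z"
      using \<open>c \<noteq> 0\<close> by (simp add: y_def)
    then have "R2 m n * laplacian m n y + c *\<^sub>R y = g"
      using \<open>c \<noteq> 0\<close> by (simp add: y_def)
    moreover have "y \<in> hspace m n k"
      unfolding y_def using z(1) less.prems(1)
      by (intro subspace_scale subspace_diff subspace_hspace R2_mult_hspace)
    ultimately show ?thesis by (auto simp: c_def)
  qed
qed

text \<open>Harmonicity of R^2 y is the radial equation with s = 1. For odd \<open>m\<close> the
  last factor of its constants is odd, hence never one of the even numbers 2j.\<close>

lemma fischer_unique:
  assumes "odd m" "y \<in> hspace m n k" "laplacian m n (R2 m n * y) = 0"
  shows "y = 0"
proof (rule radial_inj[OF assms(2), of 1])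
  show "R2 m n * laplacian m n y + radial_const m n 1 k *\<^sub>R y = 0"
    using assms(3) laplacian_R2_hspace[OF assms(2)] by (simp add: radial_const_def)
  show "2 * k + int m - 2 * int n + 2 * int 1 - 2 \<noteq> 2 * int j" for j
    using assms(1) by presburger
qed simp

text \<open>The component y solves Delta(R^2 y) = Delta f, which is again the radial equation with s
  = 1, now in degree k - 2.\<close>

lemma fischer_exists:
  assumes "odd m" "f \<in> hspace m n k"
  obtains h y where "h \<in> hspace m n k" "laplacian m n h = 0" "y \<in> hspace m n (k - 2)" "f = h + R2 m n * y"
proof -
  have "\<exists>y \<in> hspace m n (k - 2). R2 m n * laplacian m n y + radial_const m n 1 (k - 2) *\<^sub>R y = laplacian m n f"
  proof (rule radial_surj)
    show "2 * (k - 2) + int m - 2 * int n + 2 * int 1 - 2 \<noteq> 2 * int j" for j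
      using assms(1) by presburger
  qed (use assms laplacian_hspace in auto)
  then obtain y where y: "y \<in> hspace m n (k - 2)"
      "R2 m n * laplacian m n y + radial_const m n 1 (k - 2) *\<^sub>R y = laplacian m n f"
    by blast
  have "laplacian m n (R2 m n * y) = laplacian m n f"
    unfolding laplacian_R2_hspace[OF y(1)] y(2)[symmetric] by (simp add: radial_const_def)
  with that[of "f - R2 m n * y" y] y(1) assms(2) R2_mult_hspace[OF y(1)] show ?thesis
    by (simp add: subspace_diff[OF subspace_hspace])
qed

section \<open>Expansion in powers of one even variable\<close>

text \<open>\<open>tcoeff i j f\<close> is the coefficient of \<open>x\<^sub>i\<^sup>j\<close> in \<open>f\<close>, a polynomial in the other variables.\<close>

lift_definition tcoeff ::
    "nat \<Rightarrow> nat \<Rightarrow> ((nat \<Rightarrow>\<^sub>0 nat) \<Rightarrow>\<^sub>0 'b) \<Rightarrow> ((nat \<Rightarrow>\<^sub>0 nat) \<Rightarrow>\<^sub>0 'b::zero)"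
  is "\<lambda>i j f \<alpha>. if Poly_Mapping.lookup \<alpha> i = 0 then f (\<alpha> + Poly_Mapping.single i j) else 0"
proof -
  fix i j and f :: "(nat \<Rightarrow>\<^sub>0 nat) \<Rightarrow> 'b"
  assume "finite {\<alpha>. f \<alpha> \<noteq> 0}"
  then have "finite ((\<lambda>\<alpha>. \<alpha> + Poly_Mapping.single i j) -` {\<alpha>. f \<alpha> \<noteq> 0})"
    by (rule finite_vimageI) (simp add: inj_def)
  then show "finite {\<alpha>. (if Poly_Mapping.lookup \<alpha> i = 0 then f (\<alpha> + Poly_Mapping.single i j) else 0) \<noteq> 0}"
    by (rule rev_finite_subset) auto
qed

lemma scoeff_tcoeff:
  "scoeff (tcoeff i j f) \<alpha> A =
    (if Poly_Mapping.lookup \<alpha> i = 0 then scoeff f (\<alpha> + Poly_Mapping.single i j) A else 0)"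
  by (simp add: scoeff_def tcoeff.rep_eq)

lemma tcoeff_ext:
  fixes f g :: superpoly
  assumes "\<And>j. tcoeff i j f = tcoeff i j g" shows "f = g"
proof (rule superpoly_eqI)
  fix \<beta> :: "nat \<Rightarrow>\<^sub>0 nat" and A :: "nat set"
  define j where "j = Poly_Mapping.lookup \<beta> i"
  define \<alpha> where "\<alpha> = \<beta> - Poly_Mapping.single i j"
  have "\<alpha> + Poly_Mapping.single i j = \<beta>" "Poly_Mapping.lookup \<alpha> i = 0"
    by (auto intro!: poly_mapping_eqI simp: \<alpha>_def j_def lookup_add lookup_minus lookup_single when_def)
  then show "scoeff f \<beta> A = scoeff g \<beta> A"
    using arg_cong[OF assms[of j], of "\<lambda>h. scoeff h \<alpha> A"] by (simp add: scoeff_tcoeff)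
qed

lemma linear_tcoeff: "linear (tcoeff i j :: superpoly \<Rightarrow> superpoly)"
  by (rule linearI; rule superpoly_eqI) (simp_all add: scoeff_tcoeff)

lemma tcoeff_simps [simp]:
  fixes f g :: superpoly and h :: "'a \<Rightarrow> superpoly"
  shows "tcoeff i j (0 :: superpoly) = 0" "tcoeff i j (f + g) = tcoeff i j f + tcoeff i j g"
  "tcoeff i j (f - g) = tcoeff i j f - tcoeff i j g" "tcoeff i j (- f) = - tcoeff i j f"
  "tcoeff i j (c *\<^sub>R f) = c *\<^sub>R tcoeff i j f" "tcoeff i j (sum h S) = (\<Sum>s\<in>S. tcoeff i j (h s))"
  using linear_tcoeff[of i j]
  by (simp_all add: linear_0 linear_add linear_diff linear_neg linear_scale linear_sum)

lemma tcoeff_xvar_mult_same: "tcoeff i j (xvar i * f) = (if j = 0 then 0 else tcoeff i (j - 1) f)"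
proof (rule superpoly_eqI)
  fix \<alpha> and A :: "nat set"
  have "\<alpha> + Poly_Mapping.single i j - Poly_Mapping.single i 1 = \<alpha> + Poly_Mapping.single i (j - 1)" if "j \<noteq> 0"
    using that by (intro poly_mapping_eqI) (auto simp: lookup_add lookup_minus lookup_single when_def)
  then show "scoeff (tcoeff i j (xvar i * f)) \<alpha> A = scoeff (if j = 0 then 0 else tcoeff i (j - 1) f) \<alpha> A"
    by (auto simp: scoeff_tcoeff scoeff_xvar_mult lookup_add)
qed

lemma tcoeff_xvar_mult: "k \<noteq> i \<Longrightarrow> tcoeff i j (xvar k * f) = xvar k * tcoeff i j f"
proof (rule superpoly_eqI)
  fix \<alpha> and A :: "nat set"
  assume "k \<noteq> i"
  then have "\<alpha> + Poly_Mapping.single i j - Poly_Mapping.single k 1 = \<alpha> - Poly_Mapping.single k 1 + Poly_Mapping.single i j"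
    by (intro poly_mapping_eqI) (auto simp: lookup_add lookup_minus lookup_single when_def)
  with \<open>k \<noteq> i\<close> show "scoeff (tcoeff i j (xvar k * f)) \<alpha> A = scoeff (xvar k * tcoeff i j f) \<alpha> A"
    by (auto simp: scoeff_tcoeff scoeff_xvar_mult lookup_add lookup_minus lookup_single when_def)
qed

lemma tcoeff_thetavar_mult: "tcoeff i j (thetavar k * f) = thetavar k * tcoeff i j f"
  by (rule superpoly_eqI) (simp add: scoeff_tcoeff scoeff_thetavar_mult)

lemma tcoeff_dtheta: "tcoeff i j (dtheta k f) = dtheta k (tcoeff i j f)"
  by (rule superpoly_eqI) (simp add: scoeff_tcoeff scoeff_dtheta)

lemma tcoeff_dx_same: "tcoeff i j (dx i (f :: superpoly)) = real (Suc j) *\<^sub>R tcoeff i (Suc j) f"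
proof (rule superpoly_eqI)
  fix \<alpha> and A :: "nat set"
  have "\<alpha> + Poly_Mapping.single i j + Poly_Mapping.single i 1 = \<alpha> + Poly_Mapping.single i (Suc j)"
    by (intro poly_mapping_eqI) (auto simp: lookup_add lookup_single when_def)
  then show "scoeff (tcoeff i j (dx i f)) \<alpha> A = scoeff (real (Suc j) *\<^sub>R tcoeff i (Suc j) f) \<alpha> A"
    by (simp add: scoeff_tcoeff scoeff_dx lookup_add)
qed

lemma tcoeff_dx: "k \<noteq> i \<Longrightarrow> tcoeff i j (dx k (f :: superpoly)) = dx k (tcoeff i j f)"
proof (rule superpoly_eqI)
  fix \<alpha> and A :: "nat set"
  assume "k \<noteq> i"
  then show "scoeff (tcoeff i j (dx k f)) \<alpha> A = scoeff (dx k (tcoeff i j f)) \<alpha> A"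
    by (simp add: scoeff_tcoeff scoeff_dx lookup_add lookup_single ac_simps)
qed

lemma tcoeff_one: "tcoeff i j 1 = (if j = 0 then 1 else 0 :: superpoly)"
proof (rule superpoly_eqI)
  fix \<alpha> :: "nat \<Rightarrow>\<^sub>0 nat" and A :: "nat set"
  have "\<alpha> + Poly_Mapping.single i j = 0 \<longleftrightarrow> \<alpha> = 0 \<and> j = 0"
    by (metis add_is_0 lookup_add lookup_single_eq lookup_zero poly_mapping_eqI single_zero add.right_neutral)
  then show "scoeff (tcoeff i j 1) \<alpha> A = scoeff (if j = 0 then 1 else 0) \<alpha> A"
    by (auto simp: scoeff_tcoeff scoeff_one)
qed

lemma tcoeff_mult:
  assumes "f \<in> superpolys m n" "i \<notin> {1..m}"
  shows "tcoeff i j (f * g) = f * tcoeff i j g"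
  using assms(1)
proof (induction rule: superpolys_induct)
  case (xvar k f)
  then have "k \<noteq> i" using assms(2) by auto
  with xvar show ?case by (simp add: mult.assoc tcoeff_xvar_mult)
qed (simp_all add: algebra_simps tcoeff_thetavar_mult)

lemma tcoeff_superpolys_same:
  assumes "f \<in> superpolys m n" "i \<notin> {1..m}"
  shows "tcoeff i j f = (if j = 0 then f else 0)"
  using tcoeff_mult[OF assms, of j 1] by (simp add: tcoeff_one)

lemma tcoeff_laplacian: "i \<notin> {1..m} \<Longrightarrow> tcoeff i j (laplacian m n f) = laplacian m n (tcoeff i j f)"
  unfolding laplacian_def by (simp add: tcoeff_dtheta) (metis (no_types, lifting) atLeastAtMost_iff sum.cong tcoeff_dx)

text \<open>The second t-derivative shifts coefficients by two and the rest of Delta acts on each of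
  them; this is the recursion behind the Cauchy problem and behind the action of the Casimir
  operator on harmonics.\<close>

lemma tcoeff_laplacian_Suc:
  "tcoeff (Suc m) j (laplacian (Suc m) n f) =
    (real (Suc j) * real (Suc (Suc j))) *\<^sub>R tcoeff (Suc m) (Suc (Suc j)) f + laplacian m n (tcoeff (Suc m) j f)"
  by (simp add: laplacian_Suc tcoeff_dx_same tcoeff_laplacian)

lemma tcoeff_superpolys:
  assumes "f \<in> superpolys (Suc m) n" shows "tcoeff (Suc m) j f \<in> superpolys m n"
  unfolding superpolys_def
proof (intro CollectI allI impI)
  fix \<alpha> A assume "scoeff (tcoeff (Suc m) j f) \<alpha> A \<noteq> 0"
  then have "Poly_Mapping.lookup \<alpha> (Suc m) = 0" "scoeff f (\<alpha> + Poly_Mapping.single (Suc m) j) A \<noteq> 0"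
    by (auto simp: scoeff_tcoeff split: if_splits)
  with superpolysD[OF assms this(2)]
  have "Suc m \<notin> Poly_Mapping.keys \<alpha>" "Poly_Mapping.keys \<alpha> \<subseteq> {1..Suc m}" "A \<subseteq> {1..2 * n}"
    by (simp_all add: in_keys_iff keys_add_nat)
  then show "Poly_Mapping.keys \<alpha> \<subseteq> {1..m} \<and> A \<subseteq> {1..2 * n}"
    using atLeastAtMostSuc_conv[of 1 m] by auto
qed

lemma tcoeff_hspace:
  assumes "f \<in> hspace (Suc m) n k" shows "tcoeff (Suc m) j f \<in> hspace m n (k - int j)"
  unfolding hspace_def
proof (intro CollectI conjI allI impI)
  show "tcoeff (Suc m) j f \<in> superpolys m n"
    using assms by (intro tcoeff_superpolys hspace_superpolys)
  fix \<alpha> A assume "scoeff (tcoeff (Suc m) j f) \<alpha> A \<noteq> 0"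
  then have "scoeff f (\<alpha> + Poly_Mapping.single (Suc m) j) A \<noteq> 0"
    by (auto simp: scoeff_tcoeff split: if_splits)
  from hspaceD[OF assms this] show "int (pdeg \<alpha> + card A) = k - int j"
    by (simp add: pdeg_add)
qed

lemma tcoeff_parity: "f \<in> parity_part p \<Longrightarrow> tcoeff i j f \<in> parity_part p"
  by (simp add: parity_part_def scoeff_tcoeff)

lemma tcoeff_xvar_power_mult:
  "tcoeff i j (xvar i ^ a * f) = (if a \<le> j then tcoeff i (j - a) f else 0)"
  by (induction a arbitrary: j) (auto simp: mult.assoc tcoeff_xvar_mult_same)

lemma superpolys_mono: "f \<in> superpolys m n \<Longrightarrow> f \<in> superpolys (Suc m) n"
  using superpolysD[of f m n] by (fastforce simp: superpolys_def)

lemma hspace_mono: "f \<in> hspace m n k \<Longrightarrow> f \<in> hspace (Suc m) n k"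
  by (simp add: hspace_def superpolys_mono)

lemma xvar_power_mult_hspace:
  "i \<in> {1..m} \<Longrightarrow> f \<in> hspace m n k \<Longrightarrow> xvar i ^ a * f \<in> hspace m n (k + int a)"
proof (induction a)
  case (Suc a)
  then have "xvar i * (xvar i ^ a * f) \<in> hspace m n (k + int (Suc a))"
    by (intro xvar_mult_hspace) simp_all
  then show ?case by (simp add: mult.assoc)
qed simp

lemma xvar_power_superpolys: "i \<in> {1..m} \<Longrightarrow> xvar i ^ a \<in> superpolys m n"
  by (induction a) (simp_all add: superpolys_one superpolys_mult xvar_in_superpolys)

lemma xvar_power_mult_superpolys: "i \<in> {1..m} \<Longrightarrow> f \<in> superpolys m n \<Longrightarrow> xvar i ^ a * f \<in> superpolys m n"
  by (intro superpolys_mult xvar_power_superpolys)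

lemma xvar_power_parity: "xvar i ^ a \<in> parity_part 0"
  by (induction a) (use one_parity parity_part_mult[OF xvar_parity] in auto)

lemma xvar_power_left_commute: "f * (xvar i ^ a * g) = xvar i ^ a * (f * g)"
  by (induction a) (simp_all add: mult.assoc xvar_left_commute[of f])

lemma finite_tcoeff: "finite {j. tcoeff i j f \<noteq> 0}"
proof (rule finite_subset)
  show "{j. tcoeff i j f \<noteq> 0} \<subseteq> (\<lambda>\<alpha>. Poly_Mapping.lookup \<alpha> i) ` Poly_Mapping.keys f"
  proof
    fix j assume "j \<in> {j. tcoeff i j f \<noteq> 0}"
    then obtain \<alpha> where "Poly_Mapping.lookup (tcoeff i j f) \<alpha> \<noteq> 0"
      by (metis (mono_tags) mem_Collect_eq poly_mapping_eqI lookup_zero)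
    then have "Poly_Mapping.lookup \<alpha> i = 0" "\<alpha> + Poly_Mapping.single i j \<in> Poly_Mapping.keys f"
      by (auto simp: tcoeff.rep_eq in_keys_iff split: if_splits)
    then show "j \<in> (\<lambda>\<alpha>. Poly_Mapping.lookup \<alpha> i) ` Poly_Mapping.keys f"
      by (intro image_eqI[of _ _ "\<alpha> + Poly_Mapping.single i j"]) (simp_all add: lookup_add)
  qed
qed simp

lemma tcoeff_sum_powers:
  assumes "finite S" "\<And>j. g j \<in> superpolys m n" "\<And>j. j \<notin> S \<Longrightarrow> g j = 0"
  shows "tcoeff (Suc m) j (\<Sum>a\<in>S. xvar (Suc m) ^ a * g a) = g j"
proof -
  have "tcoeff (Suc m) j (\<Sum>a\<in>S. xvar (Suc m) ^ a * g a) = (\<Sum>a\<in>S. if a = j then g j else 0)"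
    unfolding tcoeff_simps tcoeff_xvar_power_mult
    by (rule sum.cong) (auto simp: tcoeff_superpolys_same[OF assms(2)])
  then show ?thesis
    using assms(1,3) by (simp add: sum.delta)
qed

lemma tcoeff_expand:
  assumes "f \<in> superpolys (Suc m) n"
  shows "f = (\<Sum>j | tcoeff (Suc m) j f \<noteq> 0. xvar (Suc m) ^ j * tcoeff (Suc m) j f)"
  by (rule tcoeff_ext[of "Suc m"], subst tcoeff_sum_powers[where n = n])
    (auto simp: finite_tcoeff tcoeff_superpolys[OF assms])

section \<open>Coefficientwise extension of derivations\<close>

definition coeffwise :: "nat \<Rightarrow> (superpoly \<Rightarrow> superpoly) \<Rightarrow> superpoly \<Rightarrow> superpoly" where
  "coeffwise i D f = (\<Sum>j | tcoeff i j f \<noteq> 0. xvar i ^ j * D (tcoeff i j f))"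

lemma tcoeff_coeffwise:
  assumes "sder m n p D" "f \<in> superpolys (Suc m) n"
  shows "tcoeff (Suc m) j (coeffwise (Suc m) D f) = D (tcoeff (Suc m) j f)"
  unfolding coeffwise_def
  by (rule tcoeff_sum_powers[where n = n])
    (auto simp: finite_tcoeff sder_zero[OF assms(1)] sder_superpolys[OF assms(1)] tcoeff_superpolys[OF assms(2)])

lemma coeffwise_superpolys:
  assumes "sder m n p D" "f \<in> superpolys (Suc m) n"
  shows "coeffwise (Suc m) D f \<in> superpolys (Suc m) n"
  unfolding coeffwise_def
  by (intro subspace_sum subspace_superpolys xvar_power_mult_superpolys superpolys_mono
      sder_superpolys[OF assms(1)] tcoeff_superpolys assms(2)) auto

lemma coeffwise_power_mult:
  assumes "sder m n p D" "f \<in> superpolys (Suc m) n"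
  shows "coeffwise (Suc m) D (xvar (Suc m) ^ a * f) = xvar (Suc m) ^ a * coeffwise (Suc m) D f"
proof (rule tcoeff_ext[of "Suc m"])
  have "xvar (Suc m) ^ a * f \<in> superpolys (Suc m) n"
    using assms(2) by (intro xvar_power_mult_superpolys) auto
  then show "tcoeff (Suc m) j (coeffwise (Suc m) D (xvar (Suc m) ^ a * f)) =
      tcoeff (Suc m) j (xvar (Suc m) ^ a * coeffwise (Suc m) D f)" for j
    by (simp add: tcoeff_coeffwise[OF assms(1)] assms(2) tcoeff_xvar_power_mult sder_zero[OF assms(1)])
qed

text \<open>For a left factor free of t the Leibniz rule holds in every t-degree separately. A
  general left factor is expanded in powers of t, which are even and central.\<close>

lemma sder_coeffwise:
  assumes D: "sder m n p D"
  shows "sder (Suc m) n p (coeffwise (Suc m) D)"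
proof -
  let ?t = "xvar (Suc m)" and ?E = "coeffwise (Suc m) D" and ?c = "tcoeff (Suc m)"
  have add: "?E (f + g) = ?E f + ?E g" if "f \<in> superpolys (Suc m) n" "g \<in> superpolys (Suc m) n" for f g
    by (rule tcoeff_ext[of "Suc m"])
      (use that in \<open>simp add: tcoeff_coeffwise[OF D] subspace_add[OF subspace_superpolys] sder_add[OF D] tcoeff_superpolys\<close>)
  have scale: "?E (c *\<^sub>R f) = c *\<^sub>R ?E f" if "f \<in> superpolys (Suc m) n" for c f
    by (rule tcoeff_ext[of "Suc m"])
      (use that in \<open>simp add: tcoeff_coeffwise[OF D] subspace_scale[OF subspace_superpolys] sder_scaleR[OF D] tcoeff_superpolys\<close>)
  have sum: "?E (sum h S) = (\<Sum>s\<in>S. ?E (h s))" if "finite S" "\<And>s. s \<in> S \<Longrightarrow> h s \<in> superpolys (Suc m) n"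
    for h and S :: "nat set"
    using that
  proof (induction S rule: finite_induct)
    case empty
    have "?E 0 = 0" by (simp add: coeffwise_def)
    then show ?case by simp
  next
    case (insert s S)
    then show ?case by (simp add: add subspace_sum[OF subspace_superpolys])
  qed
  have base: "?E (f * g) = D f * g + (-1) ^ (p * q) *\<^sub>R (f * ?E g)"
    if "f \<in> superpolys m n" "f \<in> parity_part q" "g \<in> superpolys (Suc m) n" for f g q
  proof (rule tcoeff_ext[of "Suc m"])
    fix j
    have "f * g \<in> superpolys (Suc m) n"
      using that by (simp add: superpolys_mult superpolys_mono)
    moreover have "?c j (D f * h) = D f * ?c j h" "?c j (f * h) = f * ?c j h" for h
      using that(1) sder_superpolys[OF D that(1)] by (auto intro!: tcoeff_mult)
    ultimately show "?c j (?E (f * g)) = ?c j (D f * g + (-1) ^ (p * q) *\<^sub>R (f * ?E g))"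
      using that by (simp add: tcoeff_coeffwise[OF D] sder_mult[OF D] tcoeff_superpolys)
  qed
  show ?thesis
  proof (rule sderI)
    fix f assume f: "f \<in> superpolys (Suc m) n"
    then show "?E f \<in> superpolys (Suc m) n" by (rule coeffwise_superpolys[OF D])
    fix q assume q: "f \<in> parity_part q"
    have "?t ^ j * D (?c j f) \<in> parity_part (p + q)" for j
      using parity_part_mult[OF xvar_power_parity sder_parity[OF D tcoeff_superpolys[OF f] tcoeff_parity[OF q]]]
      by simp
    then show "?E f \<in> parity_part (p + q)"
      unfolding coeffwise_def by (intro subspace_sum subspace_parity_part)
    fix g assume g: "g \<in> superpolys (Suc m) n"
    let ?S = "{j. ?c j f \<noteq> 0}"
    have fg: "?c j f * g \<in> superpolys (Suc m) n" for j
      by (rule superpolys_mult[OF superpolys_mono[OF tcoeff_superpolys[OF f]] g])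
    have "f * g = (\<Sum>j\<in>?S. ?t ^ j * (?c j f * g))"
      using arg_cong[OF tcoeff_expand[OF f], of "\<lambda>h. h * g"] by (simp only: sum_distrib_right mult.assoc)
    then have "?E (f * g) = ?E (\<Sum>j\<in>?S. ?t ^ j * (?c j f * g))"
      by (rule arg_cong)
    also have "\<dots> = (\<Sum>j\<in>?S. ?E (?t ^ j * (?c j f * g)))"
      using fg by (intro sum finite_tcoeff xvar_power_mult_superpolys) auto
    also have "\<dots> = (\<Sum>j\<in>?S. ?t ^ j * (D (?c j f) * g) + (-1) ^ (p * q) *\<^sub>R (?t ^ j * (?c j f * ?E g)))"
      by (simp add: coeffwise_power_mult[OF D fg] base[OF tcoeff_superpolys[OF f] tcoeff_parity[OF q] g] distrib_left)
    also have "\<dots> = ?E f * g + (-1) ^ (p * q) *\<^sub>R ((\<Sum>j\<in>?S. ?t ^ j * ?c j f) * ?E g)"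
      by (simp add: coeffwise_def sum.distrib sum_distrib_right mult.assoc scaleR_sum_right)
    also have "(\<Sum>j\<in>?S. ?t ^ j * ?c j f) = f"
      by (rule tcoeff_expand[OF f, symmetric])
    finally show "?E (f * g) = ?E f * g + (-1) ^ (p * q) *\<^sub>R (f * ?E g)" .
  qed (auto simp: add scale)
qed

text \<open>A superderivation that annihilates t commutes with multiplication by t, so it is
  determined by its action on t-coefficients. This turns the description by \<open>THE\<close> into
  a formula.\<close>

lemma extend_der_eq:
  assumes D: "sder m n p D" and f: "f \<in> superpolys (Suc m) n"
  shows "extend_der (Suc m) n D f = coeffwise (Suc m) D f"
proof -
  let ?t = "xvar (Suc m)" and ?E = "restrict (coeffwise (Suc m) D) (superpolys (Suc m) n)"
  have t: "?t \<in> superpolys (Suc m) n"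
    by (rule xvar_in_superpolys) simp
  have "extend_der (Suc m) n D = ?E"
    unfolding extend_der_def diff_Suc_1
  proof (rule the_equality, intro conjI)
    have p: "p mod 2 \<in> {0, 1}" by auto
    have "?E \<in> superderivations (Suc m) n (p mod 2)"
      unfolding superderivations_iff
      using sder_parity_cong[OF sder_restrict[OF sder_coeffwise[OF D]], of "p mod 2"] by simp
    then show "\<exists>p\<in>{0, 1}. ?E \<in> superderivations (Suc m) n p"
      using p by (rule bexI)
  next
    show "\<forall>f\<in>superpolys m n. ?E f = D f"
    proof
      fix f assume f: "f \<in> superpolys m n"
      have "coeffwise (Suc m) D f = D f"
        by (rule tcoeff_ext[of "Suc m"])
          (simp add: tcoeff_coeffwise[OF D superpolys_mono[OF f]] tcoeff_superpolys_same[OF f]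
            tcoeff_superpolys_same[OF sder_superpolys[OF D f]] sder_zero[OF D])
      then show "?E f = D f"
        using superpolys_mono[OF f] by simp
    qed
    have "coeffwise (Suc m) D ?t = 0"
      using coeffwise_power_mult[OF D superpolys_one, of 1]
      by (simp add: coeffwise_def[of _ _ 1] tcoeff_one sder_one[OF D])
    then show "?E ?t = 0" using t by simp
  next
    fix E assume E: "(\<exists>p\<in>{0, 1}. E \<in> superderivations (Suc m) n p) \<and>
      (\<forall>f\<in>superpolys m n. E f = D f) \<and> E ?t = 0"
    \<comment> \<open>The competitor may have a parity p' different from that of \<open>D\<close>;
      as t is even, the Leibniz rule for multiples of t has no sign for either parity.\<close>
    then obtain p' where E': "E \<in> extensional (superpolys (Suc m) n)" "sder (Suc m) n p' E"
      by (auto simp: superderivations_iff)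
    have pow: "E (?t ^ j * h) = ?t ^ j * E h" if "h \<in> superpolys (Suc m) n" for j h
    proof (induction j)
      case (Suc j)
      have "?t ^ j * h \<in> superpolys (Suc m) n"
        using that by (intro xvar_power_mult_superpolys) auto
      then show ?case
        using sder_xvar_mult[OF E'(2), of "Suc m" "?t ^ j * h"] Suc E by (simp add: mult.assoc)
    qed simp
    show "E = ?E"
    proof (rule extensionalityI[OF E'(1)])
      fix f assume f: "f \<in> superpolys (Suc m) n"
      let ?c = "\<lambda>j. tcoeff (Suc m) j f"
      have c: "?c j \<in> superpolys m n" for j
        by (rule tcoeff_superpolys[OF f])
      have "E f = E (\<Sum>j | ?c j \<noteq> 0. ?t ^ j * ?c j)"
        by (rule arg_cong[OF tcoeff_expand[OF f]])
      also have "\<dots> = (\<Sum>j | ?c j \<noteq> 0. E (?t ^ j * ?c j))"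
        by (rule sder_sum[OF E'(2)], rule xvar_power_mult_superpolys[OF _ superpolys_mono[OF c]]) simp
      also have "\<dots> = coeffwise (Suc m) D f"
        unfolding coeffwise_def
      proof (rule sum.cong[OF refl])
        fix j
        have "E (?c j) = D (?c j)" using E c by blast
        then show "E (?t ^ j * ?c j) = ?t ^ j * D (?c j)"
          using pow[OF superpolys_mono[OF c]] by simp
      qed
      finally show "E f = ?E f" using f by simp
    qed simp
  qed
  with f show ?thesis by simp
qed

section \<open>Irreducibility of the spherical harmonics\<close>

text \<open>Cauchy--Kovalevskaya: \<open>\<Delta> f = g\<close> is a recursion for the coefficients of \<open>f\<close>.\<close>

lemma laplacian_cauchy_exists:
  assumes "f0 \<in> hspace m n k" "f1 \<in> hspace m n (k - 1)" "g \<in> hspace (Suc m) n (k - 2)"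
  obtains f where "f \<in> hspace (Suc m) n k" "tcoeff (Suc m) 0 f = f0" "tcoeff (Suc m) 1 f = f1"
    "laplacian (Suc m) n f = g"
proof -
  let ?c = "tcoeff (Suc m)" and ?t = "xvar (Suc m)"
  \<comment> \<open>The recursion has order two, so primitive recursion carries pairs of consecutive
    coefficients.\<close>
  define P where "P j = rec_nat (f0, f1) (\<lambda>j (a, b). (b, (1 / (real (Suc j) * real (Suc (Suc j)))) *\<^sub>R
      (?c j g - laplacian m n a))) j" for j
  define a where "a j = fst (P j)" for j
  have snd: "snd (P j) = a (Suc j)" for j
    by (simp add: a_def P_def case_prod_beta)
  have a: "a 0 = f0" "a 1 = f1"
    "a (Suc (Suc j)) = (1 / (real (Suc j) * real (Suc (Suc j)))) *\<^sub>R (?c j g - laplacian m n (a j))" for j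
    by (simp_all add: a_def P_def case_prod_beta)
  have mem: "a j \<in> hspace m n (k - int j) \<and> a (Suc j) \<in> hspace m n (k - int (Suc j))" for j
  proof (induction j)
    case 0
    then show ?case using assms a by simp
  next
    case (Suc j)
    have "?c j g \<in> hspace m n (k - int (Suc (Suc j)))" "laplacian m n (a j) \<in> hspace m n (k - int (Suc (Suc j)))"
      using tcoeff_hspace[OF assms(3), of j] laplacian_hspace[OF conjunct1[OF Suc], of m n]
      by (simp_all add: algebra_simps)
    then show ?case
      unfolding a(3) using Suc by (intro conjI subspace_scale subspace_diff subspace_hspace) simp_all
  qed
  \<comment> \<open>Coefficients beyond t^k have negative degree and are 0, so the sum may stop at
    \<open>nat k\<close>.\<close>
  define f where "f = (\<Sum>j\<in>{..nat k}. ?t ^ j * a j)"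
  have c: "?c j f = a j" for j
    unfolding f_def
  proof (rule tcoeff_sum_powers[where n = n])
    show "a j \<in> superpolys m n" for j
      using mem hspace_superpolys by blast
    show "a j = 0" if "j \<notin> {..nat k}" for j
      using that mem[of j] by (intro hspace_neg[of _ m n "k - int j"]) auto
  qed simp
  have "f \<in> hspace (Suc m) n k"
    unfolding f_def
  proof (intro subspace_sum subspace_hspace)
    fix j
    have "a j \<in> hspace (Suc m) n (k - int j)"
      using mem hspace_mono by blast
    from xvar_power_mult_hspace[OF _ this, of "Suc m" j] show "?t ^ j * a j \<in> hspace (Suc m) n k"
      by simp
  qed
  moreover have "laplacian (Suc m) n f = g"
    by (rule tcoeff_ext[of "Suc m"]) (simp add: tcoeff_laplacian_Suc c a(3))
  ultimately show ?thesis
    using that c a by simp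
qed

lemma laplacian_cauchy_unique:
  assumes "laplacian (Suc m) n f = 0" "tcoeff (Suc m) 0 f = 0" "tcoeff (Suc m) 1 f = 0"
  shows "f = 0"
proof (rule tcoeff_ext[of "Suc m"])
  have "tcoeff (Suc m) j f = 0 \<and> tcoeff (Suc m) (Suc j) f = 0" for j
  proof (induction j)
    case (Suc j)
    then show ?case
      using tcoeff_laplacian_Suc[of m j n f] assms(1) by simp
  qed (use assms in simp)
  then show "tcoeff (Suc m) j f = tcoeff (Suc m) j 0" for j by simp
qed

section \<open>Spherical harmonics as graded modules\<close>

lemma ppart_parity_part: "f \<in> parity_part p \<Longrightarrow> ppart q f = (if p mod 2 = q then f else 0)"
  by (rule superpoly_eqI) (auto simp: scoeff_ppart dest: parity_partD)

lemma ppart_plus: "ppart q (f + g) = ppart q f + ppart q g"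
  by (rule superpoly_eqI) (auto simp: scoeff_ppart)

text \<open>With this, the kernels of the even operators built from Delta and R^2 contain the parity
  components of their elements and are graded subspaces.\<close>

lemma ppart_commute:
  assumes "\<And>f g. T (f + g) = T f + T g" "\<And>p f. f \<in> parity_part p \<Longrightarrow> T f \<in> parity_part p" "q \<in> {0, 1}"
  shows "T (ppart q f) = ppart q (T f)"
proof -
  have "ppart q (T f) = ppart q (T (ppart 0 f)) + ppart q (T (ppart 1 f))"
    by (metis assms(1) ppart_plus ppart_add)
  also have "\<dots> = T (ppart q f)"
    using assms(3) ppart_parity_part[OF assms(2)[OF ppart_parity]] by auto
  finally show ?thesis ..
qed

lemma ppart_zero: "ppart q 0 = 0"
  by (rule superpoly_eqI) (simp add: scoeff_ppart)

lemma ppart_laplacian: "q \<in> {0, 1} \<Longrightarrow> laplacian m n (ppart q f) = ppart q (laplacian m n f)"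
  by (rule ppart_commute) (auto intro: laplacian_parity)

lemma ppart_R2_mult: "q \<in> {0, 1} \<Longrightarrow> R2 m n * ppart q f = ppart q (R2 m n * f)"
  by (rule ppart_commute) (auto intro: R2_mult_parity simp: distrib_left)

text \<open>Serves two actions on spaces of superpolynomials: the natural one on the harmonics and
  the one by extended derivations on the generalized harmonics.\<close>

lemma osp_module_superpolysI:
  assumes S: "subspace S" "\<And>f q. f \<in> S \<Longrightarrow> q \<in> {0, 1} \<Longrightarrow> ppart q f \<in> S"
    and mem: "\<And>p D f. p \<in> {0, 1} \<Longrightarrow> D \<in> osp m n p \<Longrightarrow> f \<in> S \<Longrightarrow> act D f \<in> S"
    and lin: "\<And>p D. p \<in> {0, 1} \<Longrightarrow> D \<in> osp m n p \<Longrightarrow> linear_on S (act D)"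
    and par: "\<And>p q D f. p \<in> {0, 1} \<Longrightarrow> D \<in> osp m n p \<Longrightarrow> f \<in> S \<Longrightarrow> f \<in> parity_part q \<Longrightarrow>
      act D f \<in> parity_part (p + q)"
    and comb: "\<And>p D E a b f. p \<in> {0, 1} \<Longrightarrow> D \<in> osp m n p \<Longrightarrow> E \<in> osp m n p \<Longrightarrow> f \<in> S \<Longrightarrow>
      act (lincomb m n a D b E) f = a *\<^sub>R act D f + b *\<^sub>R act E f"
    and brack: "\<And>p q D E f. p \<in> {0, 1} \<Longrightarrow> q \<in> {0, 1} \<Longrightarrow> D \<in> osp m n p \<Longrightarrow> E \<in> osp m n q \<Longrightarrow> f \<in> S \<Longrightarrow>
      act (superbracket m n p q D E) f = act D (act E f) - (-1) ^ (p * q) *\<^sub>R act E (act D f)"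
  shows "osp_module m n \<lparr>mspace = S, mpart = (\<lambda>p. S \<inter> parity_part p), mact = act\<rparr>"
  unfolding osp_module_def smodule.simps
proof (intro conjI ballI allI)
  show "subspace (S \<inter> parity_part p)" for p
    using S(1) by (intro subspace_inter subspace_parity_part)
  have "f = 0" if "f \<in> parity_part 0" "f \<in> parity_part 1" for f
    using parity_part_disjoint[OF that] by simp
  then show "S \<inter> parity_part 0 \<inter> (S \<inter> parity_part 1) = {0}"
    using subspace_0[OF S(1)] subspace_0[OF subspace_parity_part] by auto
  show "graded_subspace \<lparr>mspace = S, mpart = (\<lambda>p. S \<inter> parity_part p), mact = act\<rparr> S"
    unfolding graded_subspace_def smodule.simps
  proof (intro conjI ballI S(1) order_refl)
    fix f assume "f \<in> S"
    then show "\<exists>u0\<in>S \<inter> (S \<inter> parity_part 0). \<exists>u1\<in>S \<inter> (S \<inter> parity_part 1). f = u0 + u1"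
      by (intro bexI[of _ "ppart 0 f"] bexI[of _ "ppart 1 f"] ppart_add) (simp_all add: S(2) ppart_parity)
  qed
  fix p q :: nat and D assume p: "p \<in> {0, 1}" and D: "D \<in> osp m n p"
  show "linear_on S (act D)" using lin[OF p D] .
  show "act D ` (S \<inter> parity_part q) \<subseteq> S \<inter> parity_part ((p + q) mod 2)"
    using mem[OF p D] par[OF p D] parity_part_cong[of "(p + q) mod 2" "p + q"] by auto
qed (auto intro: comb brack)

lemma harmonics_eq: "harmonics m n l = {f \<in> hspace m n (int l). laplacian m n f = 0}"
  by (simp add: harmonics_def homogeneous_superpolys_eq)

lemma subspace_harmonics: "subspace (harmonics m n l)"
  unfolding harmonics_eq
  by (rule subspaceI)
    (auto intro: subspace_0[OF subspace_hspace] subspace_add[OF subspace_hspace] subspace_scale[OF subspace_hspace])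

lemma harmonics_hspace: "f \<in> harmonics m n l \<Longrightarrow> f \<in> hspace m n (int l)"
  and harmonics_superpolys: "f \<in> harmonics m n l \<Longrightarrow> f \<in> superpolys m n"
  and harmonics_laplacian: "f \<in> harmonics m n l \<Longrightarrow> laplacian m n f = 0"
  by (auto simp: harmonics_eq hspace_superpolys)

lemma osp_harmonics: "D \<in> osp m n p \<Longrightarrow> f \<in> harmonics m n l \<Longrightarrow> D f \<in> harmonics m n l"
  using osp_laplacian[of D m n p f]
  by (auto simp: harmonics_eq osp_hspace hspace_superpolys sder_zero[OF osp_sder])

lemma linear_on_subset: "linear_on S f \<Longrightarrow> T \<subseteq> S \<Longrightarrow> linear_on T f"
  unfolding linear_on_def by blast

lemma osp_module_harmonics: "osp_module m n (harmonics_module m n l)"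
  unfolding harmonics_module_def
proof (rule osp_module_superpolysI[OF subspace_harmonics])
  show "ppart q f \<in> harmonics m n l" if "f \<in> harmonics m n l" "q \<in> {0, 1}" for q f
    using that by (simp only: harmonics_eq mem_Collect_eq ppart_laplacian ppart_hspace ppart_zero)
  show "linear_on (harmonics m n l) D" if "D \<in> osp m n p" for p D
    using linear_on_subset[OF sder_linear_on[OF osp_sder[OF that]]] harmonics_superpolys by blast
  show "D f \<in> parity_part (p + q)"
    if "D \<in> osp m n p" "f \<in> harmonics m n l" "f \<in> parity_part q" for p q D f
    using that by (intro sder_parity[OF osp_sder] harmonics_superpolys)
qed (auto intro: osp_harmonics simp: lincomb_def superbracket_def harmonics_superpolys)

text \<open>
  The elements of \<open>osp(m + 1|2n)\<close> that rotate the last even coordinate \<open>t = x\<^bsub>m+1\<^esub>\<close> into the others.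
\<close>

definition rot_x :: "nat \<Rightarrow> nat \<Rightarrow> superpoly \<Rightarrow> superpoly" where
  "rot_x m i f = xvar i * dx (Suc m) f - xvar (Suc m) * dx i f"

text \<open>The factor \<open>2 * tsgn q\<close> is forced by the annihilation of R^2: its
  t-derivative is 2t, its derivative by the partner of theta_q is \<open>tsgn q\<close> theta_q, and
  \<open>tsgn q\<close> squares to 1.\<close>

definition rot_theta :: "nat \<Rightarrow> nat \<Rightarrow> superpoly \<Rightarrow> superpoly" where
  "rot_theta m q f = thetavar q * dx (Suc m) f - (2 * tsgn q) *\<^sub>R (xvar (Suc m) * dtheta (tconj q) f)"

lemma dx_R2:
  assumes "i \<in> {1..m}" shows "dx i (R2 m n) = 2 *\<^sub>R xvar i"
proof -
  have "2 *\<^sub>R dx i (R2 m n) = 2 *\<^sub>R 2 *\<^sub>R xvar i"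
    using sharp_R2[OF xvar_coords[OF assms]] sharp_xvar[OF assms, of n "R2 m n"] by simp
  then show ?thesis by (simp only: scaleR_cancel_left) simp
qed

lemma dtheta_R2:
  assumes "q \<in> {1..2 * n}" shows "dtheta (tconj q) (R2 m n) = tsgn q *\<^sub>R thetavar q"
proof -
  have "(tsgn q / 4) *\<^sub>R (4 * tsgn q) *\<^sub>R dtheta (tconj q) (R2 m n) = (tsgn q / 4) *\<^sub>R 4 *\<^sub>R thetavar q"
    using sharp_R2[OF thetavar_coords[OF assms]] sharp_thetavar[OF assms, of m "R2 m n"] by simp
  moreover have "tsgn q * tsgn q = 1" by (simp add: tsgn_def)
  ultimately show ?thesis by simp
qed

lemma rot_x_osp: "i \<in> {1..m} \<Longrightarrow> restrict (rot_x m i) (superpolys (Suc m) n) \<in> osp (Suc m) n 0"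
proof (rule ospI)
  assume i: "i \<in> {1..m}"
  then have i': "i \<in> {1..Suc m}" "Suc m \<in> {1..Suc m}" by auto
  have "sder (Suc m) n 0 (rot_x m i)"
    unfolding rot_x_def[abs_def] using i' by (intro sder_diff_map sder_xvar_mult_map sder_dx)
  then show "sder (Suc m) n 0 (restrict (rot_x m i) (superpolys (Suc m) n))"
    by (rule sder_restrict)
  have "xvar i \<in> coords (Suc m) n" "xvar (Suc m) \<in> coords (Suc m) n"
    using i' by (auto intro!: xvar_coords)
  then show "restrict (rot_x m i) (superpolys (Suc m) n) (xvar k) \<in> coords (Suc m) n" if "k \<in> {1..Suc m}" for k
    using that by (auto simp: xvar_in_superpolys rot_x_def dx_xvar coords_def span_diff span_neg span_zero)
  show "restrict (rot_x m i) (superpolys (Suc m) n) (thetavar k) \<in> coords (Suc m) n" if "k \<in> {1..2 * n}" for k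
    using that by (simp add: thetavar_in_superpolys rot_x_def dx_thetavar coords_def span_zero)
  show "restrict (rot_x m i) (superpolys (Suc m) n) (R2 (Suc m) n) = 0"
    using i' by (simp add: R2_superpolys rot_x_def dx_R2) (simp add: xvar_mult_commute[of "xvar i"])
qed simp

lemma rot_theta_osp: "q \<in> {1..2 * n} \<Longrightarrow> restrict (rot_theta m q) (superpolys (Suc m) n) \<in> osp (Suc m) n 1"
proof (rule ospI)
  assume q: "q \<in> {1..2 * n}"
  have t: "Suc m \<in> {1..Suc m}" by auto
  have "sder (Suc m) n 1 (\<lambda>f. thetavar q * dx (Suc m) f)"
    using sder_thetavar_mult_map[OF sder_dx q] by simp
  then have "sder (Suc m) n 1 (rot_theta m q)"
    unfolding rot_theta_def[abs_def]
    by (intro sder_diff_map sder_scale_map sder_xvar_mult_map sder_dtheta t)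
  then show "sder (Suc m) n 1 (restrict (rot_theta m q) (superpolys (Suc m) n))"
    by (rule sder_restrict)
  show "restrict (rot_theta m q) (superpolys (Suc m) n) (xvar k) \<in> coords (Suc m) n" if "k \<in> {1..Suc m}" for k
    using that thetavar_coords[OF q, of "Suc m"]
    by (auto simp: xvar_in_superpolys rot_theta_def dx_xvar dtheta_xvar coords_def span_zero)
  show "restrict (rot_theta m q) (superpolys (Suc m) n) (thetavar k) \<in> coords (Suc m) n" if "k \<in> {1..2 * n}" for k
    using that xvar_coords[OF t, of n]
    by (auto simp: thetavar_in_superpolys rot_theta_def dx_thetavar dtheta_thetavar coords_def span_zero
        intro: span_neg span_scale)
  have "tsgn q * tsgn q = 1" by (simp add: tsgn_def)
  then show "restrict (rot_theta m q) (superpolys (Suc m) n) (R2 (Suc m) n) = 0"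
    using q t by (simp add: R2_superpolys rot_theta_def dx_R2 dtheta_R2 xvar_mult_commute mult.assoc)
qed simp

lemma dtheta_anticommute: 
  assumes "f \<in> superpolys m n" shows "dtheta i (dtheta j f) = - dtheta j (dtheta i f)"
  using assms
  by (induction rule: superpolys_induct) (simp_all add: dtheta_one dtheta_xvar_mult dtheta_thetavar_mult)

lemma tcoeff_rot_x:
  assumes "i \<in> {1..m}"
  shows "tcoeff (Suc m) j (rot_x m i f) = real (Suc j) *\<^sub>R (xvar i * tcoeff (Suc m) (Suc j) f) -
    (if j = 0 then 0 else dx i (tcoeff (Suc m) (j - 1) f))"
proof -
  have "i \<noteq> Suc m" using assms by auto
  then show ?thesis
    by (simp add: rot_x_def tcoeff_xvar_mult tcoeff_xvar_mult_same tcoeff_dx_same tcoeff_dx)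
qed

lemma tcoeff_rot_theta:
  "tcoeff (Suc m) j (rot_theta m q f) = real (Suc j) *\<^sub>R (thetavar q * tcoeff (Suc m) (Suc j) f) -
    (if j = 0 then 0 else (2 * tsgn q) *\<^sub>R dtheta (tconj q) (tcoeff (Suc m) (j - 1) f))"
  by (simp add: rot_theta_def tcoeff_thetavar_mult tcoeff_xvar_mult_same tcoeff_dx_same tcoeff_dtheta)

text \<open>
  The difference of the Casimir operators of \<open>osp(m + 1|2n)\<close> and \<open>osp(m|2n)\<close>. On spherical
  harmonics, the former is a scalar.
\<close>

definition casimir_diff :: "nat \<Rightarrow> nat \<Rightarrow> superpoly \<Rightarrow> superpoly" where
  "casimir_diff m n f = (\<Sum>i=1..m. rot_x m i (rot_x m i f)) +
    (1 / 2) *\<^sub>R (\<Sum>j=1..n. rot_theta m (2 * j) (rot_theta m (2 * j - 1) f) -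
      rot_theta m (2 * j - 1) (rot_theta m (2 * j) f))"

text \<open>As an operator, \<open>casimir_diff\<close> is r d_t^2 - (2 t d_t + 1) E - (m - 2n) t
  d_t + t^2 Delta, with r, E and Delta those of the variables other than t. The factor 1/2 on the
  odd rotations is what lets even and odd variables combine to these invariant operators.\<close>

lemma tcoeff_casimir_diff:
  assumes f: "f \<in> superpolys (Suc m) n"
  shows "tcoeff (Suc m) j (casimir_diff m n f) =
    (real (Suc j) * real (Suc (Suc j))) *\<^sub>R (R2 m n * tcoeff (Suc m) (Suc (Suc j)) f) -
    (2 * real j + 1) *\<^sub>R euler m n (tcoeff (Suc m) j f) -
    (real j * (real m - 2 * real n)) *\<^sub>R tcoeff (Suc m) j f +
    (if j < 2 then 0 else laplacian m n (tcoeff (Suc m) (j - 2) f))"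
proof -
  let ?c = "\<lambda>j. tcoeff (Suc m) j f"
  let ?b = "(real (Suc j) * real (Suc (Suc j))) *\<^sub>R ?c (Suc (Suc j))"
  let ?d = "if j < 2 then 0 else ?c (j - 2)"
  have x: "tcoeff (Suc m) j (rot_x m i (rot_x m i f)) =
      xvar i * (xvar i * ?b) - (2 * real j + 1) *\<^sub>R (xvar i * dx i (?c j)) - real j *\<^sub>R ?c j + dx i (dx i ?d)"
    if "i \<in> {1..m}" for i
  proof -
    consider "j = 0" | "j = 1" | i where "j = Suc (Suc i)" by (metis One_nat_def not0_implies_Suc)
    then show ?thesis
      by cases (rule superpoly_eqI, simp add: tcoeff_rot_x[OF that] dx_xvar_mult algebra_simps)+
  qed
  have th: "tcoeff (Suc m) j (rot_theta m (2 * p) (rot_theta m (2 * p - 1) f) -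
        rot_theta m (2 * p - 1) (rot_theta m (2 * p) f)) =
      2 *\<^sub>R (- (thetavar (2 * p - 1) * (thetavar (2 * p) * ?b)) -
        (2 * real j + 1) *\<^sub>R (thetavar (2 * p - 1) * dtheta (2 * p - 1) (?c j) + thetavar (2 * p) * dtheta (2 * p) (?c j)) +
        (2 * real j) *\<^sub>R ?c j - 4 *\<^sub>R dtheta (2 * p - 1) (dtheta (2 * p) ?d))"
    if "p \<in> {1..n}" for p
  proof -
    define q r where "q = 2 * p - 1" and "r = 2 * p"
    have q: "tconj q = r" "tconj r = q" "tsgn q = 1" "tsgn r = -1" "q \<noteq> r" "r \<noteq> q"
      using that by (auto simp: q_def r_def tconj_def tsgn_def)
    have anti: "thetavar r * (thetavar q * h) = - (thetavar q * (thetavar r * h))" for h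
      by (rule thetavar_left_anticommute)
    have danti: "dtheta r (dtheta q (?c i)) = - dtheta q (dtheta r (?c i))" for i
      by (rule dtheta_anticommute[OF tcoeff_superpolys[OF f]])
    consider "j = 0" | "j = 1" | i where "j = Suc (Suc i)" by (metis One_nat_def not0_implies_Suc)
    then show ?thesis
      unfolding q_def[symmetric] unfolding r_def[symmetric]
      by cases (rule superpoly_eqI, simp add: q tcoeff_rot_theta dtheta_thetavar_mult anti danti algebra_simps)+
  qed
  have "tcoeff (Suc m) j (casimir_diff m n f) =
    (\<Sum>i=1..m. tcoeff (Suc m) j (rot_x m i (rot_x m i f))) +
    (1 / 2) *\<^sub>R (\<Sum>p=1..n. tcoeff (Suc m) j (rot_theta m (2 * p) (rot_theta m (2 * p - 1) f) -
        rot_theta m (2 * p - 1) (rot_theta m (2 * p) f)))"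
    by (simp add: casimir_diff_def)
  also have "\<dots> = (\<Sum>i=1..m. xvar i * (xvar i * ?b) - (2 * real j + 1) *\<^sub>R (xvar i * dx i (?c j)) - real j *\<^sub>R ?c j + dx i (dx i ?d)) +
    (1 / 2) *\<^sub>R (\<Sum>p=1..n. 2 *\<^sub>R (- (thetavar (2 * p - 1) * (thetavar (2 * p) * ?b)) -
        (2 * real j + 1) *\<^sub>R (thetavar (2 * p - 1) * dtheta (2 * p - 1) (?c j) + thetavar (2 * p) * dtheta (2 * p) (?c j)) +
        (2 * real j) *\<^sub>R ?c j - 4 *\<^sub>R dtheta (2 * p - 1) (dtheta (2 * p) ?d)))"
    by (intro arg_cong2[of _ _ _ _ "(+)"] arg_cong2[of _ _ _ _ scaleR] refl sum.cong x th)
  also have "\<dots> = R2 m n * ?b - (2 * real j + 1) *\<^sub>R euler m n (?c j) -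
      (real j * (real m - 2 * real n)) *\<^sub>R ?c j + laplacian m n ?d"
    unfolding euler_def laplacian_def R2_def sum_pairs power2_eq_square left_diff_distrib sum_distrib_right mult.assoc
    by (rule superpoly_eqI)
      (simp del: sum_constant add: sum_constant_scaleR sum.distrib sum_subtractf sum_negf distrib_left right_diff_distrib mult.assoc flip: sum_distrib_left,
       simp add: algebra_simps)
  finally show ?thesis by simp
qed


lemma dx_last_power_mult:
  assumes "f \<in> superpolys m n"
  shows "dx (Suc m) (xvar (Suc m) ^ a * f) = real a *\<^sub>R (xvar (Suc m) ^ (a - 1) * f)"
proof (rule tcoeff_ext[of "Suc m"])
  show "tcoeff (Suc m) j (dx (Suc m) (xvar (Suc m) ^ a * f)) =
      tcoeff (Suc m) j (real a *\<^sub>R (xvar (Suc m) ^ (a - 1) * f))" for j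
    by (cases a) (auto simp: tcoeff_dx_same tcoeff_xvar_power_mult[of "Suc m"] tcoeff_superpolys_same[OF assms]
      simp del: power_Suc)
qed

lemma dx_power_mult: "k \<noteq> i \<Longrightarrow> dx i (xvar k ^ a * f) = xvar k ^ a * dx i (f :: superpoly)"
  by (induction a) (simp_all add: mult.assoc dx_xvar_mult)

lemma dtheta_power_mult: "dtheta i (xvar k ^ a * f) = xvar k ^ a * dtheta i f"
  by (induction a) (simp_all add: mult.assoc dtheta_xvar_mult)

lemma rot_x_power_mult:
  assumes "i \<in> {1..m}" "f \<in> superpolys m n"
  shows "rot_x m i (xvar (Suc m) ^ a * f) =
    real a *\<^sub>R (xvar (Suc m) ^ (a - 1) * (xvar i * f)) - xvar (Suc m) ^ Suc a * dx i f"
proof -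
  have "Suc m \<noteq> i" using assms by auto
  then show ?thesis
    by (simp add: rot_x_def dx_last_power_mult[OF assms(2)] dx_power_mult mult.assoc xvar_power_left_commute[of "xvar i"])
qed

lemma rot_theta_power_mult:
  assumes "f \<in> superpolys m n"
  shows "rot_theta m q (xvar (Suc m) ^ a * f) =
    real a *\<^sub>R (xvar (Suc m) ^ (a - 1) * (thetavar q * f)) -
    (2 * tsgn q) *\<^sub>R (xvar (Suc m) ^ Suc a * dtheta (tconj q) f)"
  by (simp add: rot_theta_def dx_last_power_mult[OF assms] dtheta_power_mult mult.assoc
      xvar_power_left_commute[of "thetavar q"])

text \<open>Modulo \<open>R\<^sup>2\<close>, the square radius of \<open>\<real>\<^sup>m\<^sup>|\<^sup>2\<^sup>n\<close> equals \<open>- t\<^sup>2\<close>.\<close>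

lemma power_radial_mod_R2:
  "\<exists>p \<in> hspace (Suc m) n (int (a + 2 * q) - 2).
    xvar (Suc m) ^ a * R2 m n ^ q = (-1) ^ q *\<^sub>R xvar (Suc m) ^ (a + 2 * q) + R2 (Suc m) n * p"
proof (induction q arbitrary: a)
  case 0
  show ?case by (intro bexI[of _ 0]) (simp_all add: subspace_0[OF subspace_hspace])
next
  case (Suc q)
  let ?t = "xvar (Suc m)"
  obtain p where p: "p \<in> hspace (Suc m) n (int (a + 2 + 2 * q) - 2)"
      "?t ^ (a + 2) * R2 m n ^ q = (-1) ^ q *\<^sub>R ?t ^ (a + 2 + 2 * q) + R2 (Suc m) n * p"
    using Suc[of "a + 2"] by blast
  have "R2 m n ^ q \<in> hspace m n (2 * int q)"
    using R2_power_hspace[OF one_in_hspace, of m n q] by simp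
  then have mem: "?t ^ a * R2 m n ^ q \<in> hspace (Suc m) n (int (a + 2 * Suc q) - 2)"
    using xvar_power_mult_hspace[OF _ hspace_mono, of "Suc m" m "R2 m n ^ q" n "2 * int q" a]
    by (simp add: algebra_simps)
  have "?t ^ a * R2 m n ^ Suc q = R2 m n * (?t ^ a * R2 m n ^ q)"
    by (simp add: xvar_power_left_commute[of "R2 m n"])
  \<comment> \<open>One factor r is replaced by R^2 - t^2, which trades it for two powers of t;
    hence the exponent \<open>a\<close> varies in the induction.\<close>
  also have "\<dots> = R2 (Suc m) n * (?t ^ a * R2 m n ^ q) - ?t ^ (a + 2) * R2 m n ^ q"
    by (simp add: R2_Suc algebra_simps power2_eq_square)
  also have "\<dots> = (-1) ^ Suc q *\<^sub>R ?t ^ (a + 2 * Suc q) + R2 (Suc m) n * (?t ^ a * R2 m n ^ q - p)"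
    unfolding p(2) by (simp add: algebra_simps)
  finally show ?case
    using p(1) mem by (intro bexI[of _ "?t ^ a * R2 m n ^ q - p"] subspace_diff[OF subspace_hspace]) simp_all
qed

text \<open>
  The eigenvalues of the Casimir operator \<open>casimir_ev m n s - R\<^sup>2 \<Delta>\<close> of \<open>osp(m|2n)\<close> on \<open>\<P>\<^sub>s\<close>, and
  the product of its translates by the first \<open>r\<close> of them, which maps \<open>\<P>\<^sub>s\<close>, \<open>s \<le> r\<close>,
  to the multiples of \<open>R\<^sup>s\<close>.
\<close>

definition casimir_ev :: "nat \<Rightarrow> nat \<Rightarrow> nat \<Rightarrow> real" where
  "casimir_ev m n s = real s * (real s + real m - 2 * real n - 2)"

fun casimir_prod :: "nat \<Rightarrow> nat \<Rightarrow> nat \<Rightarrow> nat \<Rightarrow> superpoly \<Rightarrow> superpoly" where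
  "casimir_prod m n 0 s g = g"
| "casimir_prod m n (Suc r) s g = casimir_prod m n r s
    ((casimir_ev m n s - casimir_ev m n (Suc r)) *\<^sub>R g - R2 m n * laplacian m n g)"

lemma casimir_prod_zero [simp]: "casimir_prod m n r s 0 = 0"
  by (induction r) simp_all

text \<open>Multiplication by R^2 commutes with the Casimir operator: the eigenvalues for s + 2 and
  s differ by 2(2s + m - 2n), exactly the constant in the commutator of Delta and R^2.\<close>

lemma casimir_prod_R2_mult:
  "g \<in> hspace m n (int s) \<Longrightarrow>
    casimir_prod m n r (Suc (Suc s)) (R2 m n * g) = R2 m n * casimir_prod m n r s g"
proof (induction r arbitrary: g)
  case (Suc r)
  let ?h = "(casimir_ev m n s - casimir_ev m n (Suc r)) *\<^sub>R g - R2 m n * laplacian m n g"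
  have "?h \<in> hspace m n (int s)"
    using Suc.prems by (intro subspace_diff subspace_scale subspace_hspace R2_mult_hspace laplacian_hspace)
  moreover have "(casimir_ev m n (Suc (Suc s)) - casimir_ev m n (Suc r)) *\<^sub>R (R2 m n * g) -
      R2 m n * laplacian m n (R2 m n * g) = R2 m n * ?h"
    unfolding laplacian_R2_hspace[OF Suc.prems]
    by (rule superpoly_eqI) (simp add: casimir_ev_def algebra_simps)
  ultimately show ?case using Suc.IH by simp
qed simp

text \<open>In degree s = r + 1 the scalars of the first factor cancel and leave - R^2 Delta. The
  power R^2 moves out, and the remaining r factors act in degree s - 2. This descent tolerates
  coinciding eigenvalues; it ends with a constant for even s and with 0 for odd s.\<close>

lemma casimir_prod_radial:
  "g \<in> hspace m n (int s) \<Longrightarrow> s \<le> r \<Longrightarrow>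
    \<exists>b. casimir_prod m n r s g = b *\<^sub>R R2 m n ^ (s div 2) \<and> (odd s \<longrightarrow> b = 0)"
proof (induction r arbitrary: s g)
  case 0
  then show ?case using hspace_zero_const[of g m n] by auto
next
  case (Suc r)
  let ?h = "(casimir_ev m n s - casimir_ev m n (Suc r)) *\<^sub>R g - R2 m n * laplacian m n g"
  show ?case
  proof (cases "s = Suc r")
    case False
    have "?h \<in> hspace m n (int s)"
      using Suc.prems by (intro subspace_diff subspace_scale subspace_hspace R2_mult_hspace laplacian_hspace)
    then show ?thesis using Suc False by simp
  next
    case True
    show ?thesis
    proof (cases s)
      case 0
      with True show ?thesis by simp
    next
      case (Suc s')
      show ?thesis
      proof (cases s')
        case 0
        have "laplacian m n g = 0"
          by (rule hspace_neg[OF laplacian_hspace[OF Suc.prems(1)]]) (simp add: Suc 0)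
        then show ?thesis using True Suc by (intro exI[of _ 0]) simp
      next
        case (Suc s'')
        have s: "s = Suc (Suc s'')" using \<open>s = Suc s'\<close> Suc by simp
        have mem: "- laplacian m n g \<in> hspace m n (int s'')"
          using subspace_neg[OF subspace_hspace laplacian_hspace[OF Suc.prems(1), of m n]] s by simp
        obtain b where "casimir_prod m n r s'' (- laplacian m n g) = b *\<^sub>R R2 m n ^ (s'' div 2)" "odd s'' \<longrightarrow> b = 0"
          using Suc.IH[OF mem] True s by auto
        moreover have "casimir_prod m n (Suc r) s g = R2 m n * casimir_prod m n r s'' (- laplacian m n g)"
          using casimir_prod_R2_mult[OF mem, of r] True s by simp
        ultimately show ?thesis using s by auto
      qed
    qed
  qed
qed

text \<open>Applied with \<open>V\<close> the line through t^l and with \<open>V\<close> the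
  submodule: computing modulo R^2 becomes membership in a subspace.\<close>

lemma subspace_plus_R2_mult:
  assumes "subspace V"
  shows "subspace {f. \<exists>u \<in> V. \<exists>p \<in> hspace m n k. f = u + R2 m n * p}"
proof -
  have "subspace ((*) (R2 m n) ` hspace m n k)"
    by (intro linear_subspace_image subspace_hspace linearI) (simp_all add: distrib_left)
  from subspace_sums[OF assms this] show ?thesis
    by (rule back_subst[of subspace]) auto
qed

text \<open>On constants the eigenvalue and Delta vanish, so the factors act as minus the
  eigenvalues for 1, ..., r.\<close>

lemma casimir_prod_const_nonzero:
  assumes "\<And>i. 1 \<le> i \<Longrightarrow> i \<le> r \<Longrightarrow> casimir_ev m n i \<noteq> 0" "c \<noteq> 0"
  shows "\<exists>b. casimir_prod m n r 0 (c *\<^sub>R 1) = b *\<^sub>R 1 \<and> b \<noteq> 0"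
  using assms
proof (induction r arbitrary: c)
  case (Suc r)
  have "casimir_ev m n (Suc r) \<noteq> 0" using Suc.prems(1)[of "Suc r"] by simp
  then have "- casimir_ev m n (Suc r) * c \<noteq> 0" using Suc.prems(2) by simp
  from Suc.IH[OF _ this] Suc.prems(1) show ?case
    by (simp add: laplacian_one casimir_ev_def[of _ _ 0])
qed auto


section \<open>Nonzero invariant subspaces of the harmonics\<close>

context
  fixes m n l :: nat and U :: "superpoly set"
  assumes m: "even m" and l: "l + m \<le> 2 * n"
    and U: "subspace U" "U \<subseteq> harmonics (Suc m) n l" "U \<noteq> {0}"
    and osp_U: "\<And>p D f. p \<in> {0, 1} \<Longrightarrow> D \<in> osp (Suc m) n p \<Longrightarrow> f \<in> U \<Longrightarrow> D f \<in> U"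
begin

lemma submodule_hspace: "f \<in> U \<Longrightarrow> f \<in> hspace (Suc m) n (int l)"
  and submodule_superpolys: "f \<in> U \<Longrightarrow> f \<in> superpolys (Suc m) n"
  and submodule_laplacian: "f \<in> U \<Longrightarrow> laplacian (Suc m) n f = 0"
  using U(2) by (auto simp: harmonics_eq hspace_superpolys)

lemma submodule_rot_x: "f \<in> U \<Longrightarrow> i \<in> {1..m} \<Longrightarrow> rot_x m i f \<in> U"
  using osp_U[OF _ rot_x_osp[of i m n], of f] submodule_superpolys[of f] by simp

lemma submodule_rot_theta: "f \<in> U \<Longrightarrow> q \<in> {1..2 * n} \<Longrightarrow> rot_theta m q f \<in> U"
  using osp_U[OF _ rot_theta_osp[of q n m], of f] submodule_superpolys[of f] by simp

lemma submodule_casimir_diff: "f \<in> U \<Longrightarrow> casimir_diff m n f \<in> U"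
  unfolding casimir_diff_def
  by (intro subspace_add subspace_sum subspace_scale subspace_diff U(1) submodule_rot_x submodule_rot_theta) auto

lemma submodule_tcoeff: "f \<in> U \<Longrightarrow> s \<le> l \<Longrightarrow> tcoeff (Suc m) (l - s) f \<in> hspace m n (int s)"
  using tcoeff_hspace[OF submodule_hspace, of f "l - s"] by (simp add: of_nat_diff)

lemma submodule_tcoeff_rec:
  "f \<in> U \<Longrightarrow> (real (Suc j) * real (Suc (Suc j))) *\<^sub>R tcoeff (Suc m) (Suc (Suc j)) f =
    - laplacian m n (tcoeff (Suc m) j f)"
  using tcoeff_laplacian_Suc[of m j n f] submodule_laplacian[of f] by (simp add: eq_neg_iff_add_eq_0)

text \<open>Harmonicity expresses the neighbouring coefficients j + 2 and j - 2 through the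
  coefficient j = l - s. What remains is the small Casimir operator in degree s minus the scalar
  \<open>casimir_ev (Suc m) n l\<close>, the eigenvalue of the large one.\<close>

lemma tcoeff_casimir_diff_harmonic:
  assumes f: "f \<in> U" and s: "s \<le> l"
  shows "tcoeff (Suc m) (l - s) (casimir_diff m n f) =
    (casimir_ev m n s - real l * (real l + real m - 2 * real n - 1)) *\<^sub>R tcoeff (Suc m) (l - s) f -
    R2 m n * laplacian m n (tcoeff (Suc m) (l - s) f)"
proof -
  define j where "j = l - s"
  have ls: "real l = real j + real s" using s by (simp add: j_def)
  let ?c = "tcoeff (Suc m) j f"
  have "(if j < 2 then 0 else laplacian m n (tcoeff (Suc m) (j - 2) f)) = - (real j * (real j - 1)) *\<^sub>R ?c"
  proof -
    consider "j = 0" | "j = 1" | i where "j = Suc (Suc i)" by (metis One_nat_def not0_implies_Suc)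
    then show ?thesis
    proof cases
      case (3 i)
      then show ?thesis
        using submodule_tcoeff_rec[OF f, of i] by (simp add: algebra_simps eq_neg_iff_add_eq_0)
    qed simp_all
  qed
  moreover have "(real (Suc j) * real (Suc (Suc j))) *\<^sub>R (R2 m n * tcoeff (Suc m) (Suc (Suc j)) f) =
      - (R2 m n * laplacian m n ?c)"
    using arg_cong[OF submodule_tcoeff_rec[OF f, of j], of "\<lambda>h. R2 m n * h"] by simp
  moreover have "euler m n ?c = real s *\<^sub>R ?c"
    using euler_hspace[OF submodule_tcoeff[OF f s]] by (simp add: j_def)
  ultimately show ?thesis
    unfolding j_def[symmetric] tcoeff_casimir_diff[OF submodule_superpolys[OF f]] ls casimir_ev_def
    by (simp only:, intro superpoly_eqI) (simp add: algebra_simps)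
qed

lemma submodule_casimir_prod:
  "f \<in> U \<Longrightarrow> \<exists>f' \<in> U. \<forall>s\<le>l. tcoeff (Suc m) (l - s) f' = casimir_prod m n r s (tcoeff (Suc m) (l - s) f)"
proof (induction r arbitrary: f)
  case (Suc r)
  \<comment> \<open>The added multiple of \<open>f\<close> removes the eigenvalue of the large
    Casimir operator and shifts by that of degree r + 1. It is independent of s, so one element
    serves all t-degrees at once.\<close>
  let ?f = "casimir_diff m n f + (real l * (real l + real m - 2 * real n - 1) - casimir_ev m n (Suc r)) *\<^sub>R f"
  have "?f \<in> U"
    using Suc.prems U(1) by (intro subspace_add subspace_scale submodule_casimir_diff)
  then obtain f' where "f' \<in> U"
      "\<forall>s\<le>l. tcoeff (Suc m) (l - s) f' = casimir_prod m n r s (tcoeff (Suc m) (l - s) ?f)"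
    using Suc.IH by blast
  moreover have "tcoeff (Suc m) (l - s) ?f = (casimir_ev m n s - casimir_ev m n (Suc r)) *\<^sub>R tcoeff (Suc m) (l - s) f -
      R2 m n * laplacian m n (tcoeff (Suc m) (l - s) f)" if "s \<le> l" for s
    by (simp add: tcoeff_casimir_diff_harmonic[OF Suc.prems that] algebra_simps)
  ultimately show ?case by (intro bexI[of _ f']) simp_all
qed auto

text \<open>Coefficient j + 1 of a rotated f is a multiple of the coordinate times c_(j+2), minus a
  multiple of a derivative of c_j. If all coefficients above j vanish throughout \<open>U\<close>,
  then all derivatives of c_j vanish, and Euler's identity in degree l - j > 0 gives c_j =
  0.\<close>

lemma submodule_top_coeff: "\<exists>f \<in> U. tcoeff (Suc m) l f \<noteq> 0"
proof (rule ccontr)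
  assume "\<not> ?thesis"
  then have top: "tcoeff (Suc m) l f = 0" if "f \<in> U" for f using that by blast
  have step: "tcoeff (Suc m) (l - s) f = 0" if "s \<le> l" "f \<in> U" for s f
    using that
  proof (induction s arbitrary: f rule: less_induct)
    case (less s)
    show ?case
    proof (cases s)
      case 0
      then show ?thesis using top[OF less.prems(2)] by simp
    next
      case (Suc s')
      define j where "j = l - s"
      have j: "l - s' = Suc j" using Suc less.prems by (simp add: j_def)
      have IH: "tcoeff (Suc m) (Suc j) g = 0" if "g \<in> U" for g
        using less.IH[of s' g] that Suc less.prems j by simp
      have "tcoeff (Suc m) (Suc (Suc j)) f = 0"
      proof (cases s')
        case 0
        then have "Suc (Suc j) = Suc l" using j by simp
        then show ?thesis
          using hspace_neg[OF tcoeff_hspace[OF submodule_hspace[OF less.prems(2)], of "Suc l"]] by simp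
      next
        case (Suc s'')
        then have "Suc (Suc j) = l - s''" using j less.prems \<open>s = Suc s'\<close> by simp
        then show ?thesis
          using less.IH[of s'' f] Suc \<open>s = Suc s'\<close> less.prems by simp
      qed
      then have "dx i (tcoeff (Suc m) j f) = 0" if "i \<in> {1..m}" for i
        using IH[OF submodule_rot_x[OF less.prems(2) that]] by (simp add: tcoeff_rot_x[OF that])
      moreover have "dtheta q (tcoeff (Suc m) j f) = 0" if "q \<in> {1..2 * n}" for q
      proof -
        have "rot_theta m (tconj q) f \<in> U"
          using submodule_rot_theta[OF less.prems(2) tconj_mem[OF that]] .
        from IH[OF this] \<open>tcoeff (Suc m) (Suc (Suc j)) f = 0\<close> show ?thesis
          by (simp add: tcoeff_rot_theta tconj_tconj[OF that] tsgn_def split: if_splits)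
      qed
      ultimately have "euler m n (tcoeff (Suc m) j f) = 0"
        by (simp add: euler_def)
      then show ?thesis
        using euler_hspace[OF submodule_tcoeff[OF less.prems(2,1)]] Suc by (simp add: j_def)
    qed
  qed
  have "f = 0" if "f \<in> U" for f
  proof (rule tcoeff_ext[of "Suc m"])
    fix j
    show "tcoeff (Suc m) j f = tcoeff (Suc m) j 0"
    proof (cases "j \<le> l")
      case True
      then show ?thesis using step[of "l - j" f] that by simp
    next
      case False
      then show ?thesis
        using hspace_neg[OF tcoeff_hspace[OF submodule_hspace[OF that], of j]] by simp
    qed
  qed
  with U(1,3) show False
    using subspace_0 by blast
qed

text \<open>This is where the bound on l enters: i <= l <= 2n - m makes the second factor at most
  -2.\<close>

lemma casimir_ev_nonzero: "1 \<le> i \<Longrightarrow> i \<le> l \<Longrightarrow> casimir_ev m n i \<noteq> 0"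
proof -
  assume i: "1 \<le> i" "i \<le> l"
  then have "real i + real m - 2 * real n - 2 < 0" using l by linarith
  with i show ?thesis by (simp add: casimir_ev_def)
qed

text \<open>The Casimir product makes all t-coefficients of an element radial, and modulo R^2 every
  t^j r^q of total degree l is plus or minus t^l. This expresses a nonzero element of
  \<open>U\<close> as c t^l + R^2 p.\<close>

lemma submodule_power_mod_R2:
  "\<exists>f \<in> U. \<exists>p \<in> hspace (Suc m) n (int l - 2). xvar (Suc m) ^ l = f + R2 (Suc m) n * p"
proof -
  let ?t = "xvar (Suc m)" and ?R = "R2 (Suc m) n"
  define W where "W = {f. \<exists>u \<in> span {?t ^ l}. \<exists>p \<in> hspace (Suc m) n (int l - 2). f = u + ?R * p}"
  have W: "subspace W"
    unfolding W_def by (rule subspace_plus_R2_mult[OF subspace_span])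
  obtain f where f: "f \<in> U" "tcoeff (Suc m) l f \<noteq> 0"
    using submodule_top_coeff by blast
  obtain Y where Y: "Y \<in> U" "\<And>s. s \<le> l \<Longrightarrow> tcoeff (Suc m) (l - s) Y = casimir_prod m n l s (tcoeff (Suc m) (l - s) f)"
    using submodule_casimir_prod[OF f(1), of l] by blast
  \<comment> \<open>The coefficient of t^l is a constant, on which the Casimir product acts by a
    nonzero scalar.\<close>
  have "Y \<noteq> 0"
  proof -
    obtain c where c: "tcoeff (Suc m) l f = c *\<^sub>R 1"
      using submodule_tcoeff[OF f(1), of 0] hspace_zero_const[of "tcoeff (Suc m) l f" m n] by auto
    with f(2) have "c \<noteq> 0" by auto
    from casimir_prod_const_nonzero[OF casimir_ev_nonzero this] obtain b where
      "casimir_prod m n l 0 (c *\<^sub>R 1) = b *\<^sub>R 1" "b \<noteq> 0" by blast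
    with Y(2)[of 0] c have "tcoeff (Suc m) l Y = b *\<^sub>R 1" by simp
    with \<open>b \<noteq> 0\<close> show ?thesis by (metis tcoeff_simps(1) scaleR_eq_0_iff zero_neq_one)
  qed
  have "Y \<in> W"
  proof -
    have "?t ^ j * tcoeff (Suc m) j Y \<in> W" for j
    proof (cases "j \<le> l")
      case True
      define s where "s = l - j"
      have s: "s \<le> l" "j = l - s" using True by (simp_all add: s_def)
      obtain b where b: "tcoeff (Suc m) j Y = b *\<^sub>R R2 m n ^ (s div 2)" "odd s \<longrightarrow> b = 0"
        using casimir_prod_radial[OF submodule_tcoeff[OF f(1) s(1)] s(1)] Y(2)[OF s(1)] s(2) by auto
      show ?thesis
      proof (cases "odd s")
        case True
        then show ?thesis using b subspace_0[OF W] by simp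
      next
        case False
        then have eq: "j + 2 * (s div 2) = l" using s by simp
        from power_radial_mod_R2[of m n j "s div 2"] obtain p where
          p: "p \<in> hspace (Suc m) n (int l - 2)"
            "?t ^ j * R2 m n ^ (s div 2) = (-1) ^ (s div 2) *\<^sub>R ?t ^ l + ?R * p"
          unfolding eq by blast
        moreover have "(-1) ^ (s div 2) *\<^sub>R ?t ^ l \<in> span {?t ^ l}"
          by (simp add: span_scale span_base)
        ultimately have "?t ^ j * R2 m n ^ (s div 2) \<in> W" unfolding W_def by blast
        from subspace_scale[OF W this, of b] b show ?thesis by simp
      qed
    next
      case False
      then have "tcoeff (Suc m) j Y = 0"
        using hspace_neg[OF tcoeff_hspace[OF submodule_hspace[OF Y(1)], of j]] by simp
      then show ?thesis using subspace_0[OF W] by simp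
    qed
    then show ?thesis
      by (subst tcoeff_expand[OF submodule_superpolys[OF Y(1)]]) (intro subspace_sum[OF W])
  qed
  then obtain c p where p: "p \<in> hspace (Suc m) n (int l - 2)" "Y = c *\<^sub>R ?t ^ l + ?R * p"
    by (auto simp: W_def span_singleton)
  \<comment> \<open>For c = 0 the harmonic element \<open>Y\<close> would be a multiple of R^2, and
    Fischer uniqueness would give Y = 0.\<close>
  have "c \<noteq> 0"
  proof
    assume "c = 0"
    then have "laplacian (Suc m) n (?R * p) = 0"
      using p(2) submodule_laplacian[OF Y(1)] by simp
    then have "p = 0"
      using fischer_unique[OF _ p(1)] m by simp
    with p(2) \<open>c = 0\<close> \<open>Y \<noteq> 0\<close> show False by simp
  qed
  then have "?t ^ l = (1 / c) *\<^sub>R Y + ?R * (- (1 / c) *\<^sub>R p)"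
    unfolding p(2) by (simp add: algebra_simps)
  moreover have "(1 / c) *\<^sub>R Y \<in> U" "- (1 / c) *\<^sub>R p \<in> hspace (Suc m) n (int l - 2)"
    by (rule subspace_scale[OF U(1) Y(1)], rule subspace_scale[OF subspace_hspace p(1)])
  ultimately show ?thesis by blast
qed

text \<open>
  The submodule \<open>U + R\<^sup>2 \<P>\<^bsub>l-2\<^esub>\<close> contains \<open>t\<^sup>l\<close>, and the rotations lower the degree in \<open>t\<close>.
\<close>

lemma submodule_eq_harmonics: "U = harmonics (Suc m) n l"
proof -
  let ?t = "xvar (Suc m)" and ?R = "R2 (Suc m) n"
  define W where "W = {f. \<exists>u \<in> U. \<exists>p \<in> hspace (Suc m) n (int l - 2). f = u + ?R * p}"
  have W: "subspace W"
    unfolding W_def by (rule subspace_plus_R2_mult[OF U(1)])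
  have W_osp: "D f \<in> W" if p: "p \<in> {0, 1}" and D: "D \<in> osp (Suc m) n p" and f: "f \<in> W" for p D f
  proof -
    obtain u p where *: "u \<in> U" "p \<in> hspace (Suc m) n (int l - 2)" "f = u + ?R * p"
      using f by (auto simp: W_def)
    then have "D f = D u + ?R * D p"
      by (simp add: sder_add[OF osp_sder[OF D]] submodule_superpolys R2_mult_superpolys hspace_superpolys[OF *(2)]
          osp_R2_mult[OF D])
    then show ?thesis
      unfolding W_def using osp_U[OF p D *(1)] osp_hspace[OF D *(2)] by blast
  qed
  have W_superpolys: "f \<in> superpolys (Suc m) n" if "f \<in> W" for f
    using that submodule_superpolys hspace_superpolys[of _ "Suc m" n "int l - 2"]
    by (auto simp: W_def intro!: subspace_add[OF subspace_superpolys] R2_mult_superpolys)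
  have W_rot_x: "rot_x m i f \<in> W" if "f \<in> W" "i \<in> {1..m}" for f i
    using W_osp[OF _ rot_x_osp[OF that(2)] that(1)] W_superpolys[OF that(1)] by simp
  have W_rot_theta: "rot_theta m q f \<in> W" if "f \<in> W" "q \<in> {1..2 * n}" for f q
    using W_osp[OF _ rot_theta_osp[OF that(2)] that(1)] W_superpolys[OF that(1)] by simp
  have top: "?t ^ l \<in> W"
    using submodule_power_mod_R2 by (auto simp: W_def)
  have gen: "?t ^ (l - s) * g \<in> W" if "s \<le> l" "g \<in> hspace m n (int s)" for s g
    using that
  proof (induction s arbitrary: g rule: less_induct)
    case (less s)
    show ?case
    proof (cases s)
      case 0
      then obtain c where "g = c *\<^sub>R 1"
        using less.prems(2) hspace_zero_const[of g m n] by auto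
      then show ?thesis using subspace_scale[OF W top, of c] 0 by simp
    next
      case (Suc s')
      have ls: "l - s' = Suc (l - s)" using Suc less.prems by simp
      \<comment> \<open>Rotating t^(l-s') h gives the wanted product of a coordinate with t^(l-s) h,
        up to a factor, and a term one t-degree above t^(l-s') with a derivative of h. The latter
        lies in \<open>W\<close> by induction, or is 0 for constant h.\<close>
      have low: "?t ^ Suc (l - s') * h \<in> W" if "h \<in> hspace m n (int s' - 1)" for h
      proof (cases s')
        case 0
        then have "h = 0" using hspace_neg[OF that] by simp
        then show ?thesis using subspace_0[OF W] by simp
      next
        case (Suc s'')
        then have "Suc (l - s') = l - s''" using \<open>s = Suc s'\<close> less.prems by simp
        then show ?thesis
          using less.IH[of s'' h] that Suc \<open>s = Suc s'\<close> less.prems by simp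
      qed
      have mem: "?t ^ (l - s') * h \<in> W" if "h \<in> hspace m n (int s')" for h
        using less.IH[of s' h] that Suc less.prems by simp
      have x: "?t ^ (l - s) * (xvar i * h) \<in> W" if i: "i \<in> {1..m}" and h: "h \<in> hspace m n (int s')" for i h
      proof -
        have "rot_x m i (?t ^ (l - s') * h) + ?t ^ Suc (l - s') * dx i h \<in> W"
          using W_rot_x[OF mem[OF h] i] low[OF dx_hspace[OF h]] by (rule subspace_add[OF W])
        then have "real (l - s') *\<^sub>R (?t ^ (l - s) * (xvar i * h)) \<in> W"
          using rot_x_power_mult[OF i hspace_superpolys[OF h], of "l - s'"] ls by simp
        from subspace_scale[OF W this, of "1 / real (l - s')"] ls show ?thesis by simp
      qed
      have th: "?t ^ (l - s) * (thetavar q * h) \<in> W" if q: "q \<in> {1..2 * n}" and h: "h \<in> hspace m n (int s')" for q h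
      proof -
        have "rot_theta m q (?t ^ (l - s') * h) + (2 * tsgn q) *\<^sub>R (?t ^ Suc (l - s') * dtheta (tconj q) h) \<in> W"
          using W_rot_theta[OF mem[OF h] q] subspace_scale[OF W low[OF dtheta_hspace[OF h]]]
          by (rule subspace_add[OF W])
        then have "real (l - s') *\<^sub>R (?t ^ (l - s) * (thetavar q * h)) \<in> W"
          using rot_theta_power_mult[OF hspace_superpolys[OF h], of q "l - s'"] ls by simp
        from subspace_scale[OF W this, of "1 / real (l - s')"] ls show ?thesis by simp
      qed
      have d: "dx i g \<in> hspace m n (int s')" "dtheta i g \<in> hspace m n (int s')" for i
        using dx_hspace[OF less.prems(2)] dtheta_hspace[OF less.prems(2)] Suc by simp_all
      \<comment> \<open>Euler's identity recovers g from products of coordinates with polynomials of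
        degree s - 1; dividing by s > 0 finishes the step.\<close>
      have "?t ^ (l - s) * euler m n g \<in> W"
        unfolding euler_def distrib_left sum_distrib_left
        by (intro subspace_add[OF W] subspace_sum[OF W] x th d) auto
      then have "real s *\<^sub>R (?t ^ (l - s) * g) \<in> W"
        using euler_hspace[OF less.prems(2)] by simp
      from subspace_scale[OF W this, of "1 / real s"] Suc show ?thesis by simp
    qed
  qed
  have all: "f \<in> W" if f: "f \<in> hspace (Suc m) n (int l)" for f
  proof -
    have "?t ^ j * tcoeff (Suc m) j f \<in> W" for j
    proof (cases "j \<le> l")
      case True
      then show ?thesis
        using gen[of "l - j" "tcoeff (Suc m) j f"] tcoeff_hspace[OF f, of j] by (simp add: of_nat_diff)
    next
      case False
      then have "tcoeff (Suc m) j f = 0"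
        using hspace_neg[OF tcoeff_hspace[OF f, of j]] by simp
      then show ?thesis using subspace_0[OF W] by simp
    qed
    then show ?thesis
      by (subst tcoeff_expand[OF hspace_superpolys[OF f]]) (intro subspace_sum[OF W])
  qed
  have "h \<in> U" if h: "h \<in> harmonics (Suc m) n l" for h
  proof -
    obtain u p where up: "u \<in> U" "p \<in> hspace (Suc m) n (int l - 2)" "h = u + ?R * p"
      using all[OF harmonics_hspace[OF h]] by (auto simp: W_def)
    have "laplacian (Suc m) n (?R * p) = 0"
      using harmonics_laplacian[OF h] submodule_laplacian[OF up(1)] up(3) by simp
    then have "p = 0"
      using fischer_unique[OF _ up(2)] m by simp
    with up show ?thesis by simp
  qed
  with U(2) show ?thesis by blast
qed

end

text \<open>It is enough to prescribe nonzero Cauchy data: theta_1 ... theta_l is nonzero because l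
  <= 2n.\<close>

lemma harmonics_nonzero:
  assumes "l + m \<le> 2 * n" shows "harmonics (Suc m) n l \<noteq> {0}"
proof -
  have "smonom 0 {1..l} \<in> hspace m n (int l)"
    using smonom_in_hspace[of 0 m "{1..l}" n] assms by simp
  moreover have "0 \<in> hspace m n (int l - 1)" "0 \<in> hspace (Suc m) n (int l - 2)"
    by (rule subspace_0[OF subspace_hspace])+
  ultimately obtain f where f: "f \<in> hspace (Suc m) n (int l)" "tcoeff (Suc m) 0 f = smonom 0 {1..l}"
      "laplacian (Suc m) n f = 0"
    by (rule laplacian_cauchy_exists)
  have "scoeff (smonom 0 {1..l}) 0 {1..l} \<noteq> 0"
    by (simp add: scoeff_smonom)
  then have "smonom 0 {1..l} \<noteq> 0" by auto
  with f have "f \<noteq> 0" "f \<in> harmonics (Suc m) n l" by (auto simp: harmonics_eq)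
  then show ?thesis by blast
qed

theorem harmonics_irreducible:
  assumes "even m" "l + m \<le> 2 * n"
  shows "osp_irreducible (Suc m) n (harmonics_module (Suc m) n l)"
  unfolding osp_irreducible_def
proof (intro conjI allI impI osp_module_harmonics)
  show "mspace (harmonics_module (Suc m) n l) \<noteq> {0}"
    using harmonics_nonzero[OF assms(2)] by (simp add: harmonics_module_def)
  fix U
  assume U: "graded_subspace (harmonics_module (Suc m) n l) U \<and>
    (\<forall>p\<in>{0, 1}. \<forall>D\<in>osp (Suc m) n p. mact (harmonics_module (Suc m) n l) D ` U \<subseteq> U)"
  show "U = {0} \<or> U = mspace (harmonics_module (Suc m) n l)"
  proof (cases "U = {0}")
    case False
    have "U = harmonics (Suc m) n l"
    proof (rule submodule_eq_harmonics[OF assms _ _ False])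
      show "D f \<in> U" if "p \<in> {0, 1}" "D \<in> osp (Suc m) n p" "f \<in> U" for p D f
        using conjunct2[OF U] that unfolding harmonics_module_def smodule.simps by blast
    qed (use U in \<open>simp_all add: graded_subspace_def harmonics_module_def\<close>)
    then show ?thesis by (simp add: harmonics_module_def)
  qed simp
qed

section \<open>Modules\<close>

lemma linear_onD:
  assumes "linear_on S f"
  shows "v \<in> S \<Longrightarrow> w \<in> S \<Longrightarrow> f (v + w) = f v + f w" "v \<in> S \<Longrightarrow> f (c *\<^sub>R v) = c *\<^sub>R f v"
  using assms by (auto simp: linear_on_def)

lemma linear_on_zero: "linear_on S f \<Longrightarrow> 0 \<in> S \<Longrightarrow> f 0 = 0"
  using linear_onD(2)[of S f 0 0] by simp

lemma linear_on_diff: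
  assumes "linear_on S f" "subspace S" "v \<in> S" "w \<in> S"
  shows "f (v - w) = f v - f w"
  using linear_onD(1)[OF assms(1) subspace_diff[OF assms(2-4)] assms(4)] by simp

lemma linear_on_inj_onI:
  assumes "linear_on S f" "subspace S" "\<And>v. v \<in> S \<Longrightarrow> f v = 0 \<Longrightarrow> v = 0"
  shows "inj_on f S"
proof (rule inj_onI)
  fix v w assume *: "v \<in> S" "w \<in> S" "f v = f w"
  have "f (v - w) = 0"
    using linear_on_diff[OF assms(1,2) *(1,2)] *(3) by simp
  from assms(3)[OF subspace_diff[OF assms(2) *(1,2)] this] show "v = w"
    by simp
qed

context
  fixes m n :: nat and V :: "'v::real_vector smodule"
  assumes V: "osp_module m n V"
begin

lemma osp_module_subspace: "subspace (mspace V)"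
  using V by (simp add: osp_module_def graded_subspace_def)

lemma osp_module_part: "p \<in> {0, 1} \<Longrightarrow> subspace (mpart V p) \<and> mpart V p \<subseteq> mspace V"
  by (rule V[unfolded osp_module_def, THEN conjunct1, THEN bspec])

lemma osp_module_parts_disjoint: "mpart V 0 \<inter> mpart V 1 = {0}"
  by (rule V[unfolded osp_module_def, THEN conjunct2, THEN conjunct1])

lemma osp_module_decomp:
  assumes "v \<in> mspace V" obtains v0 v1 where "v0 \<in> mpart V 0" "v1 \<in> mpart V 1" "v = v0 + v1"
proof -
  have "graded_subspace V (mspace V)"
    by (rule V[unfolded osp_module_def, THEN conjunct2, THEN conjunct2, THEN conjunct1])
  then have "\<forall>u \<in> mspace V. \<exists>v0 \<in> mspace V \<inter> mpart V 0. \<exists>v1 \<in> mspace V \<inter> mpart V 1. u = v0 + v1"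
    unfolding graded_subspace_def by (elim conjE)
  from bspec[OF this assms] obtain v0 v1 where v: "v0 \<in> mpart V 0" "v1 \<in> mpart V 1" "v = v0 + v1"
    by (elim bexE IntE) (rule that)
  then show ?thesis by (rule that)
qed

lemma osp_module_linear: "p \<in> {0, 1} \<Longrightarrow> D \<in> osp m n p \<Longrightarrow> linear_on (mspace V) (mact V D)"
  by (rule V[unfolded osp_module_def, THEN conjunct2, THEN conjunct2, THEN conjunct2, THEN conjunct1, rule_format, THEN conjunct1])

lemma osp_module_act_part:
  assumes "p \<in> {0, 1}" "q \<in> {0, 1}" "D \<in> osp m n p" "v \<in> mpart V q"
  shows "mact V D v \<in> mpart V ((p + q) mod 2)"
proof -
  have "mact V D ` mpart V q \<subseteq> mpart V ((p + q) mod 2)"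
    using V[unfolded osp_module_def, THEN conjunct2, THEN conjunct2, THEN conjunct2, THEN conjunct1,
        THEN bspec, OF assms(1), THEN bspec, OF assms(3), THEN conjunct2, THEN bspec, OF assms(2)] .
  with assms(4) show ?thesis by blast
qed

lemma osp_module_lincomb:
  "p \<in> {0, 1} \<Longrightarrow> D \<in> osp m n p \<Longrightarrow> E \<in> osp m n p \<Longrightarrow> v \<in> mspace V \<Longrightarrow>
    mact V (lincomb m n a D b E) v = a *\<^sub>R mact V D v + b *\<^sub>R mact V E v"
  by (rule V[unfolded osp_module_def, THEN conjunct2, THEN conjunct2, THEN conjunct2, THEN conjunct2, THEN conjunct1, rule_format])

lemma osp_module_superbracket:
  "p \<in> {0, 1} \<Longrightarrow> q \<in> {0, 1} \<Longrightarrow> D \<in> osp m n p \<Longrightarrow> E \<in> osp m n q \<Longrightarrow> v \<in> mspace V \<Longrightarrow>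
    mact V (superbracket m n p q D E) v = mact V D (mact V E v) - (-1) ^ (p * q) *\<^sub>R mact V E (mact V D v)"
  by (rule V[unfolded osp_module_def, THEN conjunct2, THEN conjunct2, THEN conjunct2, THEN conjunct2, THEN conjunct2, rule_format])

lemma osp_module_act_mem:
  assumes "p \<in> {0, 1}" "D \<in> osp m n p" "v \<in> mspace V"
  shows "mact V D v \<in> mspace V"
proof -
  obtain v0 v1 where v: "v0 \<in> mpart V 0" "v1 \<in> mpart V 1" "v = v0 + v1"
    using osp_module_decomp[OF assms(3)] .
  have sub: "mpart V (r mod 2) \<subseteq> mspace V" for r
    by (intro conjunct2[OF osp_module_part]) auto
  have "v0 \<in> mspace V" "v1 \<in> mspace V"
    using v(1,2) sub[of 0] sub[of 1] by auto
  then have eq: "mact V D v = mact V D v0 + mact V D v1"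
    unfolding v(3) by (rule linear_onD(1)[OF osp_module_linear[OF assms(1,2)]])
  have "mact V D v0 \<in> mspace V"
    by (rule subsetD[OF sub osp_module_act_part[OF assms(1) _ assms(2) v(1)]]) simp
  moreover have "mact V D v1 \<in> mspace V"
    by (rule subsetD[OF sub osp_module_act_part[OF assms(1) _ assms(2) v(2)]]) simp
  ultimately show ?thesis
    unfolding eq by (rule subspace_add[OF osp_module_subspace])
qed

end

lemma osp_module_dsum:
  assumes V: "osp_module m n V" and W: "osp_module m n W"
  shows "osp_module m n (V \<oplus>\<^sub>s W)"
  unfolding osp_module_def dsum_def smodule.simps
proof (intro conjI ballI allI)
  fix p :: nat assume p: "p \<in> {0, 1}"
  show "subspace (mpart V p \<times> mpart W p)"
    using osp_module_part[OF V p] osp_module_part[OF W p] by (simp add: subspace_Times)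
  show "mpart V p \<times> mpart W p \<subseteq> mspace V \<times> mspace W"
    using osp_module_part[OF V p] osp_module_part[OF W p] by auto
next
  show "mpart V 0 \<times> mpart W 0 \<inter> mpart V 1 \<times> mpart W 1 = {0}"
    using osp_module_parts_disjoint[OF V] osp_module_parts_disjoint[OF W] by (auto simp: zero_prod_def)
next
  show "graded_subspace \<lparr>mspace = mspace V \<times> mspace W, mpart = \<lambda>p. mpart V p \<times> mpart W p,
      mact = \<lambda>D (v, w). (mact V D v, mact W D w)\<rparr> (mspace V \<times> mspace W)"
    unfolding graded_subspace_def smodule.simps
  proof (intro conjI ballI order_refl)
    show "subspace (mspace V \<times> mspace W)"
      using osp_module_subspace[OF V] osp_module_subspace[OF W] by (rule subspace_Times)
    fix u assume "u \<in> mspace V \<times> mspace W"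
    then obtain v w where u: "u = (v, w)" "v \<in> mspace V" "w \<in> mspace W" by auto
    obtain v0 v1 where v: "v0 \<in> mpart V 0" "v1 \<in> mpart V 1" "v = v0 + v1"
      using osp_module_decomp[OF V u(2)] .
    obtain w0 w1 where w: "w0 \<in> mpart W 0" "w1 \<in> mpart W 1" "w = w0 + w1"
      using osp_module_decomp[OF W u(3)] .
    show "\<exists>u0\<in>mspace V \<times> mspace W \<inter> mpart V 0 \<times> mpart W 0.
        \<exists>u1\<in>mspace V \<times> mspace W \<inter> mpart V 1 \<times> mpart W 1. u = u0 + u1"
      using v w osp_module_part[OF V, of 0] osp_module_part[OF V, of 1]
        osp_module_part[OF W, of 0] osp_module_part[OF W, of 1]
      by (intro bexI[of _ "(v0, w0)"] bexI[of _ "(v1, w1)"]) (auto simp: u(1))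
  qed
next
  fix p q :: nat and D assume p: "p \<in> {0, 1}" and D: "D \<in> osp m n p"
  show "linear_on (mspace V \<times> mspace W) (\<lambda>(v, w). (mact V D v, mact W D w))"
    using osp_module_linear[OF V p D] osp_module_linear[OF W p D] by (auto simp: linear_on_def)
  assume q: "q \<in> {0, 1}"
  show "(\<lambda>(v, w). (mact V D v, mact W D w)) ` (mpart V q \<times> mpart W q) \<subseteq>
      mpart V ((p + q) mod 2) \<times> mpart W ((p + q) mod 2)"
    using osp_module_act_part[OF V p q D] osp_module_act_part[OF W p q D] by auto
next
  fix p D E a b and v :: "'a \<times> 'b"
  assume p: "p \<in> {0, 1}" and D: "D \<in> osp m n p" "E \<in> osp m n p" and v: "v \<in> mspace V \<times> mspace W"
  obtain x y where xy: "v = (x, y)" "x \<in> mspace V" "y \<in> mspace W" using v by blast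
  show "(case v of (v, w) \<Rightarrow> (mact V (lincomb m n a D b E) v, mact W (lincomb m n a D b E) w)) =
      a *\<^sub>R (case v of (v, w) \<Rightarrow> (mact V D v, mact W D w)) + b *\<^sub>R (case v of (v, w) \<Rightarrow> (mact V E v, mact W E w))"
    unfolding xy(1) by (simp add: osp_module_lincomb[OF V p D xy(2)] osp_module_lincomb[OF W p D xy(3)])
next
  fix p q D E and v :: "'a \<times> 'b"
  assume p: "p \<in> {0, 1}" "q \<in> {0, 1}" and D: "D \<in> osp m n p" "E \<in> osp m n q" and v: "v \<in> mspace V \<times> mspace W"
  obtain x y where xy: "v = (x, y)" "x \<in> mspace V" "y \<in> mspace W" using v by blast
  show "(case v of (v, w) \<Rightarrow> (mact V (superbracket m n p q D E) v, mact W (superbracket m n p q D E) w)) =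
      (case case v of (v, w) \<Rightarrow> (mact V E v, mact W E w) of (v, w) \<Rightarrow> (mact V D v, mact W D w)) -
      (-1) ^ (p * q) *\<^sub>R (case case v of (v, w) \<Rightarrow> (mact V D v, mact W D w) of (v, w) \<Rightarrow> (mact V E v, mact W E w))"
    unfolding xy(1) by (simp add: osp_module_superbracket[OF V p D xy(2)] osp_module_superbracket[OF W p D xy(3)])
qed

lemma osp_module_dsum_family:
  assumes V: "\<And>i. i \<in> I \<Longrightarrow> osp_module m n (V i)"
  shows "osp_module m n (dsum_family I V)"
proof -
  let ?fam = "\<lambda>S. {v. Poly_Mapping.keys v \<subseteq> I \<and> (\<forall>i\<in>I. Poly_Mapping.lookup v i \<in> S i)}"
  let ?act = "\<lambda>D. Poly_Mapping.mapp (\<lambda>i. mact (V i) D)"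
  have sub: "subspace (?fam S)" if "\<And>i. i \<in> I \<Longrightarrow> subspace (S i)" for S :: "'a \<Rightarrow> 'b set"
  proof (rule subspaceI)
    fix v w assume "v \<in> ?fam S" "w \<in> ?fam S"
    then show "v + w \<in> ?fam S"
      using that Poly_Mapping.keys_add[of v w] by (auto simp: lookup_add subspace_add)
  next
    fix c v assume v: "v \<in> ?fam S"
    moreover have "Poly_Mapping.keys (c *\<^sub>R v) \<subseteq> Poly_Mapping.keys v"
      by (auto simp: in_keys_iff)
    ultimately show "c *\<^sub>R v \<in> ?fam S"
      using that by (auto simp: subspace_scale)
  qed (use that in \<open>auto simp: subspace_0\<close>)
  have mem: "v \<in> ?fam S \<Longrightarrow> i \<in> I \<Longrightarrow> Poly_Mapping.lookup v i \<in> S i" for v S i by blast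
  have eqI: "v = w" if "Poly_Mapping.keys v \<subseteq> I" "Poly_Mapping.keys w \<subseteq> I"
    "\<And>i. i \<in> I \<Longrightarrow> Poly_Mapping.lookup v i = Poly_Mapping.lookup w i" for v w :: "'a \<Rightarrow>\<^sub>0 'b"
    using that by (intro poly_mapping_eqI) (metis in_keys_iff subsetD)
  have keys: "Poly_Mapping.keys (?act D v) \<subseteq> I" if "Poly_Mapping.keys v \<subseteq> I" for D v
    using keys_mapp_subset that by (rule order_trans)
  \<comment> \<open>\<open>mapp\<close> applies its function on the keys and is 0 elsewhere, so the
    pointwise formula uses that the action fixes 0.\<close>
  have act: "Poly_Mapping.lookup (?act D v) i = mact (V i) D (Poly_Mapping.lookup v i)"
    if "mact (V i) D 0 = 0" for D v i
    using that by (auto simp: mapp.rep_eq in_keys_iff)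
  have act0: "mact (V i) D 0 = 0" if "i \<in> I" "p \<in> {0, 1}" "D \<in> osp m n p" for i p D
    using linear_on_zero[OF osp_module_linear[OF V[OF that(1)] that(2,3)]]
      subspace_0[OF osp_module_subspace[OF V[OF that(1)]]] by simp
  have keys_comb: "Poly_Mapping.keys (v + w) \<subseteq> I" "Poly_Mapping.keys (v - w) \<subseteq> I"
    if "Poly_Mapping.keys v \<subseteq> I" "Poly_Mapping.keys w \<subseteq> I" for v w :: "'a \<Rightarrow>\<^sub>0 'b"
    using that Poly_Mapping.keys_add[of v w] Poly_Mapping.keys_diff[of v w] by auto
  have keys_scale: "Poly_Mapping.keys (c *\<^sub>R v) \<subseteq> I" if "Poly_Mapping.keys v \<subseteq> I" for v :: "'a \<Rightarrow>\<^sub>0 'b" and c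
    using that by (auto simp: in_keys_iff)
  show ?thesis
    unfolding osp_module_def dsum_family_def smodule.simps
  proof (intro conjI ballI allI)
    fix p :: nat assume p: "p \<in> {0, 1}"
    show "subspace (?fam (\<lambda>i. mpart (V i) p))"
      using osp_module_part[OF V p] by (intro sub) blast
    show "?fam (\<lambda>i. mpart (V i) p) \<subseteq> ?fam (\<lambda>i. mspace (V i))"
      using osp_module_part[OF V p] by blast
  next
    have "v = 0" if "v \<in> ?fam (\<lambda>i. mpart (V i) 0)" "v \<in> ?fam (\<lambda>i. mpart (V i) 1)" for v
    proof (rule eqI)
      show "Poly_Mapping.lookup v i = Poly_Mapping.lookup 0 i" if "i \<in> I" for i
        using osp_module_parts_disjoint[OF V[OF that]] mem[OF \<open>v \<in> ?fam (\<lambda>i. mpart (V i) 0)\<close> that]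
          mem[OF \<open>v \<in> ?fam (\<lambda>i. mpart (V i) 1)\<close> that] by auto
    qed (use that in auto)
    moreover have "0 \<in> ?fam (\<lambda>i. mpart (V i) p)" if "p \<in> {0, 1}" for p
      using osp_module_part[OF V that] by (intro subspace_0 sub) blast
    ultimately show "?fam (\<lambda>i. mpart (V i) 0) \<inter> ?fam (\<lambda>i. mpart (V i) 1) = {0}"
      by auto
  next
    show "graded_subspace \<lparr>mspace = ?fam (\<lambda>i. mspace (V i)), mpart = \<lambda>p. ?fam (\<lambda>i. mpart (V i) p),
        mact = ?act\<rparr> (?fam (\<lambda>i. mspace (V i)))"
      unfolding graded_subspace_def smodule.simps
    proof (intro conjI ballI order_refl)
      show "subspace (?fam (\<lambda>i. mspace (V i)))"
        using osp_module_subspace[OF V] by (intro sub)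
      fix v assume v: "v \<in> ?fam (\<lambda>i. mspace (V i))"
      have "\<forall>i\<in>I. \<exists>v0 v1. v0 \<in> mpart (V i) 0 \<and> v1 \<in> mpart (V i) 1 \<and> Poly_Mapping.lookup v i = v0 + v1"
        using osp_module_decomp[OF V] mem[OF v] by metis
      then obtain c0 c1 where c: "\<And>i. i \<in> I \<Longrightarrow> c0 i \<in> mpart (V i) 0 \<and> c1 i \<in> mpart (V i) 1 \<and>
          Poly_Mapping.lookup v i = c0 i + c1 i"
        by metis
      \<comment> \<open>The chosen components are cut off outside the keys of \<open>v\<close>,
        where the coefficient of \<open>v\<close> is 0; this keeps the support finite and the sum
        equal to \<open>v\<close>.\<close>
      let ?v = "\<lambda>c. Poly_Mapping.mapp (\<lambda>i _. c i) v"
      have kv: "Poly_Mapping.keys (?v c) \<subseteq> I" for c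
        by (rule order_trans[OF keys_mapp_subset]) (use v in blast)
      have part: "?v c \<in> ?fam (\<lambda>i. mspace (V i)) \<inter> ?fam (\<lambda>i. mpart (V i) p)"
        if "p \<in> {0, 1}" "\<And>i. i \<in> I \<Longrightarrow> c i \<in> mpart (V i) p" for c p
      proof -
        have "c i \<in> mpart (V i) p \<and> 0 \<in> mpart (V i) p \<and> c i \<in> mspace (V i) \<and> 0 \<in> mspace (V i)" if "i \<in> I" for i
          using \<open>\<And>i. i \<in> I \<Longrightarrow> c i \<in> mpart (V i) p\<close>[OF that] osp_module_part[OF V[OF that] \<open>p \<in> {0, 1}\<close>]
            subspace_0[of "mpart (V i) p"] by blast
        with kv show ?thesis by (auto simp: mapp.rep_eq)
      qed
      have "v = ?v c0 + ?v c1"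
        using c v by (intro eqI keys_comb kv) (auto simp: lookup_add mapp.rep_eq in_keys_iff)
      then show "\<exists>u0\<in>?fam (\<lambda>i. mspace (V i)) \<inter> ?fam (\<lambda>i. mpart (V i) 0).
          \<exists>u1\<in>?fam (\<lambda>i. mspace (V i)) \<inter> ?fam (\<lambda>i. mpart (V i) 1). v = u0 + u1"
        using part[of 0 c0] part[of 1 c1] c by blast
    qed
  next
    fix p q :: nat and D assume p: "p \<in> {0, 1}" and D: "D \<in> osp m n p"
    show "linear_on (?fam (\<lambda>i. mspace (V i))) (?act D)"
      unfolding linear_on_def
    proof (intro conjI ballI allI)
      fix v w assume vw: "v \<in> ?fam (\<lambda>i. mspace (V i))" "w \<in> ?fam (\<lambda>i. mspace (V i))"
      then show "?act D (v + w) = ?act D v + ?act D w"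
        by (intro eqI keys_comb keys_scale keys)
          (auto simp: act[OF act0[OF _ p D]] lookup_add intro!: linear_onD(1)[OF osp_module_linear[OF V p D]])
    next
      fix c v assume v: "v \<in> ?fam (\<lambda>i. mspace (V i))"
      then show "?act D (c *\<^sub>R v) = c *\<^sub>R ?act D v"
        by (intro eqI keys_comb keys_scale keys)
          (auto simp: act[OF act0[OF _ p D]] intro!: linear_onD(2)[OF osp_module_linear[OF V p D]])
    qed
    assume q: "q \<in> {0, 1}"
    show "?act D ` ?fam (\<lambda>i. mpart (V i) q) \<subseteq> ?fam (\<lambda>i. mpart (V i) ((p + q) mod 2))"
      using keys by (auto simp: act[OF act0[OF _ p D]] intro!: osp_module_act_part[OF V p q D])
  next
    fix p D E a b v
    assume p: "p \<in> {0, 1}" and D: "D \<in> osp m n p" and E: "E \<in> osp m n p" and v: "v \<in> ?fam (\<lambda>i. mspace (V i))"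
    have comb: "mact (V i) (lincomb m n a D b E) w = a *\<^sub>R mact (V i) D w + b *\<^sub>R mact (V i) E w"
      if "i \<in> I" "w \<in> mspace (V i)" for i w
      using osp_module_lincomb[OF V[OF that(1)] p D E that(2)] .
    have "mact (V i) (lincomb m n a D b E) 0 = 0" if "i \<in> I" for i
      using comb[OF that subspace_0[OF osp_module_subspace[OF V[OF that]]]] act0[OF that p D] act0[OF that p E] by simp
    then show "?act (lincomb m n a D b E) v = a *\<^sub>R ?act D v + b *\<^sub>R ?act E v"
      using v by (intro eqI keys_comb keys_scale keys)
        (auto simp: act act0[OF _ p D] act0[OF _ p E] lookup_add comb)
  next
    fix p q D E v
    assume p: "p \<in> {0, 1}" and q: "q \<in> {0, 1}" and D: "D \<in> osp m n p" and E: "E \<in> osp m n q"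
      and v: "v \<in> ?fam (\<lambda>i. mspace (V i))"
    have brack: "mact (V i) (superbracket m n p q D E) w =
        mact (V i) D (mact (V i) E w) - (-1) ^ (p * q) *\<^sub>R mact (V i) E (mact (V i) D w)"
      if "i \<in> I" "w \<in> mspace (V i)" for i w
      using osp_module_superbracket[OF V[OF that(1)] p q D E that(2)] .
    have "mact (V i) (superbracket m n p q D E) 0 = 0" if "i \<in> I" for i
      using brack[OF that subspace_0[OF osp_module_subspace[OF V[OF that]]]] act0[OF that p D] act0[OF that q E] by simp
    then show "?act (superbracket m n p q D E) v = ?act D (?act E v) - (-1) ^ (p * q) *\<^sub>R ?act E (?act D v)"
      using v by (intro eqI keys_comb keys_scale keys)
        (auto simp: act act0[OF _ p D] act0[OF _ q E] lookup_minus brack)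
  qed
qed

text \<open>The isomorphism is the inverse of \<open>b\<close> after \<open>a\<close>. Equivariance
  is inherited from the common target. Parity is preserved because the component of wrong parity of
  a preimage is mapped into both \<open>X 0\<close> and \<open>X 1\<close>, so it vanishes by
  injectivity.\<close>

lemma osp_isomorphic_common_image:
  fixes a :: "'v::real_vector \<Rightarrow> 'x::real_vector" and b :: "'w::real_vector \<Rightarrow> 'x"
  assumes V: "osp_module m n V" and W: "osp_module m n W"
    and a: "linear_on (mspace V) a" "inj_on a (mspace V)"
    and b: "linear_on (mspace W) b" "inj_on b (mspace W)"
    and image: "a ` mspace V = b ` mspace W"
    and part: "\<And>p. p \<in> {0, 1} \<Longrightarrow> subspace (X p)" "X 0 \<inter> X 1 \<subseteq> {0}"
      "\<And>p. p \<in> {0, 1} \<Longrightarrow> a ` mpart V p \<subseteq> X p" "\<And>p. p \<in> {0, 1} \<Longrightarrow> b ` mpart W p \<subseteq> X p"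
    and act: "\<And>p D v. p \<in> {0, 1} \<Longrightarrow> D \<in> osp m n p \<Longrightarrow> v \<in> mspace V \<Longrightarrow> a (mact V D v) = \<rho> D (a v)"
      "\<And>p D w. p \<in> {0, 1} \<Longrightarrow> D \<in> osp m n p \<Longrightarrow> w \<in> mspace W \<Longrightarrow> b (mact W D w) = \<rho> D (b w)"
  shows "osp_isomorphic m n V W"
proof -
  define \<phi> where "\<phi> v = inv_into (mspace W) b (a v)" for v
  have \<phi>: "\<phi> v \<in> mspace W" "b (\<phi> v) = a v" if "v \<in> mspace V" for v
    using that image f_inv_into_f[of "a v" b "mspace W"] inv_into_into[of "a v" b "mspace W"]
    by (auto simp: \<phi>_def)
  have eqI: "w = w'" if "w \<in> mspace W" "w' \<in> mspace W" "b w = b w'" for w w'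
    using inj_onD[OF b(2)] that by blast
  have "bij_betw \<phi> (mspace V) (mspace W)"
    using bij_betw_trans[OF inj_on_imp_bij_betw[OF a(2)], of "inv_into (mspace W) b" "mspace W"]
      bij_betw_inv_into[OF inj_on_imp_bij_betw[OF b(2)]] image
    by (simp add: \<phi>_def[abs_def] comp_def)
  moreover have "linear_on (mspace V) \<phi>"
    unfolding linear_on_def
  proof (intro conjI ballI allI)
    fix v w assume vw: "v \<in> mspace V" "w \<in> mspace V"
    show "\<phi> (v + w) = \<phi> v + \<phi> w"
      using vw by (intro eqI)
        (simp_all add: \<phi> linear_onD[OF a(1)] linear_onD[OF b(1)] subspace_add osp_module_subspace[OF V]
          osp_module_subspace[OF W])
  next
    fix c v assume v: "v \<in> mspace V"
    then show "\<phi> (c *\<^sub>R v) = c *\<^sub>R \<phi> v"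
      by (intro eqI)
        (simp_all add: \<phi> linear_onD[OF a(1)] linear_onD[OF b(1)] subspace_scale osp_module_subspace[OF V]
          osp_module_subspace[OF W])
  qed
  moreover have "\<phi> v \<in> mpart W p" if p: "p \<in> {0, 1}" and v: "v \<in> mpart V p" for p v
  proof -
    have v': "v \<in> mspace V" using osp_module_part[OF V p] v by blast
    obtain w0 w1 where w: "w0 \<in> mpart W 0" "w1 \<in> mpart W 1" "\<phi> v = w0 + w1"
      using osp_module_decomp[OF W \<phi>(1)[OF v']] .
    have ww: "w0 \<in> mspace W" "w1 \<in> mspace W"
      using w osp_module_part[OF W, of 0] osp_module_part[OF W, of 1] by auto
    have eq: "a v = b w0 + b w1"
      using \<phi>(2)[OF v'] w(3) linear_onD(1)[OF b(1) ww] by simp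
    have X: "b w0 \<in> X 0" "b w1 \<in> X 1" "a v \<in> X p"
      using part(3)[OF p] part(4)[of 0] part(4)[of 1] v w by auto
    have zero: "w = 0" if "b w = 0" "w \<in> mspace W" for w
      using eqI[OF that(2) subspace_0[OF osp_module_subspace[OF W]]] that
        linear_on_zero[OF b(1) subspace_0[OF osp_module_subspace[OF W]]] by simp
    consider "p = 0" | "p = 1" using p by auto
    then show ?thesis
    proof cases
      case 1
      then have "b w1 \<in> X 0"
        using X subspace_diff[OF part(1)[of 0], of "a v" "b w0"] eq by simp
      then have "w1 = 0" using X part(2) ww zero by blast
      then show ?thesis using w 1 by simp
    next
      case 2
      then have "b w0 \<in> X 1"
        using X subspace_diff[OF part(1)[of 1], of "a v" "b w1"] eq by simp
      then have "w0 = 0" using X part(2) ww zero by blast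
      then show ?thesis using w 2 by simp
    qed
  qed
  moreover have "\<phi> (mact V D v) = mact W D (\<phi> v)" if "p \<in> {0, 1}" "D \<in> osp m n p" "v \<in> mspace V" for p D v
    using that
    by (intro eqI osp_module_act_mem[OF W that(1,2)] \<phi>(1) osp_module_act_mem[OF V that(1,2)])
      (simp_all add: \<phi> osp_module_act_mem[OF V that(1,2)] act[OF that(1,2)])
  ultimately show ?thesis
    unfolding osp_isomorphic_def using V W by blast
qed

section \<open>The decomposition\<close>

lemma tcoeff_R2_mult:
  "tcoeff (Suc m) j (R2 (Suc m) n * f) =
    (if j < 2 then 0 else tcoeff (Suc m) (j - 2) f) + R2 m n * tcoeff (Suc m) j f"
proof -
  have "tcoeff (Suc m) j (R2 m n * f) = R2 m n * tcoeff (Suc m) j f"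
    by (rule tcoeff_mult[OF R2_superpolys]) simp
  then show ?thesis
    by (auto simp: R2_Suc distrib_right tcoeff_xvar_power_mult not_less)
qed

section \<open>Action of osp(m|2n) on generalized harmonics\<close>

context
  fixes m n p D
  assumes D: "D \<in> osp m n p"
begin

lemma coeffwise_hspace:
  assumes f: "f \<in> hspace (Suc m) n k"
  shows "coeffwise (Suc m) D f \<in> hspace (Suc m) n k"
  unfolding coeffwise_def
proof (intro subspace_sum subspace_hspace)
  fix j
  have "D (tcoeff (Suc m) j f) \<in> hspace (Suc m) n (k - int j)"
    by (intro hspace_mono osp_hspace[OF D] tcoeff_hspace f)
  from xvar_power_mult_hspace[OF _ this, of "Suc m" j]
  show "xvar (Suc m) ^ j * D (tcoeff (Suc m) j f) \<in> hspace (Suc m) n k" by simp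
qed

lemma coeffwise_laplacian:
  assumes f: "f \<in> superpolys (Suc m) n"
  shows "coeffwise (Suc m) D (laplacian (Suc m) n f) = laplacian (Suc m) n (coeffwise (Suc m) D f)"
proof (rule tcoeff_ext[of "Suc m"])
  note c = tcoeff_superpolys[OF f]
  show "tcoeff (Suc m) j (coeffwise (Suc m) D (laplacian (Suc m) n f)) =
      tcoeff (Suc m) j (laplacian (Suc m) n (coeffwise (Suc m) D f))" for j
    unfolding tcoeff_coeffwise[OF osp_sder[OF D] laplacian_superpolys[OF f]] tcoeff_laplacian_Suc
      tcoeff_coeffwise[OF osp_sder[OF D] f] osp_laplacian[OF D c, symmetric]
    using c laplacian_superpolys[OF c]
    by (simp add: sder_add[OF osp_sder[OF D]] sder_scaleR[OF osp_sder[OF D]] subspace_scale[OF subspace_superpolys])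
qed

lemma coeffwise_R2_mult:
  assumes f: "f \<in> superpolys (Suc m) n"
  shows "coeffwise (Suc m) D (R2 (Suc m) n * f) = R2 (Suc m) n * coeffwise (Suc m) D f"
proof (rule tcoeff_ext[of "Suc m"])
  note c = tcoeff_superpolys[OF f]
  show "tcoeff (Suc m) j (coeffwise (Suc m) D (R2 (Suc m) n * f)) =
      tcoeff (Suc m) j (R2 (Suc m) n * coeffwise (Suc m) D f)" for j
    unfolding tcoeff_coeffwise[OF osp_sder[OF D] R2_mult_superpolys[OF f]] tcoeff_R2_mult
      tcoeff_coeffwise[OF osp_sder[OF D] f] osp_R2_mult[OF D c, symmetric]
    using c
    by (simp add: sder_add[OF osp_sder[OF D]] sder_zero[OF osp_sder[OF D]] R2_mult_superpolys)
qed

end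

lemma gen_harmonics_eq:
  "gen_harmonics m n k = {f \<in> hspace m n (int k). laplacian m n (R2 m n * laplacian m n f) = 0}"
  by (simp add: gen_harmonics_def homogeneous_superpolys_eq)

lemma subspace_gen_harmonics: "subspace (gen_harmonics m n k)"
  unfolding gen_harmonics_eq
  by (rule subspaceI)
    (auto intro: subspace_0[OF subspace_hspace] subspace_add[OF subspace_hspace] subspace_scale[OF subspace_hspace]
      simp: distrib_left)

lemma gen_harmonics_hspace: "f \<in> gen_harmonics m n k \<Longrightarrow> f \<in> hspace m n (int k)"
  and gen_harmonics_superpolys: "f \<in> gen_harmonics m n k \<Longrightarrow> f \<in> superpolys m n"
  by (auto simp: gen_harmonics_eq hspace_superpolys)

lemma coeffwise_gen_harmonics:
  assumes D: "D \<in> osp m n p" and f: "f \<in> gen_harmonics (Suc m) n k"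
  shows "coeffwise (Suc m) D f \<in> gen_harmonics (Suc m) n k"
proof -
  have f': "f \<in> superpolys (Suc m) n" by (rule gen_harmonics_superpolys[OF f])
  have "laplacian (Suc m) n (R2 (Suc m) n * laplacian (Suc m) n (coeffwise (Suc m) D f)) =
      coeffwise (Suc m) D (laplacian (Suc m) n (R2 (Suc m) n * laplacian (Suc m) n f))"
    by (simp add: coeffwise_laplacian[OF D] coeffwise_R2_mult[OF D] f' laplacian_superpolys R2_mult_superpolys)
  also have "\<dots> = 0"
    using f by (simp add: gen_harmonics_eq coeffwise_def)
  finally show ?thesis
    using coeffwise_hspace[OF D gen_harmonics_hspace[OF f]] by (simp add: gen_harmonics_eq)
qed

lemma sder_lincomb:
  assumes "sder m n p D" "sder m n p E"
  shows "sder m n p (lincomb m n a D b E)"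
  by (rule sder_cong[OF sder_add_map[OF sder_scale_map[OF assms(1), of a] sder_scale_map[OF assms(2), of b]]])
    (simp add: lincomb_def)

lemma sder_superbracket:
  assumes "sder m n p D" "sder m n q E"
  shows "sder m n (p + q) (superbracket m n p q D E)"
  by (rule sder_cong[OF sder_bracket[OF assms]]) (simp add: superbracket_def)

text \<open>Once \<open>extend_der\<close> is replaced by the coefficientwise action, linear
  combinations and brackets can be compared in each t-degree, where they agree by
  definition.\<close>

lemma osp_module_gen_harmonics_restricted: "osp_module m n (gen_harmonics_restricted (Suc m) n k)"
  unfolding gen_harmonics_restricted_def
proof (rule osp_module_superpolysI[OF subspace_gen_harmonics])
  let ?E = "coeffwise (Suc m)"
  show "ppart q f \<in> gen_harmonics (Suc m) n k" if "f \<in> gen_harmonics (Suc m) n k" "q \<in> {0, 1}" for q f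
    using that by (simp only: gen_harmonics_eq mem_Collect_eq ppart_laplacian ppart_R2_mult ppart_hspace ppart_zero)
  have ext: "extend_der (Suc m) n D f = ?E D f" if "sder m n p D" "f \<in> gen_harmonics (Suc m) n k" for p D f
    by (rule extend_der_eq[OF that(1) gen_harmonics_superpolys[OF that(2)]])
  note osp_ext = ext[OF osp_sder]
  note E = sder_coeffwise[OF osp_sder]
  show "extend_der (Suc m) n D f \<in> gen_harmonics (Suc m) n k"
    if "D \<in> osp m n p" "f \<in> gen_harmonics (Suc m) n k" for p D f
    unfolding osp_ext[OF that] by (rule coeffwise_gen_harmonics[OF that])
  show "linear_on (gen_harmonics (Suc m) n k) (extend_der (Suc m) n D)" if D: "D \<in> osp m n p" for p D
  proof -
    have "linear_on (gen_harmonics (Suc m) n k) (?E D)"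
      using linear_on_subset[OF sder_linear_on[OF E[OF D]]] gen_harmonics_superpolys by blast
    then show ?thesis
      using subspace_gen_harmonics[of "Suc m" n k]
      by (simp add: linear_on_def osp_ext[OF D] subspace_add subspace_scale)
  qed
  show "extend_der (Suc m) n D f \<in> parity_part (p + q)"
    if "D \<in> osp m n p" "f \<in> gen_harmonics (Suc m) n k" "f \<in> parity_part q" for p q D f
    unfolding osp_ext[OF that(1,2)] by (rule sder_parity[OF E[OF that(1)] gen_harmonics_superpolys[OF that(2)] that(3)])
  show "extend_der (Suc m) n (lincomb m n a D b E') f =
      a *\<^sub>R extend_der (Suc m) n D f + b *\<^sub>R extend_der (Suc m) n E' f"
    if D: "D \<in> osp m n p" "E' \<in> osp m n p" and f: "f \<in> gen_harmonics (Suc m) n k" for p D E' a b f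
    unfolding osp_ext[OF D(1) f] osp_ext[OF D(2) f] ext[OF sder_lincomb[OF D[THEN osp_sder]] f]
  proof (rule tcoeff_ext[of "Suc m"])
    note f' = gen_harmonics_superpolys[OF f]
    show "tcoeff (Suc m) j (?E (lincomb m n a D b E') f) = tcoeff (Suc m) j (a *\<^sub>R ?E D f + b *\<^sub>R ?E E' f)" for j
      using tcoeff_coeffwise[OF osp_sder[OF D(1)] f'] tcoeff_coeffwise[OF osp_sder[OF D(2)] f']
        tcoeff_coeffwise[OF sder_lincomb[OF D[THEN osp_sder]] f'] tcoeff_superpolys[OF f']
      by (simp add: lincomb_def)
  qed
  show "extend_der (Suc m) n (superbracket m n p q D E') f = extend_der (Suc m) n D (extend_der (Suc m) n E' f) -
      (-1) ^ (p * q) *\<^sub>R extend_der (Suc m) n E' (extend_der (Suc m) n D f)"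
    if D: "D \<in> osp m n p" "E' \<in> osp m n q" and f: "f \<in> gen_harmonics (Suc m) n k" for p q D E' f
    unfolding osp_ext[OF D(1) f] osp_ext[OF D(2) f] ext[OF sder_superbracket[OF D[THEN osp_sder]] f]
      osp_ext[OF D(1) coeffwise_gen_harmonics[OF D(2) f]] osp_ext[OF D(2) coeffwise_gen_harmonics[OF D(1) f]]
  proof (rule tcoeff_ext[of "Suc m"])
    note f' = gen_harmonics_superpolys[OF f]
    note c = tcoeff_coeffwise[OF osp_sder[OF D(1)]] tcoeff_coeffwise[OF osp_sder[OF D(2)]]
    show "tcoeff (Suc m) j (?E (superbracket m n p q D E') f) =
        tcoeff (Suc m) j (?E D (?E E' f) - (-1) ^ (p * q) *\<^sub>R ?E E' (?E D f))" for j
      using c(1)[OF f'] c(2)[OF f'] c(1)[OF coeffwise_superpolys[OF osp_sder[OF D(2)] f']]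
        c(2)[OF coeffwise_superpolys[OF osp_sder[OF D(1)] f']]
        tcoeff_coeffwise[OF sder_superbracket[OF D[THEN osp_sder]] f'] tcoeff_superpolys[OF f']
      by (simp add: superbracket_def)
  qed
qed

section \<open>Fischer decompositions in two consecutive degrees\<close>

lemma hspace_disjoint: "f \<in> hspace m n a \<Longrightarrow> f \<in> hspace m n b \<Longrightarrow> a \<noteq> b \<Longrightarrow> f = 0"
  by (rule superpoly_eqI) (auto dest: hspaceD)

lemma hspace_direct_sum:
  assumes "f \<in> hspace m n a" "g \<in> hspace m n b" "a \<noteq> b" "f + g = 0"
  shows "f = 0 \<and> g = 0"
proof -
  have "f = - g" using assms(4) by (simp add: eq_neg_iff_add_eq_0)
  then have "f \<in> hspace m n b"
    using subspace_neg[OF subspace_hspace assms(2)] by simp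
  with assms show ?thesis using hspace_disjoint by fastforce
qed

text \<open>Encodes pairs of polynomials of degrees d and d - 1 by their sums. Nothing is lost since
  the degrees differ, and harmonics of all degrees up to d, of either parity, enter a single
  decomposition.\<close>

definition two_degrees :: "nat \<Rightarrow> nat \<Rightarrow> nat \<Rightarrow> superpoly set" where
  "two_degrees m n d = {f + g |f g. f \<in> hspace m n (int d) \<and> g \<in> hspace m n (int d - 1)}"

text \<open>
  The Fischer decompositions of degrees \<open>d\<close> and \<open>d - 1\<close>, combined into one sum over all
  degrees \<open>l \<le> d\<close> of spherical harmonics.
\<close>

definition fischer_sum :: "nat \<Rightarrow> nat \<Rightarrow> nat \<Rightarrow> (nat \<Rightarrow> superpoly) \<Rightarrow> superpoly" where
  "fischer_sum m n d h = (\<Sum>l\<le>d. R2 m n ^ ((d - l) div 2) * h l)"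

text \<open>Rounding in \<open>(d - l) div 2\<close> gives (d - l)/2 if l has the parity of d, and
  (d - 1 - l)/2 otherwise, so both decompositions gain one factor R^2 when d grows by two.\<close>

lemma fischer_sum_Suc_Suc:
  "fischer_sum m n (Suc (Suc d)) h = h (Suc (Suc d)) + h (Suc d) + R2 m n * fischer_sum m n d h"
proof -
  have "(\<Sum>l\<le>d. R2 m n ^ ((Suc (Suc d) - l) div 2) * h l) = (\<Sum>l\<le>d. R2 m n * (R2 m n ^ ((d - l) div 2) * h l))"
    by (rule sum.cong) (auto simp: Suc_diff_le mult.assoc)
  then show ?thesis
    by (simp add: fischer_sum_def sum_distrib_left Suc_diff_le algebra_simps)
qed

lemma two_step_induct [case_names 0 1 step]:
  "P 0 \<Longrightarrow> P (Suc 0) \<Longrightarrow> (\<And>d. P d \<Longrightarrow> P (Suc (Suc d))) \<Longrightarrow> P d" for P :: "nat \<Rightarrow> bool"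
  by (induction d rule: nat_less_induct) (metis lessI less_SucI not0_implies_Suc)

lemma fischer_sum_two_degrees:
  "(\<And>l. l \<le> d \<Longrightarrow> h l \<in> harmonics m n l) \<Longrightarrow> fischer_sum m n d h \<in> two_degrees m n d"
proof (induction d rule: two_step_induct)
  case 0
  then show ?case
    using harmonics_hspace[of "h 0" m n 0] subspace_0[OF subspace_hspace, of m n "- 1"]
    unfolding fischer_sum_def two_degrees_def mem_Collect_eq
    by - (rule exI[of _ "h 0"], rule exI[of _ 0], simp)
next
  case 1
  then show ?case
    using harmonics_hspace[of "h 0" m n 0] harmonics_hspace[of "h (Suc 0)" m n "Suc 0"]
    unfolding fischer_sum_def two_degrees_def mem_Collect_eq
    by - (rule exI[of _ "h (Suc 0)"], rule exI[of _ "h 0"], simp)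
next
  case (step d)
  then obtain f g where fg: "f \<in> hspace m n (int d)" "g \<in> hspace m n (int d - 1)" "fischer_sum m n d h = f + g"
    by (auto simp: two_degrees_def)
  have "h (Suc (Suc d)) + R2 m n * f \<in> hspace m n (int (Suc (Suc d)))"
    using fg(1) by (intro subspace_add[OF subspace_hspace] harmonics_hspace step.prems R2_mult_hspace) auto
  moreover have "h (Suc d) + R2 m n * g \<in> hspace m n (int (Suc (Suc d)) - 1)"
    using fg(2) harmonics_hspace[OF step.prems, of "Suc d"]
    by (intro subspace_add[OF subspace_hspace] R2_mult_hspace) auto
  ultimately show ?case
    unfolding fischer_sum_Suc_Suc fg(3) two_degrees_def mem_Collect_eq
    by (intro exI[of _ "h (Suc (Suc d)) + R2 m n * f"] exI[of _ "h (Suc d) + R2 m n * g"])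
      (simp add: algebra_simps)
qed

text \<open>Comparing degrees separates the two decompositions. Delta removes the harmonic top
  terms, Fischer uniqueness removes what R^2 multiplies, and so the top terms and the sum for d - 2
  vanish separately.\<close>

lemma fischer_sum_inj:
  assumes "odd m"
  shows "(\<And>l. l \<le> d \<Longrightarrow> h l \<in> harmonics m n l) \<Longrightarrow> fischer_sum m n d h = 0 \<Longrightarrow> l \<le> d \<Longrightarrow> h l = 0"
proof (induction d arbitrary: l rule: two_step_induct)
  case 0
  then show ?case by (simp add: fischer_sum_def)
next
  case 1
  have "h 0 + h (Suc 0) = 0" using 1 by (simp add: fischer_sum_def)
  then have "h 0 = 0 \<and> h (Suc 0) = 0"
    using 1 by (intro hspace_direct_sum[of _ m n "int 0" _ "int (Suc 0)"] harmonics_hspace) auto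
  with 1 show ?case by (auto simp: le_Suc_eq)
next
  case (step d)
  have "fischer_sum m n d h \<in> two_degrees m n d"
    using step.prems by (intro fischer_sum_two_degrees) auto
  then obtain f g where fg: "f \<in> hspace m n (int d)" "g \<in> hspace m n (int d - 1)" "fischer_sum m n d h = f + g"
    by (auto simp: two_degrees_def)
  have h: "h (Suc (Suc d)) \<in> harmonics m n (Suc (Suc d))" "h (Suc d) \<in> harmonics m n (Suc d)"
    using step.prems by auto
  have "(h (Suc (Suc d)) + R2 m n * f) + (h (Suc d) + R2 m n * g) = 0"
    using step.prems(2) unfolding fischer_sum_Suc_Suc fg(3) by (simp add: algebra_simps)
  moreover have "h (Suc (Suc d)) + R2 m n * f \<in> hspace m n (int (Suc (Suc d)))"
    using fg(1) harmonics_hspace[OF h(1)] by (intro subspace_add[OF subspace_hspace] R2_mult_hspace) auto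
  moreover have "h (Suc d) + R2 m n * g \<in> hspace m n (int (Suc d))"
    using fg(2) harmonics_hspace[OF h(2)] by (intro subspace_add[OF subspace_hspace] R2_mult_hspace) auto
  ultimately have eq: "h (Suc (Suc d)) + R2 m n * f = 0" "h (Suc d) + R2 m n * g = 0"
    using hspace_direct_sum[of _ m n "int (Suc (Suc d))" _ "int (Suc d)"] by auto
  have "laplacian m n (R2 m n * f) = 0" "laplacian m n (R2 m n * g) = 0"
    using arg_cong[OF eq(1), of "laplacian m n"] arg_cong[OF eq(2), of "laplacian m n"]
      harmonics_laplacian[OF h(1)] harmonics_laplacian[OF h(2)] by simp_all
  then have "f = 0" "g = 0"
    using fischer_unique[OF assms fg(1)] fischer_unique[OF assms fg(2)] by auto
  with eq fg(3) have "h (Suc (Suc d)) = 0" "h (Suc d) = 0" "fischer_sum m n d h = 0" by auto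
  with step.IH[of l] step.prems show ?case
    by (auto simp: le_Suc_eq)
qed

lemma fischer_sum_surj:
  assumes "odd m"
  shows "f \<in> hspace m n (int d) \<Longrightarrow> g \<in> hspace m n (int d - 1) \<Longrightarrow>
    \<exists>h. (\<forall>l\<le>d. h l \<in> harmonics m n l) \<and> fischer_sum m n d h = f + g"
proof (induction d arbitrary: f g rule: two_step_induct)
  case 0
  have "g = 0" using hspace_neg[OF 0(2)] by simp
  moreover have "laplacian m n f = 0"
    by (rule hspace_neg[OF laplacian_hspace[OF 0(1)]]) simp
  ultimately show ?case
    using 0(1) by (intro exI[of _ "\<lambda>_. f"]) (auto simp: fischer_sum_def harmonics_eq)
next
  case 1
  have "laplacian m n f = 0"
    by (rule hspace_neg[OF laplacian_hspace[OF 1(1)]]) simp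
  moreover have "laplacian m n g = 0"
    by (rule hspace_neg[OF laplacian_hspace[OF 1(2)]]) simp
  ultimately show ?case
    using 1 by (intro exI[of _ "\<lambda>l. if l = 0 then g else f"])
      (auto simp: fischer_sum_def harmonics_eq le_Suc_eq add.commute)
next
  case (step d)
  obtain h0 y0 where 0: "h0 \<in> hspace m n (int (Suc (Suc d)))" "laplacian m n h0 = 0"
      "y0 \<in> hspace m n (int (Suc (Suc d)) - 2)" "f = h0 + R2 m n * y0"
    using fischer_exists[OF assms step.prems(1)] .
  obtain h1 y1 where 1: "h1 \<in> hspace m n (int (Suc (Suc d)) - 1)" "laplacian m n h1 = 0"
      "y1 \<in> hspace m n (int (Suc (Suc d)) - 1 - 2)" "g = h1 + R2 m n * y1"
    using fischer_exists[OF assms step.prems(2)] .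
  obtain h where h: "\<forall>l\<le>d. h l \<in> harmonics m n l" "fischer_sum m n d h = y0 + y1"
    using step.IH[of y0 y1] 0(3) 1(3) by auto
  let ?h = "h(Suc (Suc d) := h0, Suc d := h1)"
  have "fischer_sum m n d ?h = fischer_sum m n d h"
    unfolding fischer_sum_def by (rule sum.cong) auto
  then have "fischer_sum m n (Suc (Suc d)) ?h = f + g"
    unfolding fischer_sum_Suc_Suc h(2) 0(4) 1(4) by (simp add: h(2) algebra_simps)
  moreover have "\<forall>l\<le>Suc (Suc d). ?h l \<in> harmonics m n l"
    using h(1) 0 1 by (auto simp: le_Suc_eq harmonics_eq)
  ultimately show ?case by blast
qed


section \<open>Iterated Laplacians and initial data\<close>

lemma laplacian_funpow_linear: "linear ((laplacian m n ^^ s))"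
proof (induction s)
  case 0
  then show ?case by (simp only: funpow.simps(1) linear_id)
next
  case (Suc s)
  then show ?case
    by (simp only: funpow.simps(2)) (rule linear_compose[OF _ linear_laplacian])
qed

lemma laplacian_funpow_hspace:
  "f \<in> hspace m' n' k \<Longrightarrow> (laplacian m n ^^ s) f \<in> hspace m' n' (k - 2 * int s)"
proof (induction s)
  case (Suc s)
  from laplacian_hspace[OF Suc.IH[OF Suc.prems], of m n] show ?case
    by (simp add: algebra_simps)
qed simp

lemma laplacian_funpow_superpolys:
  "f \<in> superpolys m' n' \<Longrightarrow> (laplacian m n ^^ s) f \<in> superpolys m' n'"
  by (induction s) (simp_all add: laplacian_superpolys)

lemma laplacian_funpow_parity: "f \<in> parity_part p \<Longrightarrow> (laplacian m n ^^ s) f \<in> parity_part p"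
  by (induction s) (simp_all add: laplacian_parity)

lemma coeffwise_laplacian_funpow:
  assumes "D \<in> osp m n p" "f \<in> superpolys (Suc m) n"
  shows "coeffwise (Suc m) D ((laplacian (Suc m) n ^^ s) f) = (laplacian (Suc m) n ^^ s) (coeffwise (Suc m) D f)"
  by (induction s)
    (simp_all add: coeffwise_laplacian[OF assms(1)] laplacian_funpow_superpolys[OF assms(2)])

text \<open>
  Throughout, \<open>M = m + 1 - 2n = - 2a\<close>. For \<open>g \<in> \<P>\<^bsub>k-2\<^esub>\<close>, the polynomial \<open>R\<^sup>2 g\<close> is harmonic iff
  \<open>g = R\<^bsup>2(j-1)\<^esup> u\<close> with \<open>u\<close> harmonic of degree \<open>i = 2 - M - k\<close>, where \<open>2j = k - i\<close>.
\<close>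

context
  fixes m n a k i j :: nat
  assumes M: "Suc m + 2 * a = 2 * n" and k: "a + 2 \<le> k" "k \<le> 2 * a + 2"
    and i: "i + k = 2 * a + 2" and j: "j + 1 + a = k"
begin

abbreviation (input) "Lap \<equiv> laplacian (Suc m) n"
abbreviation (input) "Rad \<equiv> R2 (Suc m) n"

text \<open>Harmonicity of R^2 g is the radial equation with s = 1 for g itself, and every
  application of Delta moves it to the next pair of parameters.\<close>

lemma radial_chain:
  assumes "g \<in> hspace (Suc m) n (int k - 2)" "Lap (Rad * g) = 0"
  shows "Rad * Lap ((Lap ^^ s) g) + radial_const (Suc m) n (Suc s) (int k - 2 - 2 * int s) *\<^sub>R (Lap ^^ s) g = 0"
proof (induction s)
  case 0
  then show ?case
    using assms(2) laplacian_R2_hspace[OF assms(1)] by (simp add: radial_const_def algebra_simps)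
next
  case (Suc s)
  show ?case
    using arg_cong[OF Suc, of Lap] radial_step[OF laplacian_funpow_hspace[OF assms(1), of s "Suc m" n], of "Suc s"]
    by (simp add: algebra_simps)
qed

text \<open>In the equation for Delta^(j-1) g the constant is 0. One step later its last factor is
  -2 and only decreases from there, so the radial operator is injective and Delta^j g = 0.\<close>

lemma funpow_laplacian_harmonic:
  assumes "g \<in> hspace (Suc m) n (int k - 2)" "Lap (Rad * g) = 0"
  shows "Lap ((Lap ^^ (j - 1)) g) = 0"
proof -
  have "(Lap ^^ j) g = 0"
  proof (rule radial_inj[OF laplacian_funpow_hspace[OF assms(1)] _ radial_chain[OF assms]])
    fix j' :: nat
    have "2 * (int k - 2 - 2 * int j) + int (Suc m) - 2 * int n + 2 * int (Suc j) - 2 = - 2"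
      using M j by auto
    then show "2 * (int k - 2 - 2 * int j) + int (Suc m) - 2 * int n + 2 * int (Suc j) - 2 \<noteq> 2 * int j'"
      by linarith
  qed simp
  moreover have "j = Suc (j - 1)" using j k by linarith
  ultimately show ?thesis by (metis funpow.simps(2) o_apply)
qed

text \<open>For r < j - 1 the last factor of the constant is 2(j - 1 - r) > 0. If Delta^(r+1) g = 0,
  the radial equation then gives Delta^r g = 0, and this descends from r = j - 2 to 0.\<close>

lemma funpow_laplacian_inj:
  assumes "g \<in> hspace (Suc m) n (int k - 2)" "Lap (Rad * g) = 0" "(Lap ^^ (j - 1)) g = 0"
  shows "g = 0"
proof -
  have "(Lap ^^ (j - 1 - s)) g = 0" if "s \<le> j - 1" for s
    using that
  proof (induction s)
    case (Suc s)
    let ?r = "j - 1 - Suc s"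
    have r: "Suc ?r = j - 1 - s" using Suc.prems by simp
    have "Lap ((Lap ^^ ?r) g) = 0"
      using Suc unfolding r[symmetric] by simp
    with radial_chain[OF assms(1,2), of ?r]
    have "radial_const (Suc m) n (Suc ?r) (int k - 2 - 2 * int ?r) *\<^sub>R (Lap ^^ ?r) g = 0" by simp
    moreover have "radial_const (Suc m) n (Suc ?r) (int k - 2 - 2 * int ?r) \<noteq> 0"
    proof -
      have "2 * (int k - 2 - 2 * int ?r) + int (Suc m) - 2 * int n + 2 * int (Suc ?r) - 2 > 0"
      proof -
        define r where "r = ?r"
        have "int r + 2 \<le> int j" using Suc.prems by (simp add: r_def)
        moreover have "int k = int j + 1 + int a" "int m + 1 + 2 * int a = 2 * int n"
          using M j by linarith+
        ultimately show ?thesis unfolding r_def[symmetric] by simp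
      qed
      then show ?thesis unfolding radial_const_def by simp
    qed
    ultimately show ?case by simp
  qed (use assms(3) in simp)
  from this[of "j - 1"] show ?thesis by simp
qed

text \<open>The candidate is a multiple of R^(2(j-1)) u. Removing its factors R^2 one by one
  produces scalars containing 2(s + 1 - j), nonzero for s < j - 1, so Delta^(j-1) returns a nonzero
  multiple of u. The next scalar, at s = j - 1, is 0, which makes R^(2j) u harmonic.\<close>

lemma funpow_laplacian_surj:
  assumes u: "u \<in> harmonics (Suc m) n i"
  shows "\<exists>g \<in> hspace (Suc m) n (int k - 2). Lap (Rad * g) = 0 \<and> (Lap ^^ (j - 1)) g = u"
proof -
  have M': "real (Suc m) - 2 * real n = - 2 * real a"
    using M by linarith
  have "\<exists>c. (Lap ^^ s) (Rad ^ s * u) = c *\<^sub>R u \<and> c \<noteq> 0" if "s \<le> j - 1" for s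
    using that
  proof (induction s)
    case 0
    then show ?case by (intro exI[of _ 1]) simp
  next
    case (Suc s)
    then obtain c where c: "(Lap ^^ s) (Rad ^ s * u) = c *\<^sub>R u" "c \<noteq> 0" by auto
    define d where "d = 2 * real (Suc s) * (2 * real_of_int (int i) + real (Suc m) - 2 * real n + 2 * real s)"
    have "2 * real_of_int (int i) + real (Suc m) - 2 * real n + 2 * real s < 0"
      using M i j Suc.prems by linarith
    then have "d \<noteq> 0" by (simp add: d_def)
    have "Lap (Rad ^ Suc s * u) = d *\<^sub>R (Rad ^ s * u)"
      unfolding d_def by (rule laplacian_R2_power[OF harmonics_hspace[OF u] harmonics_laplacian[OF u]])
    then have "(Lap ^^ Suc s) (Rad ^ Suc s * u) = (Lap ^^ s) (d *\<^sub>R (Rad ^ s * u))"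
      by (simp only: funpow_Suc_right o_apply)
    also have "\<dots> = (d * c) *\<^sub>R u"
      using c(1) by (simp add: linear_scale[OF laplacian_funpow_linear])
    finally show ?case using c(2) \<open>d \<noteq> 0\<close> by (intro exI[of _ "d * c"]) simp
  qed
  then obtain c where c: "(Lap ^^ (j - 1)) (Rad ^ (j - 1) * u) = c *\<^sub>R u" "c \<noteq> 0" by blast
  define g where "g = (1 / c) *\<^sub>R (Rad ^ (j - 1) * u)"
  have "Rad ^ (j - 1) * u \<in> hspace (Suc m) n (int i + 2 * int (j - 1))"
    by (rule R2_power_hspace[OF harmonics_hspace[OF u]])
  moreover have "int i + 2 * int (j - 1) = int k - 2"
    using i j k by linarith
  ultimately have "g \<in> hspace (Suc m) n (int k - 2)"
    unfolding g_def by (simp add: subspace_scale[OF subspace_hspace])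
  moreover have "Lap (Rad * g) = 0"
  proof -
    have "2 * real_of_int (int i) + real (Suc m) - 2 * real n + 2 * real (j - 1) = 0"
      using M i j k by linarith
    then have "Lap (Rad ^ Suc (j - 1) * u) = 0"
      unfolding laplacian_R2_power[OF harmonics_hspace[OF u] harmonics_laplacian[OF u]]
      by (simp only: mult_zero_right scaleR_zero_left)
    then show ?thesis by (simp add: g_def mult.assoc)
  qed
  moreover have "(Lap ^^ (j - 1)) g = u"
    using c by (simp add: g_def linear_scale[OF laplacian_funpow_linear])
  ultimately show ?thesis by blast
qed

text \<open>The four coefficients are stored as two elements of \<open>two_degrees\<close>, of
  degrees k and i.\<close>

definition initial_data :: "superpoly \<Rightarrow> superpoly \<times> superpoly" where
  "initial_data f = (tcoeff (Suc m) 0 f + tcoeff (Suc m) 1 f,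
    tcoeff (Suc m) 0 ((Lap ^^ j) f) + tcoeff (Suc m) 1 ((Lap ^^ j) f))"

lemma linear_initial_data: "linear initial_data"
  by (rule linearI)
    (simp_all add: initial_data_def linear_add[OF laplacian_funpow_linear] linear_scale[OF laplacian_funpow_linear]
      algebra_simps)

lemma funpow_laplacian_j: "(Lap ^^ j) f = (Lap ^^ (j - 1)) (Lap f)"
proof -
  have "j = Suc (j - 1)" using j k by linarith
  then show ?thesis by (metis funpow_Suc_right o_apply)
qed

lemma cauchy_data_zero:
  assumes f: "f \<in> hspace (Suc m) n d" "Lap f = 0" "tcoeff (Suc m) 0 f + tcoeff (Suc m) 1 f = 0"
  shows "f = 0"
proof -
  have "tcoeff (Suc m) 0 f \<in> hspace m n d" "tcoeff (Suc m) 1 f \<in> hspace m n (d - 1)"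
    using tcoeff_hspace[OF f(1), of 0] tcoeff_hspace[OF f(1), of 1] by simp_all
  from hspace_direct_sum[OF this _ f(3)] laplacian_cauchy_unique[OF f(2)] show ?thesis by simp
qed

text \<open>Zero data kill the harmonic polynomial Delta^j f; injectivity of Delta^(j-1) then gives
  Delta f = 0, and the data of f itself give f = 0.\<close>

lemma inj_initial_data: "inj_on initial_data (gen_harmonics (Suc m) n k)"
proof (rule linear_on_inj_onI[OF _ subspace_gen_harmonics])
  show "linear_on (gen_harmonics (Suc m) n k) initial_data"
    using linear_initial_data by (simp add: linear_on_def linear_add linear_scale)
  fix f assume f: "f \<in> gen_harmonics (Suc m) n k" "initial_data f = 0"
  have fh: "f \<in> hspace (Suc m) n (int k)" by (rule gen_harmonics_hspace[OF f(1)])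
  have g: "Lap f \<in> hspace (Suc m) n (int k - 2)" "Lap (Rad * Lap f) = 0"
    using laplacian_hspace[OF fh] f(1) by (auto simp: gen_harmonics_eq)
  have "(Lap ^^ j) f = 0"
  proof (rule cauchy_data_zero)
    show "(Lap ^^ j) f \<in> hspace (Suc m) n (int k - 2 * int j)"
      by (rule laplacian_funpow_hspace[OF fh])
    show "Lap ((Lap ^^ j) f) = 0"
      unfolding funpow_laplacian_j by (rule funpow_laplacian_harmonic[OF g])
    show "tcoeff (Suc m) 0 ((Lap ^^ j) f) + tcoeff (Suc m) 1 ((Lap ^^ j) f) = 0"
      using f(2) by (simp add: initial_data_def zero_prod_def)
  qed
  then have "Lap f = 0"
    using funpow_laplacian_inj[OF g] by (simp add: funpow_laplacian_j)
  then show "f = 0"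
    using cauchy_data_zero[OF fh] f(2) by (simp add: initial_data_def zero_prod_def)
qed

text \<open>For surjectivity the equations are solved outwards: the second data determine a harmonic
  u, then comes g with Delta^(j-1) g = u and R^2 g harmonic, and then f with Delta f = g and the
  first data.\<close>

lemma image_initial_data:
  "initial_data ` gen_harmonics (Suc m) n k = two_degrees m n k \<times> two_degrees m n i"
proof (intro equalityI subsetI)
  fix y assume "y \<in> initial_data ` gen_harmonics (Suc m) n k"
  then obtain f where f: "f \<in> gen_harmonics (Suc m) n k" "y = initial_data f" by auto
  have fh: "f \<in> hspace (Suc m) n (int k)" by (rule gen_harmonics_hspace[OF f(1)])
  have "int k - 2 * int j = int i" using i j by linarith
  then have u: "(Lap ^^ j) f \<in> hspace (Suc m) n (int i)"
    using laplacian_funpow_hspace[OF fh, of j "Suc m" n] by simp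
  show "y \<in> two_degrees m n k \<times> two_degrees m n i"
    using tcoeff_hspace[OF fh, of 0] tcoeff_hspace[OF fh, of 1] tcoeff_hspace[OF u, of 0] tcoeff_hspace[OF u, of 1]
    unfolding f(2) initial_data_def two_degrees_def by auto
next
  fix y assume "y \<in> two_degrees m n k \<times> two_degrees m n i"
  then obtain f0 f1 u0 u1 where y: "f0 \<in> hspace m n (int k)" "f1 \<in> hspace m n (int k - 1)"
      "u0 \<in> hspace m n (int i)" "u1 \<in> hspace m n (int i - 1)" "y = (f0 + f1, u0 + u1)"
    by (auto simp: two_degrees_def)
  have zero: "0 \<in> hspace (Suc m) n (int i - 2)" by (rule subspace_0[OF subspace_hspace])
  obtain u where u: "u \<in> hspace (Suc m) n (int i)" "tcoeff (Suc m) 0 u = u0" "tcoeff (Suc m) 1 u = u1" "Lap u = 0"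
    using laplacian_cauchy_exists[OF y(3,4) zero] .
  then have "u \<in> harmonics (Suc m) n i" by (simp add: harmonics_eq)
  from funpow_laplacian_surj[OF this] obtain g where g: "g \<in> hspace (Suc m) n (int k - 2)"
      "Lap (Rad * g) = 0" "(Lap ^^ (j - 1)) g = u" by blast
  obtain f where f: "f \<in> hspace (Suc m) n (int k)" "tcoeff (Suc m) 0 f = f0" "tcoeff (Suc m) 1 f = f1" "Lap f = g"
    using laplacian_cauchy_exists[OF y(1,2) g(1)] .
  have "initial_data f = y"
    unfolding initial_data_def funpow_laplacian_j f(4) g(3) f(2,3) u(2,3) y(5) ..
  moreover have "f \<in> gen_harmonics (Suc m) n k"
    using f g by (simp add: gen_harmonics_eq)
  ultimately show "y \<in> initial_data ` gen_harmonics (Suc m) n k" by blast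
qed

end

section \<open>The direct sum of spherical harmonics and its embedding\<close>

lemma fischer_sum_add: "fischer_sum m n d (\<lambda>l. g l + h l) = fischer_sum m n d g + fischer_sum m n d h"
  and fischer_sum_scaleR: "fischer_sum m n d (\<lambda>l. c *\<^sub>R h l) = c *\<^sub>R fischer_sum m n d h"
  by (simp_all add: fischer_sum_def distrib_left sum.distrib scaleR_sum_right)

lemma R2_power_superpolys: "f \<in> superpolys m n \<Longrightarrow> R2 m n ^ s * f \<in> superpolys m n"
  by (induction s) (simp_all add: mult.assoc R2_mult_superpolys)

lemma R2_power_parity: "f \<in> parity_part p \<Longrightarrow> R2 m n ^ s * f \<in> parity_part p"
  by (induction s) (simp_all add: mult.assoc R2_mult_parity)

lemma osp_R2_power_mult: "D \<in> osp m n p \<Longrightarrow> f \<in> superpolys m n \<Longrightarrow> D (R2 m n ^ s * f) = R2 m n ^ s * D f"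
  by (induction s) (simp_all add: mult.assoc osp_R2_mult R2_power_superpolys)

lemma osp_fischer_sum:
  assumes D: "D \<in> osp m n p" and h: "\<And>l. l \<le> d \<Longrightarrow> h l \<in> harmonics m n l"
  shows "D (fischer_sum m n d h) = fischer_sum m n d (\<lambda>l. D (h l))"
proof -
  have h': "h l \<in> superpolys m n" if "l \<in> {..d}" for l
    using h[of l] that harmonics_superpolys by auto
  have "D (fischer_sum m n d h) = (\<Sum>l\<le>d. D (R2 m n ^ ((d - l) div 2) * h l))"
    unfolding fischer_sum_def by (rule sder_sum[OF osp_sder[OF D]]) (rule R2_power_superpolys[OF h'])
  then show ?thesis
    unfolding fischer_sum_def using osp_R2_power_mult[OF D h'] by simp
qed

lemma fischer_sum_parity:
  "(\<And>l. l \<le> d \<Longrightarrow> h l \<in> parity_part p) \<Longrightarrow> fischer_sum m n d h \<in> parity_part p"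
  unfolding fischer_sum_def by (intro subspace_sum subspace_parity_part R2_power_parity) auto

lemma fischer_sum_cong: "(\<And>l. l \<le> d \<Longrightarrow> g l = h l) \<Longrightarrow> fischer_sum m n d g = fischer_sum m n d h"
  unfolding fischer_sum_def by (rule sum.cong) auto

text \<open>The right-hand side of the decomposition with i = 2 - M - k, so that the single copies
  start at i + 1 = 3 - M - k.\<close>

definition double_harmonics :: "nat \<Rightarrow> nat \<Rightarrow> nat \<Rightarrow> nat \<Rightarrow>
    ((nat \<Rightarrow>\<^sub>0 superpoly \<times> superpoly) \<times> (nat \<Rightarrow>\<^sub>0 superpoly)) smodule" where
  "double_harmonics m n i k =
    dsum_family {l. l \<le> i} (\<lambda>l. harmonics_module m n l \<oplus>\<^sub>s harmonics_module m n l) \<oplus>\<^sub>s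
    dsum_family {l. i < l \<and> l \<le> k} (harmonics_module m n)"

lemma osp_module_double_harmonics: "osp_module m n (double_harmonics m n i k)"
  unfolding double_harmonics_def
  by (intro osp_module_dsum osp_module_dsum_family osp_module_harmonics)

text \<open>Selects one copy for every degree up to k: the first of the two for l <= i and the only
  one for i < l <= k. The second copies make up \<open>second_family\<close>.\<close>

definition first_family :: "nat \<Rightarrow> (nat \<Rightarrow>\<^sub>0 superpoly \<times> superpoly) \<times> (nat \<Rightarrow>\<^sub>0 superpoly) \<Rightarrow> nat \<Rightarrow> superpoly" where
  "first_family i w l =
    (if l \<le> i then fst (Poly_Mapping.lookup (fst w) l) else Poly_Mapping.lookup (snd w) l)"

definition second_family :: "(nat \<Rightarrow>\<^sub>0 superpoly \<times> superpoly) \<times> (nat \<Rightarrow>\<^sub>0 superpoly) \<Rightarrow> nat \<Rightarrow> superpoly" where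
  "second_family w l = snd (Poly_Mapping.lookup (fst w) l)"

definition fischer_data :: "nat \<Rightarrow> nat \<Rightarrow> nat \<Rightarrow> nat \<Rightarrow>
    (nat \<Rightarrow>\<^sub>0 superpoly \<times> superpoly) \<times> (nat \<Rightarrow>\<^sub>0 superpoly) \<Rightarrow> superpoly \<times> superpoly" where
  "fischer_data m n i k w =
    (fischer_sum m n k (first_family i w), fischer_sum m n i (second_family w))"

lemma linear_fischer_data: "linear (fischer_data m n i k)"
proof (rule linearI)
  have "first_family i (v + w) = (\<lambda>l. first_family i v l + first_family i w l)"
    "second_family (v + w) = (\<lambda>l. second_family v l + second_family w l)" for v w
    by (auto simp: first_family_def second_family_def lookup_add fun_eq_iff)
  then show "fischer_data m n i k (v + w) = fischer_data m n i k v + fischer_data m n i k w" for v w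
    by (simp add: fischer_data_def fischer_sum_add)
  have "first_family i (c *\<^sub>R w) = (\<lambda>l. c *\<^sub>R first_family i w l)"
    "second_family (c *\<^sub>R w) = (\<lambda>l. c *\<^sub>R second_family w l)" for c w
    by (auto simp: first_family_def second_family_def fun_eq_iff)
  then show "fischer_data m n i k (c *\<^sub>R w) = c *\<^sub>R fischer_data m n i k w" for c w
    by (simp add: fischer_data_def fischer_sum_scaleR)
qed

lemma double_harmonics_mem:
  assumes "w \<in> mspace (double_harmonics m n i k)"
  shows "l \<le> k \<Longrightarrow> first_family i w l \<in> harmonics m n l"
    and "l \<le> i \<Longrightarrow> second_family w l \<in> harmonics m n l"
  using assms
  by (auto simp: double_harmonics_def dsum_def dsum_family_def harmonics_module_def first_family_def
      second_family_def mem_Times_iff)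

lemma double_harmonics_parity:
  assumes "w \<in> mpart (double_harmonics m n i k) p"
  shows "l \<le> k \<Longrightarrow> first_family i w l \<in> parity_part p"
    and "l \<le> i \<Longrightarrow> second_family w l \<in> parity_part p"
  using assms
  by (auto simp: double_harmonics_def dsum_def dsum_family_def harmonics_module_def first_family_def
      second_family_def mem_Times_iff)

lemma double_harmonics_act:
  assumes D: "D \<in> osp m n p"
  shows "first_family i (mact (double_harmonics m n i' k) D w) l = D (first_family i w l)"
    and "second_family (mact (double_harmonics m n i' k) D w) l = D (second_family w l)"
  by (auto simp: double_harmonics_def dsum_def dsum_family_def harmonics_module_def first_family_def
      second_family_def mapp.rep_eq in_keys_iff sder_zero[OF osp_sder[OF D]] split: prod.splits)

lemma inj_fischer_data:
  assumes "odd m" "i \<le> k"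
  shows "inj_on (fischer_data m n i k) (mspace (double_harmonics m n i k))"
proof (rule linear_on_inj_onI[OF _ osp_module_subspace[OF osp_module_double_harmonics]])
  show "linear_on (mspace (double_harmonics m n i k)) (fischer_data m n i k)"
    using linear_fischer_data by (simp add: linear_on_def linear_add linear_scale)
  fix w assume w: "w \<in> mspace (double_harmonics m n i k)" "fischer_data m n i k w = 0"
  have 1: "first_family i w l = 0" if "l \<le> k" for l
    using fischer_sum_inj[OF assms(1) double_harmonics_mem(1)[OF w(1)] _ that] w(2)
    by (simp add: fischer_data_def zero_prod_def)
  have 2: "second_family w l = 0" if "l \<le> i" for l
    using fischer_sum_inj[OF assms(1) double_harmonics_mem(2)[OF w(1)] _ that] w(2)
    by (simp add: fischer_data_def zero_prod_def)
  have keys: "Poly_Mapping.keys (fst w) \<subseteq> {l. l \<le> i}" "Poly_Mapping.keys (snd w) \<subseteq> {l. i < l \<and> l \<le> k}"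
    using w(1) by (auto simp: double_harmonics_def dsum_def dsum_family_def)
  have "fst w = 0"
  proof (rule poly_mapping_eqI)
    fix l
    show "Poly_Mapping.lookup (fst w) l = Poly_Mapping.lookup 0 l"
    proof (cases "l \<le> i")
      case True
      then show ?thesis
        using 1[of l] 2[of l] assms(2) by (simp add: first_family_def second_family_def prod_eq_iff)
    next
      case False
      then show ?thesis using keys(1) by (auto simp: in_keys_iff)
    qed
  qed
  moreover have "snd w = 0"
  proof (rule poly_mapping_eqI)
    fix l
    show "Poly_Mapping.lookup (snd w) l = Poly_Mapping.lookup 0 l"
    proof (cases "i < l \<and> l \<le> k")
      case True
      then show ?thesis
        using 1[of l] by (simp add: first_family_def)
    next
      case False
      then show ?thesis using keys(2) by (auto simp: in_keys_iff)
    qed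
  qed
  ultimately show "w = 0" by (simp add: prod_eq_iff)
qed

lemma image_fischer_data:
  assumes "odd m" "i \<le> k"
  shows "fischer_data m n i k ` mspace (double_harmonics m n i k) = two_degrees m n k \<times> two_degrees m n i"
proof (intro equalityI subsetI)
  fix y assume "y \<in> fischer_data m n i k ` mspace (double_harmonics m n i k)"
  then show "y \<in> two_degrees m n k \<times> two_degrees m n i"
    by (auto simp: fischer_data_def intro!: fischer_sum_two_degrees double_harmonics_mem)
next
  fix y assume "y \<in> two_degrees m n k \<times> two_degrees m n i"
  then obtain f0 f1 u0 u1 where y: "f0 \<in> hspace m n (int k)" "f1 \<in> hspace m n (int k - 1)"
      "u0 \<in> hspace m n (int i)" "u1 \<in> hspace m n (int i - 1)" "y = (f0 + f1, u0 + u1)"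
    by (auto simp: two_degrees_def)
  obtain g where g: "\<forall>l\<le>k. g l \<in> harmonics m n l" "fischer_sum m n k g = f0 + f1"
    using fischer_sum_surj[OF assms(1) y(1,2)] by blast
  obtain h where h: "\<forall>l\<le>i. h l \<in> harmonics m n l" "fischer_sum m n i h = u0 + u1"
    using fischer_sum_surj[OF assms(1) y(3,4)] by blast
  define v1 :: "nat \<Rightarrow>\<^sub>0 superpoly \<times> superpoly" where "v1 = (\<Sum>l\<le>i. Poly_Mapping.single l (g l, h l))"
  define v2 :: "nat \<Rightarrow>\<^sub>0 superpoly" where "v2 = (\<Sum>l\<in>{i<..k}. Poly_Mapping.single l (g l))"
  have v1: "Poly_Mapping.lookup v1 l = (if l \<le> i then (g l, h l) else 0)" for l
    by (simp add: v1_def lookup_sum lookup_single when_def)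
  have v2: "Poly_Mapping.lookup v2 l = (if i < l \<and> l \<le> k then g l else 0)" for l
    by (simp add: v2_def lookup_sum lookup_single when_def)
  have "(v1, v2) \<in> mspace (double_harmonics m n i k)"
    using g(1) h(1) assms(2)
    by (auto simp: double_harmonics_def dsum_def dsum_family_def harmonics_module_def v1 v2 in_keys_iff split: if_splits)
  moreover have "fischer_data m n i k (v1, v2) = y"
  proof -
    have "fischer_sum m n k (first_family i (v1, v2)) = fischer_sum m n k g"
      "fischer_sum m n i (second_family (v1, v2)) = fischer_sum m n i h"
      by (auto intro!: fischer_sum_cong simp: first_family_def second_family_def v1 v2)
    then show ?thesis by (simp add: fischer_data_def g(2) h(2) y(5))
  qed
  ultimately show "y \<in> fischer_data m n i k ` mspace (double_harmonics m n i k)" by (metis image_eqI)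
qed

text \<open>Both sides embed onto the product of \<open>two_degrees m n k\<close> and
  \<open>two_degrees m n i\<close> with the diagonal action. Here \<open>m\<close> counts the even
  coordinates other than t; it is odd because m + 1 = 2n - 2a, as the Fischer decomposition
  requires.\<close>

lemma gen_harmonics_isomorphic:
  assumes "Suc m + 2 * a = 2 * n" "a + 2 \<le> k" "k \<le> 2 * a + 2" "i + k = 2 * a + 2"
  shows "osp_isomorphic m n (gen_harmonics_restricted (Suc m) n k) (double_harmonics m n i k)"
proof -
  \<comment> \<open>From 2j = k - i and i = 2a + 2 - k.\<close>
  define j where "j = k - 1 - a"
  have j: "j + 1 + a = k" using assms(2) by (simp add: j_def)
  have "odd m" using assms(1) by presburger
  have "i \<le> k" using assms by linarith
  note ctx = assms j
  have space: "mspace (gen_harmonics_restricted (Suc m) n k) = gen_harmonics (Suc m) n k"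
    by (simp add: gen_harmonics_restricted_def)
  let ?\<rho> = "\<lambda>D :: superpoly \<Rightarrow> superpoly. \<lambda>(f, g). (D f, D g)"
  let ?X = "\<lambda>p. parity_part p \<times> parity_part p"
  show ?thesis
  proof (rule osp_isomorphic_common_image[where a = "initial_data m n j" and b = "fischer_data m n i k"
        and X = ?X and \<rho> = ?\<rho>])
    show "osp_module m n (gen_harmonics_restricted (Suc m) n k)"
      by (rule osp_module_gen_harmonics_restricted)
    show "osp_module m n (double_harmonics m n i k)"
      by (rule osp_module_double_harmonics)
    show "linear_on (mspace (gen_harmonics_restricted (Suc m) n k)) (initial_data m n j)"
      using linear_initial_data[OF ctx] by (simp add: linear_on_def linear_add linear_scale)
    show "inj_on (initial_data m n j) (mspace (gen_harmonics_restricted (Suc m) n k))"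
      unfolding space by (rule inj_initial_data[OF ctx])
    show "linear_on (mspace (double_harmonics m n i k)) (fischer_data m n i k)"
      using linear_fischer_data by (simp add: linear_on_def linear_add linear_scale)
    show "inj_on (fischer_data m n i k) (mspace (double_harmonics m n i k))"
      by (rule inj_fischer_data[OF \<open>odd m\<close> \<open>i \<le> k\<close>])
    show "initial_data m n j ` mspace (gen_harmonics_restricted (Suc m) n k) =
        fischer_data m n i k ` mspace (double_harmonics m n i k)"
      unfolding space image_initial_data[OF ctx] image_fischer_data[OF \<open>odd m\<close> \<open>i \<le> k\<close>] ..
    show "subspace (?X p)" for p
      by (intro subspace_Times subspace_parity_part)
    show "?X 0 \<inter> ?X 1 \<subseteq> {0}"
      using parity_part_disjoint[of _ 0 1] by (auto simp: zero_prod_def)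
    show "initial_data m n j ` mpart (gen_harmonics_restricted (Suc m) n k) p \<subseteq> ?X p" for p
      by (auto simp: gen_harmonics_restricted_def initial_data_def[OF ctx]
          intro!: subspace_add[OF subspace_parity_part] tcoeff_parity laplacian_funpow_parity)
    show "fischer_data m n i k ` mpart (double_harmonics m n i k) p \<subseteq> ?X p" for p
      using \<open>i \<le> k\<close> by (auto simp: fischer_data_def intro!: fischer_sum_parity double_harmonics_parity)
  next
    fix p D v
    assume D: "D \<in> osp m n p" and v: "v \<in> mspace (gen_harmonics_restricted (Suc m) n k)"
    have v': "v \<in> superpolys (Suc m) n"
      using v gen_harmonics_superpolys unfolding space by blast
    note u = laplacian_funpow_superpolys[OF v', of j "Suc m" n]
    note E = tcoeff_coeffwise[OF osp_sder[OF D]]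
    have "mact (gen_harmonics_restricted (Suc m) n k) D v = coeffwise (Suc m) D v"
      using extend_der_eq[OF osp_sder[OF D] v'] by (simp add: gen_harmonics_restricted_def)
    then show "initial_data m n j (mact (gen_harmonics_restricted (Suc m) n k) D v) =
        ?\<rho> D (initial_data m n j v)"
      by (simp add: initial_data_def[OF ctx] coeffwise_laplacian_funpow[OF D v', symmetric] E[OF v'] E[OF u]
          sder_add[OF osp_sder[OF D] tcoeff_superpolys[OF v'] tcoeff_superpolys[OF v']]
          sder_add[OF osp_sder[OF D] tcoeff_superpolys[OF u] tcoeff_superpolys[OF u]])
  next
    fix p D w
    assume D: "D \<in> osp m n p" and w: "w \<in> mspace (double_harmonics m n i k)"
    show "fischer_data m n i k (mact (double_harmonics m n i k) D w) = ?\<rho> D (fischer_data m n i k w)"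
      by (simp add: fischer_data_def double_harmonics_act[OF D] cong: fischer_sum_cong)
        (simp add: osp_fischer_sum[OF D] double_harmonics_mem[OF w])
  qed
qed

theorem theorem3:
  fixes m n k :: nat and M :: int
  assumes "m \<ge> 1"
    and "M = int m - 2 * int n"
    and "\<exists>j::nat. M = - 2 * int j"
    and "k \<in> I_M M"
  shows "osp_isomorphic (m - 1) n (gen_harmonics_restricted m n k)
      (dsum_family {l. int l \<le> 2 - M - int k}
         (\<lambda>l. harmonics_module (m - 1) n l \<oplus>\<^sub>s harmonics_module (m - 1) n l) \<oplus>\<^sub>s
       dsum_family {l. 3 - M - int k \<le> int l \<and> l \<le> k} (harmonics_module (m - 1) n)) \<and>
    (\<forall>l \<in> {l. int l \<le> 2 - M - int k} \<union> {l. 3 - M - int k \<le> int l \<and> l \<le> k}.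
      osp_irreducible (m - 1) n (harmonics_module (m - 1) n l))"
proof -
  obtain a :: nat where a: "M = - 2 * int a" using assms(3) by blast
  have ma: "m + 2 * a = 2 * n" using a assms(2) by linarith
  \<comment> \<open>\<open>m\<close> is even together with \<open>M\<close>, so at least one even
    coordinate remains besides t; the irreducibility argument rotates it.\<close>
  then have "m \<noteq> 1" by presburger
  with assms(1) obtain \<nu> where \<nu>: "m = Suc (Suc \<nu>)"
    by (metis One_nat_def not0_implies_Suc not_one_le_zero)
  have "real k \<ge> 2 + real a" "real k \<le> 2 + 2 * real a"
    using assms(4) by (simp_all add: I_M_def a)
  then have k: "a + 2 \<le> k" "k \<le> 2 * a + 2" by linarith+
  define i where "i = 2 * a + 2 - k"
  have i: "i + k = 2 * a + 2" using k by (simp add: i_def)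
  have sets: "{l. int l \<le> 2 - M - int k} = {l. l \<le> i}"
      "{l. 3 - M - int k \<le> int l \<and> l \<le> k} = {l. i < l \<and> l \<le> k}"
    using i a by auto
  have "osp_isomorphic (m - 1) n (gen_harmonics_restricted m n k) (double_harmonics (m - 1) n i k)"
    using gen_harmonics_isomorphic[of "m - 1" a n k i] ma k i \<nu> by simp
  moreover have "osp_irreducible (m - 1) n (harmonics_module (m - 1) n l)" if "l \<le> k" for l
  proof -
    \<comment> \<open>The bound is k <= 2 - M read as l <= k <= 2n - \<nu>.\<close>
    have "even \<nu>" "l + \<nu> \<le> 2 * n" using ma that k \<nu> by presburger+
    from harmonics_irreducible[OF this] show ?thesis by (simp add: \<nu>)
  qed
  moreover have "i \<le> k" using i k by linarith
  ultimately show ?thesis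
    unfolding sets double_harmonics_def by auto
qed

end
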